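(* Let $F$ be a field of characteristic different from $2$ and $3$, let $\mathbb{M}$ be a $7$-dimensional exceptional Malcev algebra over $F$, and let $\mathcal{M}$ be a Malcev algebra over $F$ in the variety $\mathcal{H}$ containing $\mathbb{M}$ as a subalgebra. Then $\mathcal{M}$ is isomorphic to a direct sum $(\mathbb{M}\otimes_F A)\oplus\mathcal{N}$, where $A$ is a certain commutative associative $F$-algebra and $\mathcal{N}$ is the ideal $\{x\in\mathcal{M}: J(x,\mathbb{M},\mathbb{M})=0\}$ of $\mathcal{M}$.
   Context: A Malcev algebra over $F$ is an $F$-vector space with a bilinear product $(x,y)\mapsto xy$ satisfying $x^2=0$ and $J(x,y,xz)=J(x,y,z)x$, where $J(x,y,z)=(xy)z+(yz)x+(zx)y$. No finite-dimensionality is assumed. $J(x,\mathbb{M},\mathbb{M})=0$ means $J(x,a,b)=0$ for all $a,b\in\mathbb{M}$. Put $\{x,y,z\}=(xy)z-(xz)y+2x(yz)$ and $$h(y,z,t,x,u)=\{yz,t,u\}x+\{yz,t,x\}u+\{yx,z,u\}t+\{yu,z,x\}t.$$ The variety $\mathcal{H}$ is the class of Malcev algebras over $F$ satisfying the identity $h(y,z,t,x,u)=0$. The exceptional algebra $\mathbb{M}$: it denotes either of the following $7$-dimensional simple non-Lie Malcev algebras. (1) $\mathcal{M}_7(F)=C(F)^{(-)}/F\cdot e_0$, where $C(F)$ is the split Cayley-Dickson matrix algebra of matrices $\begin{bmatrix} a&\alpha\\ \beta&b\end{bmatrix}$ with $a,b\in F$, $\alpha,\beta\in F^3$, entrywise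 addition, and product $$\begin{bmatrix} a&\alpha\\ \beta&b\end{bmatrix}\begin{bmatrix} c&\gamma\\ \delta&d\end{bmatrix}=\begin{bmatrix} ac+\alpha\bullet\delta & a\gamma+d\alpha-\beta\times\delta\\ c\beta+b\delta+\alpha\times\gamma & \beta\bullet\gamma+bd\end{bmatrix}$$ ($\bullet$ the scalar product, $\times$ the vector product on $F^3$), $e_0$ is the identity matrix, and $A^{(-)}$ denotes the vector space $A$ with product $[x,y]=xy-yx$. (2) $\mathbb{M}_7=\mathbb{O}^{(-)}/F\cdot 1$, where $\mathbb{O}=\mathbb{H}\oplus v\mathbb{H}$ is a division Cayley-Dickson algebra over $F$ obtained from a division quaternion algebra $\mathbb{H}$ with basis $1,i,j,k$, $i^2=j^2=k^2=-1$, and canonical involution $a\mapsto\bar a$, with $v^2=\gamma\in F$, $\gamma\ne 0$, and $aw=w\bar a$ for $a\in\mathbb{H}$, $w\in v\mathbb{H}$, and $(ab)v=b(av)$, $v(ab)=(vb)a$, $(va)(vb)=\gamma b\bar a$ for $a,b\in\mathbb{H}$. The product on $\mathbb{M}\otimes_F A$ is $(a\otimes u)(b\otimes w)=ab\otimes uw$. *)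

theory Defs
  imports "HOL-Analysis.Cartesian_Space" "HOL-Library.Poly_Mapping" "HOL-Library.Set_Algebras"
begin

section \<open>Malcev algebras and the variety H\<close>

text \<open>Algebras are neither assumed associative nor unital, and no dimension is bounded.\<close>

locale nonassoc_algebra = vector_space scl
  for scl :: "'f::field \<Rightarrow> 'm::ab_group_add \<Rightarrow> 'm" +
  fixes mult :: "'m \<Rightarrow> 'm \<Rightarrow> 'm" (infixl "\<cdot>" 70)
  assumes linear_mult_left: "Vector_Spaces.linear scl scl (\<lambda>x. x \<cdot> y)"
    and linear_mult_right: "Vector_Spaces.linear scl scl (\<lambda>y. x \<cdot> y)"

definition jacobian :: "('m::ab_group_add \<Rightarrow> 'm \<Rightarrow> 'm) \<Rightarrow> 'm \<Rightarrow> 'm \<Rightarrow> 'm \<Rightarrow> 'm" where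
  "jacobian mult x y z = mult (mult x y) z + mult (mult y z) x + mult (mult z x) y"

locale malcev_algebra = nonassoc_algebra +
  assumes mult_self: "x \<cdot> x = 0"
    and malcev: "jacobian (\<cdot>) x y (x \<cdot> z) = jacobian (\<cdot>) x y z \<cdot> x"

definition brace ::
  "('f::field \<Rightarrow> 'm::ab_group_add \<Rightarrow> 'm) \<Rightarrow> ('m \<Rightarrow> 'm \<Rightarrow> 'm) \<Rightarrow> 'm \<Rightarrow> 'm \<Rightarrow> 'm \<Rightarrow> 'm" where
  "brace scl mult x y z =
     mult (mult x y) z - mult (mult x z) y + scl 2 (mult x (mult y z))"

definition h_poly ::
  "('f::field \<Rightarrow> 'm::ab_group_add \<Rightarrow> 'm) \<Rightarrow> ('m \<Rightarrow> 'm \<Rightarrow> 'm) \<Rightarrow> 'm \<Rightarrow> 'm \<Rightarrow> 'm \<Rightarrow> 'm \<Rightarrow> 'm \<Rightarrow> 'm"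
  where
  "h_poly scl mult y z t x u =
     mult (brace scl mult (mult y z) t u) x + mult (brace scl mult (mult y z) t x) u +
     mult (brace scl mult (mult y x) z u) t + mult (brace scl mult (mult y u) z x) t"

locale malcev_algebra_H = malcev_algebra +
  assumes h_identity: "h_poly scl (\<cdot>) y z t x u = 0"

definition subalgebra ::
  "('f::field \<Rightarrow> 'm::ab_group_add \<Rightarrow> 'm) \<Rightarrow> ('m \<Rightarrow> 'm \<Rightarrow> 'm) \<Rightarrow> 'm set \<Rightarrow> bool" where
  "subalgebra scl mult B \<longleftrightarrow> module.subspace scl B \<and> (\<forall>x\<in>B. \<forall>y\<in>B. mult x y \<in> B)"

definition alg_ideal ::
  "('f::field \<Rightarrow> 'm::ab_group_add \<Rightarrow> 'm) \<Rightarrow> ('m \<Rightarrow> 'm \<Rightarrow> 'm) \<Rightarrow> 'm set \<Rightarrow> bool" where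
  "alg_ideal scl mult I \<longleftrightarrow>
     module.subspace scl I \<and> (\<forall>x\<in>I. \<forall>y. mult x y \<in> I \<and> mult y x \<in> I)"

definition jacobian_annihilator :: "('m::ab_group_add \<Rightarrow> 'm \<Rightarrow> 'm) \<Rightarrow> 'm set \<Rightarrow> 'm set" where
  "jacobian_annihilator mult B = {x. \<forall>a\<in>B. \<forall>b\<in>B. jacobian mult x a b = 0}"


section \<open>Algebras with an explicit carrier\<close>

text \<open>Quotients, tensor products and an existentially quantified algebra do not live on the
  whole of a type, so they carry their operations explicitly.\<close>

record ('f, 'a) alg =
  carrier :: "'a set"
  add :: "'a \<Rightarrow> 'a \<Rightarrow> 'a"
  zero :: 'a
  smul :: "'f \<Rightarrow> 'a \<Rightarrow> 'a"
  mul :: "'a \<Rightarrow> 'a \<Rightarrow> 'a"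

definition alg_on ::
  "('f \<Rightarrow> 'a::ab_group_add \<Rightarrow> 'a) \<Rightarrow> ('a \<Rightarrow> 'a \<Rightarrow> 'a) \<Rightarrow> 'a set \<Rightarrow> ('f, 'a) alg" where
  "alg_on scl mult S = \<lparr>carrier = S, add = (+), zero = 0, smul = scl, mul = mult\<rparr>"

locale comm_assoc_algebra =
  fixes A :: "('f::field, 'a) alg"
  assumes add_closed: "\<lbrakk>x \<in> carrier A; y \<in> carrier A\<rbrakk> \<Longrightarrow> add A x y \<in> carrier A"
    and zero_closed: "zero A \<in> carrier A"
    and smul_closed: "x \<in> carrier A \<Longrightarrow> smul A c x \<in> carrier A"
    and mul_closed: "\<lbrakk>x \<in> carrier A; y \<in> carrier A\<rbrakk> \<Longrightarrow> mul A x y \<in> carrier A"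
    and add_assoc: "\<lbrakk>x \<in> carrier A; y \<in> carrier A; z \<in> carrier A\<rbrakk>
      \<Longrightarrow> add A (add A x y) z = add A x (add A y z)"
    and add_comm: "\<lbrakk>x \<in> carrier A; y \<in> carrier A\<rbrakk> \<Longrightarrow> add A x y = add A y x"
    and add_zero: "x \<in> carrier A \<Longrightarrow> add A x (zero A) = x"
    and add_inverse: "x \<in> carrier A \<Longrightarrow> \<exists>y\<in>carrier A. add A x y = zero A"
    and smul_add: "\<lbrakk>x \<in> carrier A; y \<in> carrier A\<rbrakk>
      \<Longrightarrow> smul A c (add A x y) = add A (smul A c x) (smul A c y)"
    and add_smul: "x \<in> carrier A \<Longrightarrow> smul A (c + d) x = add A (smul A c x) (smul A d x)"
    and smul_smul: "x \<in> carrier A \<Longrightarrow> smul A c (smul A d x) = smul A (c * d) x"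
    and smul_one: "x \<in> carrier A \<Longrightarrow> smul A 1 x = x"
    and mul_add: "\<lbrakk>x \<in> carrier A; y \<in> carrier A; z \<in> carrier A\<rbrakk>
      \<Longrightarrow> mul A x (add A y z) = add A (mul A x y) (mul A x z)"
    and mul_smul: "\<lbrakk>x \<in> carrier A; y \<in> carrier A\<rbrakk>
      \<Longrightarrow> mul A x (smul A c y) = smul A c (mul A x y)"
    and mul_comm: "\<lbrakk>x \<in> carrier A; y \<in> carrier A\<rbrakk> \<Longrightarrow> mul A x y = mul A y x"
    and mul_assoc: "\<lbrakk>x \<in> carrier A; y \<in> carrier A; z \<in> carrier A\<rbrakk>
      \<Longrightarrow> mul A (mul A x y) z = mul A x (mul A y z)"

definition alg_isomorphic :: "('f, 'a) alg \<Rightarrow> ('f, 'b) alg \<Rightarrow> bool" where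
  "alg_isomorphic X Y \<longleftrightarrow>
     (\<exists>\<phi>. bij_betw \<phi> (carrier X) (carrier Y) \<and>
        (\<forall>x\<in>carrier X. \<forall>y\<in>carrier X. \<phi> (add X x y) = add Y (\<phi> x) (\<phi> y)) \<and>
        (\<forall>c. \<forall>x\<in>carrier X. \<phi> (smul X c x) = smul Y c (\<phi> x)) \<and>
        (\<forall>x\<in>carrier X. \<forall>y\<in>carrier X. \<phi> (mul X x y) = mul Y (\<phi> x) (\<phi> y)))"

definition direct_sum :: "('f, 'a) alg \<Rightarrow> ('f, 'b) alg \<Rightarrow> ('f, 'a \<times> 'b) alg" where
  "direct_sum X Y =
     \<lparr>carrier = carrier X \<times> carrier Y,
      add = (\<lambda>p q. (add X (fst p) (fst q), add Y (snd p) (snd q))),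
      zero = (zero X, zero Y),
      smul = (\<lambda>c p. (smul X c (fst p), smul Y c (snd p))),
      mul = (\<lambda>p q. (mul X (fst p) (fst q), mul Y (snd p) (snd q)))\<rparr>"

text \<open>The quotient \<open>S / K\<close>, whose elements are the cosets \<open>x +o K\<close>. The operations on cosets
  are formed over all representatives, which gives a single coset when \<open>K\<close> is an ideal of \<open>S\<close>.\<close>

definition quotient_alg ::
  "('f \<Rightarrow> 'a::ab_group_add \<Rightarrow> 'a) \<Rightarrow> ('a \<Rightarrow> 'a \<Rightarrow> 'a) \<Rightarrow> 'a set \<Rightarrow> 'a set \<Rightarrow> ('f, 'a set) alg"
  where
  "quotient_alg scl mult S K =
     \<lparr>carrier = (\<lambda>x. x +o K) ` S,
      add = (\<lambda>X Y. \<Union>x\<in>X. \<Union>y\<in>Y. (x + y) +o K),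
      zero = K,
      smul = (\<lambda>c X. \<Union>x\<in>X. scl c x +o K),
      mul = (\<lambda>X Y. \<Union>x\<in>X. \<Union>y\<in>Y. mult x y +o K)\<rparr>"


section \<open>Tensor products\<close>

text \<open>\<open>X \<otimes> A\<close> is the free vector space on \<open>carrier X \<times> carrier A\<close> modulo the bilinearity
  relations; the product is induced by \<open>(x, a) (y, b) = (x y, a b)\<close>. For fixed \<open>x \<noteq> 0\<close> in \<open>X\<close> the
  map taking \<open>a\<close> to \<open>x \<otimes> a\<close> is injective, so a coordinate algebra \<open>A\<close> of an algebra on a type
  \<open>'m\<close> can always be taken with its carrier in \<open>'m\<close>.\<close>

definition free_scale :: "'f::field \<Rightarrow> ('k \<Rightarrow>\<^sub>0 'f) \<Rightarrow> ('k \<Rightarrow>\<^sub>0 'f)" where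
  "free_scale c p = Poly_Mapping.map (\<lambda>d. c * d) p"

abbreviation pure_tensor :: "'a \<Rightarrow> 'b \<Rightarrow> ('a \<times> 'b \<Rightarrow>\<^sub>0 'f::field)" where
  "pure_tensor x a \<equiv> Poly_Mapping.single (x, a) 1"

definition free_mult ::
  "('f::field, 'a) alg \<Rightarrow> ('f, 'b) alg \<Rightarrow>
     ('a \<times> 'b \<Rightarrow>\<^sub>0 'f) \<Rightarrow> ('a \<times> 'b \<Rightarrow>\<^sub>0 'f) \<Rightarrow> ('a \<times> 'b \<Rightarrow>\<^sub>0 'f)" where
  "free_mult X A p q =
     (\<Sum>(x, a)\<in>Poly_Mapping.keys p. \<Sum>(y, b)\<in>Poly_Mapping.keys q.
        free_scale (Poly_Mapping.lookup p (x, a) * Poly_Mapping.lookup q (y, b))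
          (pure_tensor (mul X x y) (mul A a b)))"

definition tensor_relations ::
  "('f::field, 'a) alg \<Rightarrow> ('f, 'b) alg \<Rightarrow> ('a \<times> 'b \<Rightarrow>\<^sub>0 'f) set" where
  "tensor_relations X A =
     {pure_tensor (add X x y) a - pure_tensor x a - pure_tensor y a | x y a.
        x \<in> carrier X \<and> y \<in> carrier X \<and> a \<in> carrier A} \<union>
     {pure_tensor x (add A a b) - pure_tensor x a - pure_tensor x b | x a b.
        x \<in> carrier X \<and> a \<in> carrier A \<and> b \<in> carrier A} \<union>
     {pure_tensor (smul X c x) a - free_scale c (pure_tensor x a) | c x a.
        x \<in> carrier X \<and> a \<in> carrier A} \<union>
     {pure_tensor x (smul A c a) - free_scale c (pure_tensor x a) | c x a.
        x \<in> carrier X \<and> a \<in> carrier A}"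

definition tensor_alg ::
  "('f::field, 'a) alg \<Rightarrow> ('f, 'b) alg \<Rightarrow> ('f, ('a \<times> 'b \<Rightarrow>\<^sub>0 'f) set) alg" where
  "tensor_alg X A =
     quotient_alg free_scale (free_mult X A)
       {p. Poly_Mapping.keys p \<subseteq> carrier X \<times> carrier A}
       (module.span free_scale (tensor_relations X A))"

lemma lookup_free_scale: "Poly_Mapping.lookup (free_scale c p) k = c * Poly_Mapping.lookup p k"
  by (simp add: free_scale_def Poly_Mapping.map.rep_eq when_def)

lemma vector_space_free_scale: "vector_space (free_scale :: 'f::field \<Rightarrow> ('k \<Rightarrow>\<^sub>0 'f) \<Rightarrow> _)"
  by unfold_locales
    (auto intro!: poly_mapping_eqI simp: lookup_free_scale lookup_add algebra_simps)


section \<open>The exceptional algebras\<close>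

definition commutator :: "('a::ab_group_add \<Rightarrow> 'a \<Rightarrow> 'a) \<Rightarrow> 'a \<Rightarrow> 'a \<Rightarrow> 'a" where
  "commutator mult x y = mult x y - mult y x"

subsection \<open>The split Cayley-Dickson matrix algebra\<close>

text \<open>The tuple \<open>(a, \<alpha>, \<beta>, b)\<close> is the matrix with first row \<open>a, \<alpha>\<close> and second row \<open>\<beta>, b\<close>.\<close>

type_synonym 'f zorn = "'f \<times> ('f ^ 3) \<times> ('f ^ 3) \<times> 'f"

definition dot3 :: "'f::field ^ 3 \<Rightarrow> 'f ^ 3 \<Rightarrow> 'f" where
  "dot3 u v = (\<Sum>i\<in>UNIV. u $ i * v $ i)"

definition vec_prod3 :: "'f::field ^ 3 \<Rightarrow> 'f ^ 3 \<Rightarrow> 'f ^ 3" where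
  "vec_prod3 u v =
     vector [u $ 2 * v $ 3 - u $ 3 * v $ 2,
             u $ 3 * v $ 1 - u $ 1 * v $ 3,
             u $ 1 * v $ 2 - u $ 2 * v $ 1]"

definition zorn_scale :: "'f::field \<Rightarrow> 'f zorn \<Rightarrow> 'f zorn" where
  "zorn_scale k = (\<lambda>(a, \<alpha>, \<beta>, b). (k * a, k *s \<alpha>, k *s \<beta>, k * b))"

definition zorn_mult :: "'f::field zorn \<Rightarrow> 'f zorn \<Rightarrow> 'f zorn" where
  "zorn_mult = (\<lambda>(a, \<alpha>, \<beta>, b) (c, \<gamma>, \<delta>, d).
     (a * c + dot3 \<alpha> \<delta>,
      a *s \<gamma> + d *s \<alpha> - vec_prod3 \<beta> \<delta>,
      c *s \<beta> + b *s \<delta> + vec_prod3 \<alpha> \<gamma>,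
      dot3 \<beta> \<gamma> + b * d))"

definition zorn_e0 :: "'f::field zorn" where
  "zorn_e0 = (1, 0, 0, 1)"

definition split_M7 :: "('f::field, 'f zorn set) alg" where
  "split_M7 = quotient_alg zorn_scale (commutator zorn_mult) UNIV (range (\<lambda>k. zorn_scale k zorn_e0))"

subsection \<open>Cayley-Dickson algebras over a quaternion algebra\<close>

definition division_mult :: "('a::zero \<Rightarrow> 'a \<Rightarrow> 'a) \<Rightarrow> bool" where
  "division_mult mult \<longleftrightarrow>
     (\<forall>a b. a \<noteq> 0 \<longrightarrow> (\<exists>!x. mult a x = b) \<and> (\<exists>!x. mult x a = b))"

text \<open>Coordinates are taken with respect to \<open>1, i, j, k\<close>, where \<open>i j = k\<close>.\<close>

type_synonym 'f quat = "'f \<times> 'f \<times> 'f \<times> 'f"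

definition quat_scale :: "'f::field \<Rightarrow> 'f quat \<Rightarrow> 'f quat" where
  "quat_scale k = (\<lambda>(a, b, c, d). (k * a, k * b, k * c, k * d))"

definition quat_mult :: "'f::field quat \<Rightarrow> 'f quat \<Rightarrow> 'f quat" where
  "quat_mult = (\<lambda>(a, b, c, d) (a', b', c', d').
     (a * a' - b * b' - c * c' - d * d',
      a * b' + b * a' + c * d' - d * c',
      a * c' - b * d' + c * a' + d * b',
      a * d' + b * c' - c * b' + d * a'))"

definition quat_conj :: "'f::field quat \<Rightarrow> 'f quat" where
  "quat_conj = (\<lambda>(a, b, c, d). (a, - b, - c, - d))"

text \<open>The pair \<open>(a, b)\<close> stands for \<open>a + v b\<close>. From \<open>a (v d) = (v d) a\<^sup>*\<close>, \<open>(v b) a = v (a b)\<close> and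
  \<open>(v b) (v d) = \<gamma> (d b\<^sup>*)\<close>, where the star is the involution, one gets
  \<open>(a + v b) (c + v d) = (a c + \<gamma> (d b\<^sup>*)) + v (a\<^sup>* d + c b)\<close>.\<close>

type_synonym 'f oct = "'f quat \<times> 'f quat"

definition oct_scale :: "'f::field \<Rightarrow> 'f oct \<Rightarrow> 'f oct" where
  "oct_scale k = (\<lambda>(a, b). (quat_scale k a, quat_scale k b))"

definition oct_mult :: "'f::field \<Rightarrow> 'f oct \<Rightarrow> 'f oct \<Rightarrow> 'f oct" where
  "oct_mult \<gamma> = (\<lambda>(a, b) (c, d).
     (quat_mult a c + quat_scale \<gamma> (quat_mult d (quat_conj b)),
      quat_mult (quat_conj a) d + quat_mult c b))"

definition oct_one :: "'f::field oct" where
  "oct_one = ((1, 0, 0, 0), 0)"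

definition division_M7 :: "'f::field \<Rightarrow> ('f, 'f oct set) alg" where
  "division_M7 \<gamma> =
     quotient_alg oct_scale (commutator (oct_mult \<gamma>)) UNIV (range (\<lambda>k. oct_scale k oct_one))"

definition exceptional_malcev :: "('f::field, 'm) alg \<Rightarrow> bool" where
  "exceptional_malcev X \<longleftrightarrow>
     alg_isomorphic X (split_M7 :: ('f, 'f zorn set) alg) \<or>
     (\<exists>\<gamma>. \<gamma> \<noteq> 0 \<and> division_mult (quat_mult :: 'f quat \<Rightarrow> _) \<and> division_mult (oct_mult \<gamma>) \<and>
        alg_isomorphic X (division_M7 \<gamma>))"

end

theory Submission
  imports Defs
begin

text \<open>
  Both exceptional algebras are the imaginary octonions with the commutator product, the octonions
  being doubled from the quaternions with \<open>i\<^sup>2 = j\<^sup>2 = -1\<close> by some \<open>v\<^sup>2 = \<gamma> \<noteq> 0\<close>; the split case is \<open>\<gamma> = 1\<close>.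
  So \<open>B\<close> is the image of an injective map \<open>\<iota>\<close> on a seven-dimensional space \<open>V\<close> with a product
  \<open>\<otimes>\<close> and a symmetric form \<open>q\<close> that satisfy \<open>q(x \<otimes> y, y) = 0\<close> and
  \<open>(x \<otimes> y) \<otimes> y = 4 q(x, y) y - 4 q(y, y) x\<close>. These laws and an orthogonal basis \<open>E\<close> of \<open>V\<close> whose
  elements multiply like octonion units are all that the argument uses of \<open>B\<close>.

  Write \<open>x \<star> v\<close> for \<open>x \<cdot> \<iota> v\<close> and call a linear map \<open>\<phi>\<close> from \<open>V\<close> to the algebra a homomorphism if
  \<open>\<phi> v \<star> w = \<phi> (v \<otimes> w)\<close>. The first half shows that the algebra is the direct sum of the span
  \<open>isotypic\<close> of all images of homomorphisms and of the annihilator \<open>ann\<close> of \<open>B\<close>, which is also the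
  ideal \<open>N\<close>. On \<open>V\<close> itself the operator \<open>x \<star> f \<star> b + 2 (x \<star> b \<star> f) - x \<star> (f \<otimes> b)\<close> (\<open>tri\<close>) is, up
  to the factor 12 and a multiple of the identity, the matrix unit sending \<open>v\<close> to \<open>q(v, f) b\<close>. In
  general, \<open>vol x f b c\<close> is the quantity that equals \<open>12 q(f, b \<otimes> c) x\<close> wherever this is so. The
  identity \<open>h\<close> with the module element in its third slot, together with Sagle's form of the
  Malcev identity, says that \<open>vol\<close> is alternating; with the module element in its second slot,
  \<open>h\<close> says that \<open>vol x (y \<otimes> a) a t = - vol x y a (t \<otimes> a)\<close>.
  These two facts leave only \<open>vol x f b c = 12 q(f, b \<otimes> c) Z x\<close> for one operator \<open>Z\<close> (\<open>iso_part\<close>), and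
  \<open>Z\<close> turns out to be the projection onto \<open>isotypic\<close> along \<open>ann\<close> (\<open>vol_eq\<close>, \<open>iso_part_act\<close>,
  \<open>act_in_isotypic\<close>). The corrected matrix units \<open>munit x f\<close> are then homomorphisms.

  The second half computes products. Sagle's identity gives \<open>ann \<cdot> isotypic = 0\<close> and
  \<open>ann \<cdot> ann \<subseteq> ann\<close>. For homomorphisms \<open>\<phi>\<close>, \<open>\<psi>\<close> it gives, with \<open>h\<close>, that
  \<open>\<phi> b \<cdot> \<psi> c\<close> has a component only along \<open>b \<otimes> c\<close> and that this component does not depend on the
  basis vectors chosen, so \<open>\<phi> b \<cdot> \<psi> c = \<chi> (b \<otimes> c)\<close> for a homomorphism \<open>\<chi>\<close> (\<open>hom_mult\<close>). The
  operation sending \<open>\<phi>, \<psi>\<close> to \<open>\<chi>\<close> is commutative, and associative by Sagle's identity once more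
  (\<open>hom_prod_assoc\<close>). Homomorphisms are determined by their value at one basis vector, and
  these values form the algebra \<open>A\<close>; the map \<open>\<iota> v \<otimes> \<phi> e1 \<mapsto> \<phi> v\<close> identifies \<open>B \<otimes> A\<close> with \<open>isotypic\<close>.
\<close>

section \<open>Vector identities through linear functionals\<close>

definition (in vector_space) functional :: "('b \<Rightarrow> 'a) \<Rightarrow> bool" where
  "functional g \<longleftrightarrow> Vector_Spaces.linear scale ((*) :: 'a \<Rightarrow> 'a \<Rightarrow> 'a) g"

lemma (in vector_space) functionalD:
  assumes "functional g"
  shows "g (x + y) = g x + g y" "g (x - y) = g x - g y" "g (- x) = - g x" "g 0 = 0"
    "g (scale c x) = c * g x"
proof -
  interpret g: Vector_Spaces.linear scale "(*) :: 'a \<Rightarrow> 'a \<Rightarrow> 'a" g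
    using assms by (simp add: functional_def)
  show "g (x + y) = g x + g y" "g (x - y) = g x - g y" "g (- x) = - g x" "g 0 = 0"
    "g (scale c x) = c * g x"
    by (simp_all add: g.add g.diff g.neg g.zero g.scale)
qed

text \<open>Applying an arbitrary functional turns an identity between vectors into one between
  scalars, where Groebner bases over the field are available.\<close>

lemma (in vector_space) eq_by_functionals:
  assumes "\<And>g. functional g \<Longrightarrow> g u = g v"
  shows "u = v"
proof (rule ccontr)
  assume ne: "u \<noteq> v"
  interpret pr: vector_space_pair scale "(*) :: 'a \<Rightarrow> 'a \<Rightarrow> 'a"
    by unfold_locales (auto simp: algebra_simps)
  have ind: "independent {u - v}" using ne by (simp add: dependent_single)
  obtain g where g: "functional g" "g (u - v) = 1"
    unfolding functional_def using pr.linear_independent_extend[OF ind, of "\<lambda>_. 1"] by auto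
  from assms[OF g(1)] g(2) show False by (simp add: functionalD[OF g(1)])
qed

lemma eq_minus_swap: "(a::'a::ab_group_add) + b = r \<Longrightarrow> b = - a + r"
  by auto

lemma (in vector_space) scale_three: "scale 3 x = x + x + x"
  using scale_left_distrib[of 2 1 x] scale_left_distrib[of 1 1 x] by simp

lemma (in vector_space) scale_three_eq_0:
  assumes "x = - x - x"
  shows "scale 3 x = 0"
proof -
  have "x + (x + x) = (- x - x) + (x + x)" using assms by (rule arg_cong)
  thus ?thesis by (simp add: scale_three add.assoc)
qed

section \<open>Seven-dimensional cross products\<close>

text \<open>The axioms describe the imaginary octonions with product \<open>[x, y] = 2 (x \<times> y)\<close>, which is where
  the factor 4 comes from, and with the polar form \<open>q\<close> of the norm. The set \<open>E\<close> is an orthogonal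
  basis of anisotropic vectors that is closed under the product up to scalars, like the seven
  points of the Fano plane; \<open>E_third\<close> says that no line contains all the points. Since \<open>V\<close> is a
  whole type, statements about elements of \<open>B\<close> need no membership conditions.\<close>

locale cross_product_space = vector_space sv
  for sv :: "'f::field \<Rightarrow> 'v::ab_group_add \<Rightarrow> 'v" (infixr "\<odot>" 76) +
  fixes cp :: "'v \<Rightarrow> 'v \<Rightarrow> 'v" (infixl "\<otimes>" 74)
    and q :: "'v \<Rightarrow> 'v \<Rightarrow> 'f"
    and E :: "'v set"
  assumes two_nz: "(2::'f) \<noteq> 0" and three_nz: "(3::'f) \<noteq> 0"
    and cp_add_left: "(x + y) \<otimes> z = x \<otimes> z + y \<otimes> z"
    and cp_scale_left: "(c \<odot> x) \<otimes> z = c \<odot> (x \<otimes> z)"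
    and cp_add_right: "z \<otimes> (x + y) = z \<otimes> x + z \<otimes> y"
    and cp_scale_right: "z \<otimes> (c \<odot> x) = c \<odot> (z \<otimes> x)"
    and cp_self: "x \<otimes> x = 0"
    and q_add_left: "q (x + y) z = q x z + q y z"
    and q_scale_left: "q (c \<odot> x) z = c * q x z"
    and q_sym: "q x y = q y x"
    and q_cp: "q (x \<otimes> y) y = 0"
    and cp_cp: "(x \<otimes> y) \<otimes> y = (4 * q x y) \<odot> y - (4 * q y y) \<odot> x"
    and finite_E: "finite E"
    and E_aniso: "e \<in> E \<Longrightarrow> q e e \<noteq> 0"
    and E_orth: "\<lbrakk>e \<in> E; e' \<in> E; e \<noteq> e'\<rbrakk> \<Longrightarrow> q e e' = 0"
    and E_expand: "v = (\<Sum>e\<in>E. (q v e / q e e) \<odot> e)"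
    and E_cp: "\<lbrakk>e \<in> E; e' \<in> E; e \<noteq> e'\<rbrakk> \<Longrightarrow> \<exists>c\<in>E. \<exists>r. e \<otimes> e' = r \<odot> c"
    and E_third: "\<lbrakk>e \<in> E; e' \<in> E; e \<noteq> e'\<rbrakk> \<Longrightarrow> \<exists>c\<in>E. c \<noteq> e \<and> c \<noteq> e' \<and> q c (e \<otimes> e') = 0"
    and E_two: "\<exists>e\<in>E. \<exists>e'\<in>E. e \<noteq> e'"
begin

lemma four_nz: "(4::'f) \<noteq> 0"
proof -
  have "(4::'f) = 2 * 2" by simp
  with two_nz show ?thesis by (metis mult_eq_0_iff)
qed

lemma cp_swap: "x \<otimes> y = - (y \<otimes> x)"
proof -
  have "(x + y) \<otimes> (x + y) = x \<otimes> y + y \<otimes> x"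
    by (simp add: cp_add_left cp_add_right cp_self[of x] cp_self[of y])
  thus ?thesis by (simp add: cp_self eq_neg_iff_add_eq_0)
qed

lemma cp_zero_left [simp]: "0 \<otimes> x = 0" using cp_scale_left[of 0 0 x] by simp
lemma cp_zero_right [simp]: "x \<otimes> 0 = 0" using cp_scale_right[of x 0 0] by simp
lemma cp_minus_left: "(- x) \<otimes> y = - (x \<otimes> y)" using cp_scale_left[of "-1" x y] by simp
lemma cp_minus_right: "x \<otimes> (- y) = - (x \<otimes> y)" using cp_scale_right[of x "-1" y] by simp
lemma cp_diff_left: "(x - y) \<otimes> z = x \<otimes> z - y \<otimes> z"
  using cp_add_left[of x "- y" z] by (simp add: cp_minus_left)
lemma cp_diff_right: "z \<otimes> (x - y) = z \<otimes> x - z \<otimes> y"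
  using cp_add_right[of z x "- y"] by (simp add: cp_minus_right)

lemma q_add_right: "q z (x + y) = q z x + q z y" by (metis q_add_left q_sym)
lemma q_scale_right: "q z (c \<odot> x) = c * q z x" by (metis q_scale_left q_sym)
lemma q_zero_left [simp]: "q 0 x = 0" using q_scale_left[of 0 0 x] by simp
lemma q_zero_right [simp]: "q x 0 = 0" using q_scale_right[of x 0 0] by simp
lemma q_minus_left: "q (- x) y = - q x y" using q_scale_left[of "-1" x y] by simp
lemma q_minus_right: "q x (- y) = - q x y" using q_scale_right[of x "-1" y] by simp
lemma q_diff_left: "q (x - y) z = q x z - q y z"
  using q_add_left[of x "- y" z] by (simp add: q_minus_left)
lemma q_diff_right: "q z (x - y) = q z x - q z y"
  using q_add_right[of z x "- y"] by (simp add: q_minus_right)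

lemmas bilin = cp_add_left cp_add_right cp_scale_left cp_scale_right cp_minus_left cp_minus_right
  cp_diff_left cp_diff_right
lemmas qbilin = q_add_left q_add_right q_scale_left q_scale_right q_minus_left q_minus_right
  q_diff_left q_diff_right

lemma q_cp_left: "q (x \<otimes> y) x = 0"
  using q_cp[of y x] cp_swap[of x y] by (simp add: q_minus_left)

text \<open>The trilinear form \<open>q (x \<otimes> y) z\<close> is alternating.\<close>

lemma q_cp_assoc: "q (x \<otimes> y) z = q x (y \<otimes> z)"
proof -
  have "0 = q (x \<otimes> (y + z)) (y + z)" by (simp add: q_cp)
  hence "q (x \<otimes> y) z = - q (x \<otimes> z) y" by (simp add: bilin qbilin q_cp eq_neg_iff_add_eq_0 add.commute)
  moreover have "0 = q ((x + y) \<otimes> z) (x + y)" by (simp add: q_cp_left)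
  hence "q (x \<otimes> z) y = - q (y \<otimes> z) x" by (simp add: bilin qbilin q_cp_left eq_neg_iff_add_eq_0 add.commute)
  ultimately show ?thesis by (simp add: q_sym[of x])
qed

lemma cp_cp_lin: "(x \<otimes> y) \<otimes> z + (x \<otimes> z) \<otimes> y =
    (4 * q x y) \<odot> z + (4 * q x z) \<odot> y - (8 * q y z) \<odot> x"
  (is "?l = ?r")
proof (rule eq_by_functionals)
  fix g assume "functional g"
  note g = functionalD[OF this]
  have "g ((x \<otimes> (y + z)) \<otimes> (y + z)) = g ((4 * q x (y + z)) \<odot> (y + z) - (4 * q (y + z) (y + z)) \<odot> x)"
    by (simp only: cp_cp)
  thus "g ?l = g ?r" by (simp add: bilin qbilin g cp_cp q_sym[of z y]) algebra
qed

lemma cp_cp_swap: "y \<otimes> (x \<otimes> y) = (4 * q y y) \<odot> x - (4 * q x y) \<odot> y"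
  using cp_swap[of y "x \<otimes> y"] by (simp add: cp_cp)
lemma cp_cp_left: "y \<otimes> (y \<otimes> x) = (4 * q x y) \<odot> y - (4 * q y y) \<odot> x"
  using cp_cp_swap[of y x] cp_swap[of y x] by (simp add: bilin)
lemma cp_cp_mid: "(y \<otimes> x) \<otimes> y = (4 * q y y) \<odot> x - (4 * q x y) \<odot> y"
  using cp_cp[of x y] cp_swap[of y x] by (simp add: bilin)

text \<open>The bracket in the definition of \<open>h\<close> is, on \<open>V\<close>, twelve times the infinitesimal rotation in the
  plane of its last two arguments.\<close>

lemma cp_brace: "(c \<otimes> t) \<otimes> u - (c \<otimes> u) \<otimes> t + 2 \<odot> (c \<otimes> (t \<otimes> u)) =
    (12 * q c u) \<odot> t - (12 * q c t) \<odot> u" (is "?l = ?r")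
proof (rule eq_by_functionals)
  fix g assume "functional g"
  note g = functionalD[OF this]
  have "c \<otimes> (t \<otimes> u) = - ((t \<otimes> u) \<otimes> c)" by (rule cp_swap)
  moreover have "(t \<otimes> c) \<otimes> u = - ((c \<otimes> t) \<otimes> u)" using cp_swap[of t c] by (simp add: bilin)
  ultimately have eq: "c \<otimes> (t \<otimes> u) = - ((t \<otimes> u) \<otimes> c)" "(t \<otimes> c) \<otimes> u = - ((c \<otimes> t) \<otimes> u)"
    by simp_all
  show "g ?l = g ?r"
    using arg_cong[OF cp_cp_lin[of c t u], of g] arg_cong[OF cp_cp_lin[of t c u], of g]
    by (simp add: eq g q_sym[of t c] q_sym[of u t]) algebra
qed

lemma q_cp_cp: "q (x \<otimes> y) (z \<otimes> y) = 4 * (q x z * q y y - q x y * q z y)"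
  using q_cp_assoc[of x y "z \<otimes> y"] by (simp add: cp_cp_swap qbilin algebra_simps)

lemma E_induct:
  assumes "\<And>x y. P x \<Longrightarrow> P y \<Longrightarrow> P (x + y)" "\<And>c x. P x \<Longrightarrow> P (c \<odot> x)" "\<And>e. e \<in> E \<Longrightarrow> P e"
  shows "P v"
proof -
  have P0: "P 0" using E_two assms(2)[of _ 0] assms(3) by auto
  have "P (\<Sum>e\<in>F. c e \<odot> e)" if "F \<subseteq> E" "finite F" for F c
    using that(2,1) by (induction F) (auto intro: P0 assms)
  from this[OF order_refl finite_E, of "\<lambda>e. q v e / q e e"]
  show ?thesis by (rule back_subst[of P, OF _ E_expand[symmetric]])
qed

text \<open>Three orthogonal vectors with the third orthogonal to the product of the others: for anisotropic
  vectors, generators of the whole octonion algebra. Products of such a triple associate and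
  commute up to sign.\<close>

definition indep :: "'v \<Rightarrow> 'v \<Rightarrow> 'v \<Rightarrow> bool" where
  "indep x y z \<longleftrightarrow> q x y = 0 \<and> q x z = 0 \<and> q y z = 0 \<and> q x (y \<otimes> z) = 0"

lemma indepD:
  assumes "indep x y z"
  shows "q x y = 0" "q y x = 0" "q x z = 0" "q z x = 0" "q y z = 0" "q z y = 0"
    "q x (y \<otimes> z) = 0" "q (x \<otimes> y) z = 0" "q y (z \<otimes> x) = 0" "q y (x \<otimes> z) = 0" "q x (z \<otimes> y) = 0"
    "q z (x \<otimes> y) = 0"  "q z (y \<otimes> x) = 0"
    "(x \<otimes> z) \<otimes> y = - ((x \<otimes> y) \<otimes> z)" "x \<otimes> (y \<otimes> z) = - ((x \<otimes> y) \<otimes> z)"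
proof -
  show *: "q x y = 0" "q y x = 0" "q x z = 0" "q z x = 0" "q y z = 0" "q z y = 0" "q x (y \<otimes> z) = 0"
    using assms q_sym[of y x] q_sym[of z x] q_sym[of z y] by (simp_all add: indep_def)
  show "q (x \<otimes> y) z = 0" using *(7) by (simp add: q_cp_assoc)
  thus "q z (x \<otimes> y) = 0" by (simp only: q_sym[of z])
  thus "q z (y \<otimes> x) = 0" using cp_swap[of x y] by (simp add: q_minus_right)
  show "q y (z \<otimes> x) = 0" using *(7) q_cp_assoc[of y z x] q_sym[of x "y \<otimes> z"] by simp
  thus "q y (x \<otimes> z) = 0" using cp_swap[of x z] by (simp add: q_minus_right)
  show "q x (z \<otimes> y) = 0" using *(7) cp_swap[of z y] by (simp add: q_minus_right)
  show 1: "(x \<otimes> z) \<otimes> y = - ((x \<otimes> y) \<otimes> z)"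
    using cp_cp_lin[of x y z] * by (simp add: eq_neg_iff_add_eq_0 add.commute)
  have "(y \<otimes> z) \<otimes> x = - ((y \<otimes> x) \<otimes> z)"
    using cp_cp_lin[of y z x] * by (simp add: eq_neg_iff_add_eq_0 add.commute)
  thus "x \<otimes> (y \<otimes> z) = - ((x \<otimes> y) \<otimes> z)"
    using cp_swap[of x "y \<otimes> z"] cp_swap[of y x] by (simp add: bilin)
qed

lemma indep_rot: "indep x y z \<Longrightarrow> indep y z x"
  unfolding indep_def[of y z x] using indepD(2,4,5,9)[of x y z] by blast
lemma indep_swap: "indep x y z \<Longrightarrow> indep x z y"
  unfolding indep_def[of x z y] using indepD(1,3,6,11)[of x y z] by blast

lemma E_indep:
  assumes "b \<in> E" "c \<in> E" "b \<noteq> c"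
  obtains d where "d \<in> E" "d \<noteq> b" "d \<noteq> c" "indep b c d"
proof -
  obtain d where "d \<in> E" "d \<noteq> b" "d \<noteq> c" "q d (b \<otimes> c) = 0" using E_third[OF assms] by auto
  moreover from this have "q b (c \<otimes> d) = 0" using q_cp_assoc[of b c d] q_sym[of d "b \<otimes> c"] by simp
  moreover have "q b c = 0" "q b d = 0" "q c d = 0" using assms calculation(1-3) E_orth by metis+
  moreover from calculation have "indep b c d" by (simp add: indep_def)
  ultimately show ?thesis using that by blast
qed

lemma E_prod:
  assumes "e \<in> E"
  obtains r d w where "e = r \<odot> (d \<otimes> w)"
proof -
  obtain d where d: "d \<in> E" "d \<noteq> e" using E_two by metis
  have "e = (1 / (4 * q d d)) \<odot> (d \<otimes> (e \<otimes> d))"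
    using E_aniso[OF d(1)] four_nz E_orth[OF assms d(1)] d(2) by (simp add: cp_cp_swap)
  thus ?thesis by (rule that)
qed

text \<open>Up to a scalar, \<open>(((e \<otimes> c) \<otimes> b) \<otimes> b) \<otimes> c\<close> is \<open>e\<close> again, so \<open>f = (e \<otimes> c) \<otimes> b\<close> works.\<close>

lemma E_triple:
  assumes e: "e \<in> E"
  obtains r f b c where "indep f b c" "q b b \<noteq> 0" "q c c \<noteq> 0" "e = r \<odot> ((f \<otimes> b) \<otimes> c)"
proof -
  obtain b where b: "b \<in> E" "b \<noteq> e" using E_two by metis
  obtain c where c: "c \<in> E" "indep e b c" using E_indep[OF e b(1)] b(2) by metis
  note D = indepD[OF c(2)]
  define f where "f = (e \<otimes> c) \<otimes> b"
  have bc: "b \<otimes> (b \<otimes> c) = - ((4 * q b b) \<odot> c)" "c \<otimes> (b \<otimes> c) = (4 * q c c) \<odot> b"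
    using D by (simp_all add: cp_cp_left cp_cp_swap)
  have "q (e \<otimes> c) b = 0" using D(11) by (simp add: q_cp_assoc)
  hence "(f \<otimes> b) \<otimes> c = (4 * q b b * (4 * q c c)) \<odot> e" using D(3) by (simp add: f_def cp_cp bilin)
  moreover have "q b b \<noteq> 0" "q c c \<noteq> 0" using b c E_aniso by auto
  moreover from calculation(2,3) have "4 * q b b * (4 * q c c) \<noteq> 0" using four_nz by (simp only: mult_eq_0_iff) simp
  ultimately have "e = (1 / (4 * q b b * (4 * q c c))) \<odot> ((f \<otimes> b) \<otimes> c)"
    by (simp only: scale_scale) simp
  moreover have "indep f b c"
    using D bc by (simp add: indep_def f_def q_cp q_cp_assoc qbilin cp_cp_swap)
  ultimately show ?thesis using \<open>q b b \<noteq> 0\<close> \<open>q c c \<noteq> 0\<close> that by blast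
qed

lemma indep_cp:
  assumes "indep f b c"
  shows "indep f (b \<otimes> c) c"
  using indepD(1,3,5,7)[OF assms] by (simp add: indep_def q_cp cp_cp qbilin)

text \<open>Two points collinear with \<open>c\<close> are linked by any point off their line, so that a symmetric
  function of pairs which is unchanged along independent triples is constant.\<close>

lemma E_pairs_const:
  assumes sym: "\<And>b c. \<lbrakk>b \<in> E; c \<in> E; b \<noteq> c\<rbrakk> \<Longrightarrow> g b c = g c b"
    and step: "\<And>b b' c. \<lbrakk>b \<in> E; b' \<in> E; c \<in> E; indep b b' c\<rbrakk> \<Longrightarrow> g b c = g b' c"
    and E: "b \<in> E" "c \<in> E" "b \<noteq> c" "b' \<in> E" "c' \<in> E" "b' \<noteq> c'"
  shows "g b c = g b' c'"
proof -
  have same: "g b c = g b' c" if E: "b \<in> E" "b' \<in> E" "c \<in> E" "b \<noteq> c" "b' \<noteq> c" for b b' c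
  proof (cases "b = b' \<or> indep b b' c")
    case True
    thus ?thesis using step E by blast
  next
    case False
    hence o: "q b b' = 0" "q b c = 0" "q b' c = 0" "q b (b' \<otimes> c) \<noteq> 0"
      using E E_orth by (auto simp: indep_def)
    obtain d where d: "d \<in> E" "indep b c d" using E_indep[of b c] E by metis
    obtain e r where e: "e \<in> E" "b \<otimes> c = r \<odot> e" using E_cp[of b c] E by blast
    have "q (b \<otimes> c) b' \<noteq> 0" using o(4) cp_swap[of c b'] by (simp add: q_cp_assoc qbilin)
    hence r: "r \<noteq> 0" "e = b'" using e E_orth[OF e(1) E(2)] by (auto simp: qbilin)
    have "r * q b' d = q (b \<otimes> c) d" using e r by (simp add: qbilin)
    hence "q b' d = 0" using indepD(8)[OF d(2)] r by simp
    moreover have "r * q b' (d \<otimes> c) = q (b \<otimes> c) (d \<otimes> c)" using e r by (simp add: qbilin)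
    hence "q b' (d \<otimes> c) = 0" using r indepD[OF d(2)] by (simp add: q_cp_cp)
    ultimately have "indep b' d c" using o(3) indepD(6)[OF d(2)] by (simp add: indep_def)
    moreover have "indep b d c" using d(2) by (rule indep_swap)
    ultimately show ?thesis using step E d(1) by metis
  qed
  show ?thesis
  proof (cases "c = c'")
    case True
    thus ?thesis using same E by blast
  next
    case False
    hence "g b c = g c' c" using same E by metis
    also have "\<dots> = g c c'" using sym E False by metis
    also have "\<dots> = g b' c'" using same E False by metis
    finally show ?thesis .
  qed
qed

definition e1 where "e1 = (SOME e. e \<in> E \<and> (\<exists>e'\<in>E. e \<noteq> e'))"
definition e2 where "e2 = (SOME e. e \<in> E \<and> e1 \<noteq> e)"

lemma e12: "e1 \<in> E" "e2 \<in> E" "e1 \<noteq> e2"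
proof -
  have 1: "e1 \<in> E \<and> (\<exists>e'\<in>E. e1 \<noteq> e')" unfolding e1_def by (rule someI_ex) (use E_two in blast)
  hence 2: "e2 \<in> E \<and> e1 \<noteq> e2" unfolding e2_def by (intro someI_ex[of "\<lambda>e. e \<in> E \<and> e1 \<noteq> e"]) blast
  show "e1 \<in> E" "e2 \<in> E" "e1 \<noteq> e2" using 1 2 by auto
qed

end

section \<open>Malcev algebras\<close>

context nonassoc_algebra
begin
lemma mult_add_left: "(x + y) \<cdot> z = x \<cdot> z + y \<cdot> z"
  and mult_scale_left: "scl c x \<cdot> z = scl c (x \<cdot> z)"
  and mult_minus_left: "(- x) \<cdot> z = - (x \<cdot> z)"
  and mult_diff_left: "(x - y) \<cdot> z = x \<cdot> z - y \<cdot> z"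
  and mult_zero_left [simp]: "0 \<cdot> z = 0"
proof -
  interpret l: Vector_Spaces.linear scl scl "\<lambda>x. x \<cdot> z" by (rule linear_mult_left)
  show "(x + y) \<cdot> z = x \<cdot> z + y \<cdot> z" "scl c x \<cdot> z = scl c (x \<cdot> z)" "(- x) \<cdot> z = - (x \<cdot> z)"
    "(x - y) \<cdot> z = x \<cdot> z - y \<cdot> z" "0 \<cdot> z = 0"
    by (simp_all add: l.add l.diff l.neg l.zero l.scale)
qed

lemma mult_add_right: "z \<cdot> (x + y) = z \<cdot> x + z \<cdot> y"
  and mult_scale_right: "z \<cdot> scl c x = scl c (z \<cdot> x)"
  and mult_minus_right: "z \<cdot> (- x) = - (z \<cdot> x)"
  and mult_diff_right: "z \<cdot> (x - y) = z \<cdot> x - z \<cdot> y"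
  and mult_zero_right [simp]: "z \<cdot> 0 = 0"
proof -
  interpret l: Vector_Spaces.linear scl scl "\<lambda>x. z \<cdot> x" by (rule linear_mult_right)
  show "z \<cdot> (x + y) = z \<cdot> x + z \<cdot> y" "z \<cdot> scl c x = scl c (z \<cdot> x)" "z \<cdot> (- x) = - (z \<cdot> x)"
    "z \<cdot> (x - y) = z \<cdot> x - z \<cdot> y" "z \<cdot> 0 = 0"
    by (simp_all add: l.add l.diff l.neg l.zero l.scale)
qed

lemmas mult_bilin = mult_add_left mult_scale_left mult_minus_left mult_diff_left
  mult_add_right mult_scale_right mult_minus_right mult_diff_right
end

context malcev_algebra
begin

lemma mult_swap: "x \<cdot> y = - (y \<cdot> x)"
proof -
  have "(x + y) \<cdot> (x + y) = x \<cdot> y + y \<cdot> x"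
    by (simp add: mult_add_left mult_add_right mult_self[of x] mult_self[of y])
  thus ?thesis by (simp add: mult_self eq_neg_iff_add_eq_0)
qed

lemma malcev_lin:
  "jacobian (\<cdot>) x y (w \<cdot> z) + jacobian (\<cdot>) w y (x \<cdot> z) = jacobian (\<cdot>) x y z \<cdot> w + jacobian (\<cdot>) w y z \<cdot> x"
  (is "?l = ?r")
proof (rule eq_by_functionals)
  fix g assume "functional g"
  note g = functionalD[OF this]
  show "g ?l = g ?r"
    using arg_cong[OF malcev[of "x + w" y z], of g] arg_cong[OF malcev[of x y z], of g] arg_cong[OF malcev[of w y z], of g]
    by (simp add: jacobian_def mult_bilin g) algebra
qed

text \<open>Sagle's form of the Malcev identity, which is cyclic in its four variables: half of a
  combination of three linearized Malcev identities.\<close>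

lemma sagle:
  assumes two: "(2::'a) \<noteq> 0"
  shows "(x \<cdot> z) \<cdot> (y \<cdot> t) = ((x \<cdot> y) \<cdot> z) \<cdot> t + ((y \<cdot> z) \<cdot> t) \<cdot> x + ((z \<cdot> t) \<cdot> x) \<cdot> y + ((t \<cdot> x) \<cdot> y) \<cdot> z"
  (is "?l = ?r")
proof (rule eq_by_functionals)
  fix g assume "functional g"
  note g = functionalD[OF this]
  note sw = mult_swap[of y x] mult_swap[of z x] mult_swap[of t x] mult_swap[of z y] mult_swap[of t y] mult_swap[of t z]
    mult_swap[of "y \<cdot> t" "x \<cdot> z"] mult_swap[of "z \<cdot> t" "x \<cdot> y"] mult_swap[of "y \<cdot> z" "x \<cdot> t"]
    mult_swap[of x "_ \<cdot> _"] mult_swap[of y "_ \<cdot> _"] mult_swap[of z "_ \<cdot> _"] mult_swap[of t "_ \<cdot> _"]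
  have "2 * g ?l = 2 * g ?r"
    using arg_cong[OF malcev_lin[of x y z t], of g] arg_cong[OF malcev_lin[of y t z x], of g]
      arg_cong[OF malcev_lin[of t x z y], of g]
    by (simp add: jacobian_def mult_bilin g sw) algebra
  with two show "g ?l = g ?r" by simp
qed
end

section \<open>Malcev algebras over a cross product space\<close>

locale malcev_over_cross = malcev_algebra_H scl mult + V: cross_product_space sv cp q E
  for scl :: "'f::field \<Rightarrow> 'm::ab_group_add \<Rightarrow> 'm" and mult :: "'m \<Rightarrow> 'm \<Rightarrow> 'm" (infixl "\<cdot>" 70)
    and sv :: "'f \<Rightarrow> 'v::ab_group_add \<Rightarrow> 'v" (infixr "\<odot>" 76)
    and cp :: "'v \<Rightarrow> 'v \<Rightarrow> 'v" (infixl "\<otimes>" 74) and q E +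
  fixes \<iota> :: "'v \<Rightarrow> 'm"
  assumes iota_add: "\<iota> (v + w) = \<iota> v + \<iota> w"
    and iota_scale: "\<iota> (c \<odot> v) = scl c (\<iota> v)"
    and iota_cp: "\<iota> (v \<otimes> w) = \<iota> v \<cdot> \<iota> w"
    and iota_inj: "inj \<iota>"
begin

lemmas two_nz = V.two_nz and three_nz = V.three_nz and four_nz = V.four_nz

lemma iota_zero [simp]: "\<iota> 0 = 0" using iota_scale[of 0 0] by simp
lemma iota_minus: "\<iota> (- v) = - \<iota> v" using iota_scale[of "-1" v] by simp
lemma iota_diff: "\<iota> (v - w) = \<iota> v - \<iota> w" using iota_add[of v "- w"] by (simp add: iota_minus)

definition act :: "'m \<Rightarrow> 'v \<Rightarrow> 'm" (infixl "\<star>" 72) where "x \<star> v = x \<cdot> \<iota> v"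

lemma act_bilin:
  "(x + y) \<star> v = x \<star> v + y \<star> v" "(x - y) \<star> v = x \<star> v - y \<star> v" "(- x) \<star> v = - (x \<star> v)"
  "scl c x \<star> v = scl c (x \<star> v)"
  "x \<star> (v + w) = x \<star> v + x \<star> w" "x \<star> (v - w) = x \<star> v - x \<star> w" "x \<star> (- v) = - (x \<star> v)"
  "x \<star> (c \<odot> v) = scl c (x \<star> v)"
  by (simp_all add: act_def mult_bilin iota_add iota_diff iota_minus iota_scale)

lemma act_zero [simp]: "0 \<star> v = 0" "x \<star> 0 = 0" by (simp_all add: act_def)

lemma act_left: "\<iota> v \<cdot> x = - (x \<star> v)" using mult_swap[of x "\<iota> v"] by (simp add: act_def)

lemmas lin = act_bilin V.bilin V.qbilin

lemma sagle_act:
  "x \<star> y \<star> z \<star> t - x \<star> t \<star> y \<star> z = x \<star> z \<star> (y \<otimes> t) + x \<star> ((y \<otimes> z) \<otimes> t) + x \<star> (z \<otimes> t) \<star> y"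
proof -
  have a: "\<iota> (z \<otimes> t) \<cdot> x = - (x \<star> (z \<otimes> t))" "\<iota> ((y \<otimes> z) \<otimes> t) \<cdot> x = - (x \<star> ((y \<otimes> z) \<otimes> t))" "\<iota> t \<cdot> x = - (x \<star> t)"
    by (rule act_left)+
  show ?thesis
    using sagle[OF two_nz, of x "\<iota> z" "\<iota> y" "\<iota> t"] a
    by (simp add: act_def iota_cp mult_bilin algebra_simps)
qed

text \<open>On \<open>V\<close> itself this operator sends \<open>v\<close> to \<open>12 (q v f \<odot> b - q f b \<odot> v)\<close>, see \<open>cp_tri\<close>.\<close>

definition tri :: "'m \<Rightarrow> 'v \<Rightarrow> 'v \<Rightarrow> 'm" where
  "tri x f b = x \<star> f \<star> b + scl 2 (x \<star> b \<star> f) - x \<star> (f \<otimes> b)"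

text \<open>If \<open>tri x f b\<close> were \<open>12 (\<phi> b - q f b x)\<close> with a homomorphism \<open>\<phi>\<close>, then \<open>vol x f b c\<close> would be
  \<open>12 q f (b \<otimes> c) x\<close>; hence the name, for the alternating form \<open>q f (b \<otimes> c)\<close>.\<close>

definition vol :: "'m \<Rightarrow> 'v \<Rightarrow> 'v \<Rightarrow> 'v \<Rightarrow> 'm" where
  "vol x f b c = tri x f b \<star> c - tri x f (b \<otimes> c) + scl (12 * q f b) (x \<star> c)"

lemma tri_bilin:
  "tri (x + y) f b = tri x f b + tri y f b" "tri (x - y) f b = tri x f b - tri y f b"
  "tri (- x) f b = - tri x f b" "tri (scl r x) f b = scl r (tri x f b)"
  "tri x (f + f') b = tri x f b + tri x f' b" "tri x (f - f') b = tri x f b - tri x f' b"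
  "tri x (- f) b = - tri x f b" "tri x (r \<odot> f) b = scl r (tri x f b)"
  "tri x f (b + b') = tri x f b + tri x f b'" "tri x f (b - b') = tri x f b - tri x f b'"
  "tri x f (- b) = - tri x f b" "tri x f (r \<odot> b) = scl r (tri x f b)"
  by (simp_all add: tri_def lin algebra_simps)

text \<open>\<open>h\<close> is symmetric in its last two arguments, so nothing is lost by equating them.\<close>

lemma h_square: "brace scl (\<cdot>) (y \<cdot> z) t x \<cdot> x + brace scl (\<cdot>) (y \<cdot> x) z x \<cdot> t = 0" (is "?l = 0")
proof -
  have "scl 2 ?l = h_poly scl (\<cdot>) y z t x x"
    unfolding h_poly_def by (simp only: scale_left_distrib scale_right_distrib one_add_one[symmetric] scale_one) simp
  also have "\<dots> = 0" by (rule h_identity)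
  finally show ?thesis using two_nz by simp
qed

lemma brace_iota_left:
  "brace scl (\<cdot>) (\<iota> c) x (\<iota> a) = - tri x c a" "brace scl (\<cdot>) (\<iota> c) (\<iota> t) x = tri x c t"
  "brace scl (\<cdot>) x (\<iota> t) (\<iota> a) = tri x a t - tri x t a"
  "brace scl (\<cdot>) (\<iota> c) (\<iota> t) (\<iota> a) = scl (12 * q c a) (\<iota> t) - scl (12 * q c t) (\<iota> a)"
proof -
  show "brace scl (\<cdot>) (\<iota> c) x (\<iota> a) = - tri x c a"
    unfolding brace_def iota_cp[symmetric] unfolding act_def[symmetric] act_left
    by (simp add: tri_def lin algebra_simps)
  show "brace scl (\<cdot>) (\<iota> c) (\<iota> t) x = tri x c t"
    unfolding brace_def iota_cp[symmetric] unfolding act_left unfolding act_def[symmetric]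
    by (simp add: tri_def lin mult_bilin act_left algebra_simps)
  show "brace scl (\<cdot>) x (\<iota> t) (\<iota> a) = tri x a t - tri x t a" (is "?l = ?r")
  proof (rule eq_by_functionals)
    fix g assume "functional g"
    note g = functionalD[OF this]
    show "g ?l = g ?r"
      unfolding brace_def iota_cp[symmetric] unfolding act_def[symmetric]
      by (simp add: tri_def lin g V.cp_swap[of a t])
  qed
  show "brace scl (\<cdot>) (\<iota> c) (\<iota> t) (\<iota> a) = scl (12 * q c a) (\<iota> t) - scl (12 * q c t) (\<iota> a)"
    using arg_cong[OF V.cp_brace[of c t a], of \<iota>]
    by (simp add: brace_def iota_add iota_diff iota_scale iota_cp)
qed

text \<open>\<open>h\<close> with the module element in its third slot. The last bracket then lies in \<open>B\<close> and is known
  explicitly.\<close>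

lemma tri_same: "tri x c a \<star> a = scl (- 12 * q c a) (x \<star> a)"
proof (induction c rule: V.E_induct)
  case (3 e)
  \<comment> \<open>The identity speaks about \<open>c\<close> only when \<open>c\<close> is a product, which every basis vector is up to a scalar.\<close>
  obtain r d w where e: "e = r \<odot> (d \<otimes> w)" using V.E_prod[OF 3] .
  have "tri x (y \<otimes> z) a \<star> a = scl (- 12 * q (y \<otimes> z) a) (x \<star> a)" for y z
  proof -
    have "q (y \<otimes> a) z = - q (y \<otimes> z) a"
      using V.cp_swap[of a z] by (simp add: V.q_cp_assoc V.qbilin)
    moreover have "brace scl (\<cdot>) (\<iota> (y \<otimes> z)) x (\<iota> a) \<cdot> \<iota> a + brace scl (\<cdot>) (\<iota> (y \<otimes> a)) (\<iota> z) (\<iota> a) \<cdot> x = 0"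
      using h_square[of "\<iota> y" "\<iota> z" x "\<iota> a"] by (simp only: iota_cp)
    ultimately show ?thesis
      unfolding brace_iota_left(4) unfolding brace_iota_left(1)
      by (simp add: V.q_cp act_left mult_bilin act_bilin act_def[symmetric]
          minus_equation_iff[of "tri _ _ _ \<star> _"])
  qed
  from this[of d w] show ?case by (simp add: e tri_bilin lin mult.left_commute)
qed (simp_all add: tri_bilin lin algebra_simps)

text \<open>In the presence of Sagle's identity, \<open>tri_same\<close> expresses the square of an operator followed by
  another one through products of two operators.\<close>

lemma act_act_act: "scl 3 (x \<star> f \<star> f \<star> b) = scl 2 (x \<star> (f \<otimes> b) \<star> f) + x \<star> f \<star> (f \<otimes> b)
    - scl (8 * q f f) (x \<star> b) - scl (4 * q f b) (x \<star> f)" (is "?l = ?r")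
proof (rule eq_by_functionals)
  fix g assume "functional g"
  note g = functionalD[OF this]
  note sw = V.cp_swap[of b f]
  show "g ?l = g ?r"
    using arg_cong[OF tri_same[of x b f], of g] arg_cong[OF sagle_act[of x f f b], of g]
       arg_cong[OF sagle_act[of x f b f], of g]
    by (simp add: tri_def lin g sw V.cp_self V.cp_cp_mid V.q_sym[of b f]) algebra
qed

lemma vol_same23: "vol x f b b = 0"
  by (simp add: vol_def tri_same V.cp_self tri_bilin) (simp add: tri_def V.cp_self)

lemma tri_zero [simp]: "tri 0 f b = 0" "tri x 0 b = 0" "tri x f 0 = 0" by (simp_all add: tri_def)

lemma vol_same12: "vol x f f c = 0" (is "?l = 0")
proof (rule eq_by_functionals)
  fix g assume "functional g"
  note g = functionalD[OF this]
  show "g ?l = g 0"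
    using arg_cong[OF act_act_act[of x f c], of g]
    by (simp add: vol_def tri_def lin g V.cp_self V.cp_cp_left V.q_sym[of c f])
qed

lemma vol_lin:
  "vol (x + y) f b c = vol x f b c + vol y f b c" "vol (x - y) f b c = vol x f b c - vol y f b c"
  "vol (- x) f b c = - vol x f b c" "vol (scl r x) f b c = scl r (vol x f b c)"
  "vol x (f + f') b c = vol x f b c + vol x f' b c" "vol x (f - f') b c = vol x f b c - vol x f' b c"
  "vol x (- f) b c = - vol x f b c" "vol x (r \<odot> f) b c = scl r (vol x f b c)"
  "vol x f (b + b') c = vol x f b c + vol x f b' c" "vol x f (b - b') c = vol x f b c - vol x f b' c"
  "vol x f (- b) c = - vol x f b c" "vol x f (r \<odot> b) c = scl r (vol x f b c)"
  "vol x f b (c + c') = vol x f b c + vol x f b c'" "vol x f b (c - c') = vol x f b c - vol x f b c'"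
  "vol x f b (- c) = - vol x f b c" "vol x f b (r \<odot> c) = scl r (vol x f b c)"
  by (simp_all add: vol_def tri_bilin lin algebra_simps)

lemma vol_swap12: "vol x b f c = - vol x f b c"
proof -
  have "vol x f b c + vol x b f c = vol x (f + b) (f + b) c"
    unfolding vol_lin by (simp add: vol_same12)
  hence "vol x f b c + vol x b f c = 0" by (simp add: vol_same12)
  thus ?thesis by (metis eq_neg_iff_add_eq_0 add.commute)
qed

lemma vol_swap23: "vol x f c b = - vol x f b c"
proof -
  have "vol x f b c + vol x f c b = vol x f (b + c) (b + c)"
    unfolding vol_lin by (simp add: vol_same23)
  hence "vol x f b c + vol x f c b = 0" by (simp add: vol_same23)
  thus ?thesis by (metis eq_neg_iff_add_eq_0 add.commute)
qed

lemma vol_rot: "vol x b c f = vol x f b c"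
  using vol_swap12[of x c b f] vol_swap23[of x b c f] vol_swap12[of x b f c] by simp

lemma vol_same13: "vol x f b f = 0"
  using vol_swap23[of x f f b] by (simp add: vol_same12)

text \<open>The left-hand analogue of the definition of \<open>vol\<close>: it makes no difference on which side of
  \<open>tri\<close> the third operator is placed.\<close>

lemma tri_act: "tri (x \<star> f) b c = tri x (f \<otimes> b) c - scl (12 * q b c) (x \<star> f) + vol x f b c" (is "?l = ?r")
proof (rule eq_by_functionals)
  fix g assume "functional g"
  note g = functionalD[OF this]
  note sw = V.cp_swap[of f b] V.cp_swap[of c b] V.cp_swap[of c f]
  \<comment> \<open>\<open>e1\<close> to \<open>e3\<close> express all products of three vectors through \<open>(b \<otimes> f) \<otimes> c\<close>.\<close>
  have e1: "(f \<otimes> c) \<otimes> b = (b \<otimes> f) \<otimes> c + ((4 * q f b) \<odot> c + (4 * q f c) \<odot> b - (8 * q b c) \<odot> f)"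
    using eq_minus_swap[OF V.cp_cp_lin[of f b c]] V.cp_swap[of f b] by (simp add: V.bilin)
  have e2: "(b \<otimes> c) \<otimes> f = - ((b \<otimes> f) \<otimes> c) + ((4 * q f b) \<odot> c + (4 * q b c) \<odot> f - (8 * q f c) \<odot> b)"
    using eq_minus_swap[OF V.cp_cp_lin[of b f c]] V.q_sym[of f b] by simp
  have e3: "b \<otimes> (f \<otimes> c) = - ((f \<otimes> c) \<otimes> b)" "f \<otimes> (b \<otimes> c) = - ((b \<otimes> c) \<otimes> f)" by (rule V.cp_swap)+
  show "g ?l = g ?r"
    using arg_cong[OF sagle_act[of x f c b], of g]
    by (simp add: vol_def tri_def lin g sw e1 e2 e3 V.q_sym[of b f]) algebra
qed
section \<open>The alternating obstruction\<close>

text \<open>\<open>h\<close> with the module element in its second slot, where all terms reduce to \<open>tri\<close>.\<close>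

lemma vol_skew: "vol x (y \<otimes> a) a t = - vol x y a (t \<otimes> a)"
proof (rule eq_by_functionals)
  fix g assume "functional g"
  note g = functionalD[OF this]
  have "brace scl (\<cdot>) (- (x \<star> y)) (\<iota> t) (\<iota> a) \<cdot> \<iota> a + brace scl (\<cdot>) (\<iota> (y \<otimes> a)) x (\<iota> a) \<cdot> \<iota> t = 0"
    using h_square[of "\<iota> y" x "\<iota> t" "\<iota> a"] by (simp only: iota_cp act_left)
  hence 1: "- (tri (x \<star> y) a t \<star> a) + tri (x \<star> y) t a \<star> a - tri x (y \<otimes> a) a \<star> t = 0"
    unfolding brace_iota_left act_def[symmetric] by (simp add: tri_bilin lin)
  have 2: "tri (x \<star> y) a t \<star> a = tri (x \<star> y) a (t \<otimes> a) - scl (12 * q a t) (x \<star> y \<star> a)"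
    using vol_same13[of "x \<star> y" a t] unfolding vol_def by (simp add: algebra_simps)
  have 3: "tri x (y \<otimes> a) a \<star> t = vol x (y \<otimes> a) a t - tri x (y \<otimes> a) (t \<otimes> a)"
    unfolding vol_def using V.cp_swap[of a t] by (simp add: tri_bilin V.q_cp)
  have 4: "q a (t \<otimes> a) = 0" using V.q_cp[of t a] by (simp only: V.q_sym)
  show "g (vol x (y \<otimes> a) a t) = g (- vol x y a (t \<otimes> a))"
    using arg_cong[OF 1[unfolded 2 3 tri_same], of g]
    by (simp add: 4 tri_act g V.q_sym[of t a])
qed

text \<open>Walking around the triangle \<open>c\<close>, \<open>b\<close>, \<open>b \<otimes> c\<close> with \<open>vol_skew\<close> brings \<open>vol x f (b \<otimes> c) c\<close> back
  with the opposite sign.\<close>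

lemma vol_line_cp:
  assumes i: "V.indep f b c" and b: "q b b \<noteq> 0"
  shows "vol x f (b \<otimes> c) c = 0"
proof -
  note D = V.indepD[OF i]
  define p where "p = b \<otimes> c"
  have p: "c \<otimes> b = - p" "b \<otimes> p = - ((4 * q b b) \<odot> c)" "p \<otimes> b = (4 * q b b) \<odot> c" "(f \<otimes> c) \<otimes> b = f \<otimes> p"
    using D V.cp_swap[of c b] by (simp_all add: p_def V.cp_cp_left V.cp_minus_left V.cp_cp_mid)
  have 1: "vol x (f \<otimes> c) c b = - vol x f c p" by (simp add: vol_skew p_def)
  have 2: "- scl (4 * q b b) (vol x c b (f \<otimes> c)) = vol x p b (f \<otimes> p)"
    using vol_skew[of x "c \<otimes> b" b "f \<otimes> c"] by (simp add: p vol_lin V.bilin)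
  have 3: "vol x (f \<otimes> p) p b = scl (4 * q b b) (vol x f p c)"
    using vol_skew[of x f p b] unfolding p by (simp add: vol_lin)
  have "- scl (4 * q b b) (vol x c b (f \<otimes> c)) = scl (4 * q b b) (vol x f p c)"
    unfolding 2 using 3 vol_rot[of x p b "f \<otimes> p"] by simp
  hence "scl (4 * q b b) (- vol x c b (f \<otimes> c)) = scl (4 * q b b) (vol x f p c)" by simp
  hence "- vol x c b (f \<otimes> c) = vol x f p c" using b four_nz by (simp only: scale_cancel_left) simp
  moreover have "vol x (f \<otimes> c) c b = vol x f p c" using 1 vol_swap23[of x f c p] by simp
  ultimately have "- vol x f p c = vol x f p c" using vol_rot[of x c b "f \<otimes> c"] by simp
  hence "vol x f p c = - vol x f p c" by (rule sym)
  hence "vol x f p c + vol x f p c = 0" by (simp only: eq_neg_iff_add_eq_0)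
  hence "scl 2 (vol x f p c) = 0"
    using scale_left_distrib[of 1 1 "vol x f p c"] by simp
  thus ?thesis using two_nz by (simp add: p_def)
qed

lemma vol_indep:
  assumes i: "V.indep f b c" and n: "q b b \<noteq> 0" "q c c \<noteq> 0"
  shows "vol x f b c = 0"
proof -
  note D = V.indepD[OF i]
  have "q (b \<otimes> c) (b \<otimes> c) \<noteq> 0" using n four_nz D by (simp add: V.q_cp_cp)
  from vol_line_cp[OF V.indep_cp[OF i] this, of x] have "scl (- (4 * q c c)) (vol x f b c) = 0"
    using D by (simp add: V.cp_cp vol_lin)
  thus ?thesis using n four_nz by simp
qed

text \<open>Lines through \<open>f\<close> are compared by applying \<open>vol_indep\<close> to \<open>b + b'\<close>, \<open>f\<close> and a
  combination of \<open>b \<otimes> f\<close> and \<open>b' \<otimes> f\<close> that makes the triple independent. If this combination is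
  isotropic, \<open>2 b'\<close> takes the place of \<open>b'\<close>.\<close>

lemma vol_ratio:
  assumes i: "V.indep b b' f" and n: "q b b \<noteq> 0" "q b' b' \<noteq> 0" "q f f \<noteq> 0"
  shows "scl (q b' b') (vol x b f (b \<otimes> f)) = scl (q b b) (vol x b' f (b' \<otimes> f))"
proof -
  have *: "scl (q b' b') (vol x b f (b \<otimes> f)) = scl (q b b) (vol x b' f (b' \<otimes> f))"
    if i: "V.indep b b' f" and n: "q b b \<noteq> 0" "q b' b' \<noteq> 0" and s: "q b b + q b' b' \<noteq> 0" for b b'
  proof -
    note D = V.indepD[OF i]
    define c where "c = q b' b' \<odot> (b \<otimes> f) - q b b \<odot> (b' \<otimes> f)"
    have z: "q b (b \<otimes> f) = 0" "q b' (b' \<otimes> f) = 0" "q f (b \<otimes> f) = 0" "q f (b' \<otimes> f) = 0"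
      by (simp_all add: V.q_sym[of _ "_ \<otimes> _"] V.q_cp V.q_cp_left)
    have fc: "f \<otimes> c = (4 * q f f) \<odot> (q b' b' \<odot> b - q b b \<odot> b')"
      using D by (simp add: c_def V.bilin V.cp_cp_swap V.scale_right_diff_distrib mult.commute)
    have "V.indep (b + b') f c" unfolding V.indep_def fc
      using D z by (simp add: c_def V.qbilin algebra_simps)
    moreover have "q c c = 4 * q f f * q b b * q b' b' * (q b b + q b' b')"
      using D by (simp add: c_def V.qbilin V.q_cp_cp algebra_simps)
    ultimately have "vol x (b + b') f c = 0" using vol_indep n s assms(4) four_nz by simp
    moreover have "vol x b (b' \<otimes> f) f = 0" "vol x b' (b \<otimes> f) f = 0"
      using vol_line_cp[OF i n(2)] vol_line_cp[OF V.indep_swap[OF V.indep_rot[OF i]] n(1)]  by auto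
    hence "vol x b f (b' \<otimes> f) = 0" "vol x b' f (b \<otimes> f) = 0" by (simp_all add: vol_swap23[of x _ f])
    ultimately show ?thesis by (simp add: c_def vol_lin)
  qed
  show ?thesis
  proof (cases "q b b + q b' b' = 0")
    case False
    thus ?thesis using * i n by blast
  next
    case True
    \<comment> \<open>The sum of the norms was zero, so now it is \<open>3 q b' b'\<close>.\<close>
    have "q b b + q (2 \<odot> b') (2 \<odot> b') = 3 * q b' b' + (q b b + q b' b')" by (simp add: V.qbilin)
    hence "q b b + q (2 \<odot> b') (2 \<odot> b') \<noteq> 0" using True three_nz n by simp
    moreover have "V.indep b (2 \<odot> b') f" using V.indepD[OF i] by (simp add: V.indep_def V.qbilin V.bilin)
    moreover have "q (2 \<odot> b') (2 \<odot> b') \<noteq> 0" using n four_nz by (simp add: V.qbilin)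
    ultimately have "scl (q (2 \<odot> b') (2 \<odot> b')) (vol x b f (b \<otimes> f)) = scl (q b b) (vol x (2 \<odot> b') f ((2 \<odot> b') \<otimes> f))"
      using * n by blast
    hence "scl 4 (scl (q b' b') (vol x b f (b \<otimes> f))) = scl 4 (scl (q b b) (vol x b' f (b' \<otimes> f)))"
      by (simp add: V.qbilin V.bilin vol_lin mult.commute)
    thus ?thesis using four_nz by (simp only: scale_cancel_left) simp
  qed
qed

text \<open>By \<open>vol_eq\<close> the line through \<open>e1\<close> and \<open>e2\<close> may be replaced by any other. On images of
  homomorphisms this operator is the identity, which fixes the factor 48.\<close>

definition iso_part :: "'m \<Rightarrow> 'm" where
  "iso_part x = scl (1 / (48 * (q V.e1 V.e1 * q V.e2 V.e2))) (vol x V.e1 V.e2 (V.e1 \<otimes> V.e2))"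

lemma nz48_12: "(48::'f) \<noteq> 0" "(12::'f) \<noteq> 0"
proof -
  have "(48::'f) = 4 * (4 * 3)" "(12::'f) = 4 * 3" by simp_all
  thus "(48::'f) \<noteq> 0" "(12::'f) \<noteq> 0" using four_nz three_nz by (metis mult_eq_0_iff)+
qed

lemma vol_line:
  assumes E: "b \<in> E" "c \<in> E" "b \<noteq> c"
  shows "vol x b c (b \<otimes> c) = scl (48 * (q b b * q c c)) (iso_part x)"
proof -
  let ?g = "\<lambda>b c. scl (1 / (48 * (q b b * q c c))) (vol x b c (b \<otimes> c))"
  have "?g b c = ?g V.e1 V.e2"
  proof (rule V.E_pairs_const[of ?g, OF _ _ E V.e12])
    fix b c assume "b \<in> E" "c \<in> E" "b \<noteq> c"
    have "vol x c b (c \<otimes> b) = vol x b c (b \<otimes> c)"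
      using vol_swap12[of x c b] V.cp_swap[of c b] by (simp add: vol_lin)
    thus "?g b c = ?g c b" by (simp add: mult.commute)
  next
    fix b b' c assume E: "b \<in> E" "b' \<in> E" "c \<in> E" and i: "V.indep b b' c"
    note n = E[THEN V.E_aniso]
    show "?g b c = ?g b' c"
      using arg_cong[OF vol_ratio[OF i n, of x], of "scl (1 / (48 * (q b b * q b' b' * q c c)))"] n
      by (simp add: field_simps)
  qed
  hence g: "?g b c = iso_part x" by (simp only: iso_part_def)
  have "vol x b c (b \<otimes> c) = scl (48 * (q b b * q c c)) (?g b c)"
    using E(1,2)[THEN V.E_aniso] nz48_12 by simp
  thus ?thesis by (simp only: g)
qed

text \<open>Both sides are trilinear, so basis vectors suffice: on an independent triple both sides vanish,
  and on a line they agree by \<open>vol_line\<close>.\<close>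

lemma vol_eq: "vol x f b c = scl (12 * q f (b \<otimes> c)) (iso_part x)"
proof -
  have E: "vol x f b c = scl (12 * q f (b \<otimes> c)) (iso_part x)" if E: "f \<in> E" "b \<in> E" "c \<in> E" for f b c
  proof -
    consider "f = b" | "b = c" | "f = c" | "f \<noteq> b" "b \<noteq> c" "f \<noteq> c" "q f (b \<otimes> c) = 0"
      | "f \<noteq> b" "b \<noteq> c" "f \<noteq> c" "q f (b \<otimes> c) \<noteq> 0" by blast
    thus ?thesis
    proof cases
      case 1 thus ?thesis by (simp add: vol_same12 V.q_cp_assoc[symmetric] V.cp_self)
    next
      case 2 thus ?thesis by (simp add: vol_same23 V.cp_self)
    next
      case 3 thus ?thesis using V.q_sym[of c "b \<otimes> c"] by (simp add: vol_same13 V.q_cp)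
    next
      case 4
      hence "V.indep f b c" using E V.E_orth by (simp add: V.indep_def)
      thus ?thesis using vol_indep E V.E_aniso 4 by simp
    next
      case 5
      obtain e r where e: "e \<in> E" "f \<otimes> b = r \<odot> e" using V.E_cp[OF E(1,2) 5(1)] by blast
      have "q (f \<otimes> b) c \<noteq> 0" using 5 by (simp add: V.q_cp_assoc)
      hence r: "r \<noteq> 0" "e = c" using e V.E_orth[OF e(1) E(3)] by (auto simp: V.qbilin)
      have rr: "r * r * q c c = 4 * (q f f * q b b)"
        using V.q_cp_cp[of f b f] V.E_orth[OF E(1,2) 5(1)] e r by (simp add: V.qbilin mult.assoc)
      have "scl r (vol x f b c) = scl (48 * (q f f * q b b)) (iso_part x)"
        using vol_line[OF E(1,2) 5(1), of x] e r by (simp add: vol_lin)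
      also have "48 * (q f f * q b b) = r * (12 * q f (b \<otimes> c))"
      proof -
        have "q f (b \<otimes> c) = r * q c c" using e r by (simp add: V.q_cp_assoc[symmetric] V.qbilin)
        thus ?thesis using rr by simp algebra
      qed
      finally show ?thesis using r by (simp flip: scale_scale)
    qed
  qed
  show ?thesis
  proof (induction c rule: V.E_induct)
    case (3 c) note c = this
    show ?case
    proof (induction b rule: V.E_induct)
      case (3 b) note b = this
      show ?case
      proof (induction f rule: V.E_induct)
        case (3 f) show ?case using E 3 b c by blast
      qed (simp_all add: vol_lin lin algebra_simps)
    qed (simp_all add: vol_lin lin algebra_simps)
  qed (simp_all add: vol_lin lin algebra_simps)
qed

lemma act_act_act': "scl 3 (x \<star> b \<star> c \<star> c) = tri x (b \<otimes> c) c - scl (12 * q c c) (x \<star> b)" (is "?l = ?r")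
proof (rule eq_by_functionals)
  fix g assume "functional g"
  note g = functionalD[OF this]
  note sw = V.cp_swap[of c b]
  show "g ?l = g ?r"
    using arg_cong[OF act_act_act[of x c b], of g] arg_cong[OF sagle_act[of x c c b], of g]
    by (simp add: tri_def lin g sw V.cp_self V.cp_cp V.q_sym[of c b]) algebra
qed

text \<open>Any \<open>d\<close> is, up to a scalar, \<open>f \<otimes> b\<close> with \<open>b = f \<otimes> d\<close>, and \<open>vol x f b (f \<otimes> b) \<star> (f \<otimes> b)\<close>
  involves only the two generators \<open>f\<close>, \<open>b\<close>, so the cubic identities evaluate it.\<close>

lemma iso_part_act: "iso_part x \<star> d = x \<star> d"
proof -
  have line: "vol x f b (f \<otimes> b) \<star> (f \<otimes> b) = scl (48 * q f f * q b b) (x \<star> (f \<otimes> b))" (is "?l = ?r")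
    if o: "q f b = 0" for f b
  proof -
    define c where "c = f \<otimes> b"
    have c: "b \<otimes> c = (4 * q b b) \<odot> f" "f \<otimes> c = - ((4 * q f f) \<odot> b)" "q c c = 4 * q f f * q b b" "f \<otimes> b = c"
      "q f c = 0" "c \<otimes> c = 0" "q b c = 0" "q c b = 0"
      using o V.q_sym[of b f] V.q_sym[of b c] V.q_sym[of f c]
      by (simp_all add: c_def V.cp_cp_left V.cp_cp_swap V.q_cp_cp V.q_cp_left V.q_cp V.cp_self)
    have "scl 3 (vol x f b c \<star> c) = scl 3 (scl (48 * q f f * q b b) (x \<star> c))" (is "?l = ?r")
    proof (rule eq_by_functionals)
      fix g assume "functional g"
      note g = functionalD[OF this]
      have z: "tri (x \<star> f) f c = 0" "tri (x \<star> b) b c = 0"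
        using c by (simp_all add: tri_act vol_same12 V.cp_self)
      have "scl 3 (x \<star> f \<star> b \<star> c \<star> c) = - scl (12 * q c c) (x \<star> f \<star> b)"
        "scl 3 (x \<star> b \<star> f \<star> c \<star> c) = - scl (12 * q c c) (x \<star> b \<star> f)"
        "scl 3 (x \<star> c \<star> c \<star> c) = - scl (12 * q c c) (x \<star> c)"
        using act_act_act'[of "x \<star> f" b c] act_act_act'[of "x \<star> b" f c] act_act_act'[of x c c] by (simp_all add: c tri_bilin z)
      note e = this[THEN arg_cong, of g]
      show "g ?l = g ?r"
        using e arg_cong[OF act_act_act[of x f c], of g]
        by (simp add: vol_def tri_def lin g c V.cp_self o) algebra
    qed
    thus ?thesis unfolding c_def using three_nz by (simp only: scale_cancel_left) simp
  qed
  show ?thesis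
  proof (induction d rule: V.E_induct)
    case (3 d)
    obtain f where f: "f \<in> E" "f \<noteq> d" using V.E_two by metis
    have o: "q f d = 0" "q d f = 0" using V.E_orth 3 f by metis+
    define b where "b = f \<otimes> d"
    have fb: "f \<otimes> b = - ((4 * q f f) \<odot> d)" "q f b = 0" using o V.q_sym[of f b]
      by (simp_all add: b_def V.cp_cp_left V.q_cp_left)
    have nb: "q b b = 4 * (q f f * q d d)" using o by (simp add: b_def V.q_cp_cp)
    have "q f (b \<otimes> (f \<otimes> b)) = 4 * q b b * q f f"
      using fb(2) by (simp add: V.cp_cp_swap V.qbilin)
    with line[OF fb(2)] have "scl (48 * q f f * q b b) (iso_part x \<star> (f \<otimes> b)) = scl (48 * q f f * q b b) (x \<star> (f \<otimes> b))"
      by (simp add: vol_eq lin mult_ac)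
    moreover have nz: "q f f \<noteq> 0" "q d d \<noteq> 0" using V.E_aniso 3 f by auto
    moreover have "q b b \<noteq> 0" using nb nz four_nz by simp
    ultimately have "iso_part x \<star> (f \<otimes> b) = x \<star> (f \<otimes> b)" using nz48_12 by simp
    thus ?case using nz four_nz by (simp add: fb lin)
  qed (simp_all add: lin)
qed

section \<open>Matrix units and the isotypic component\<close>

definition hom :: "('v \<Rightarrow> 'm) \<Rightarrow> bool" where
  "hom \<phi> \<longleftrightarrow> (\<forall>v w. \<phi> (v + w) = \<phi> v + \<phi> w) \<and> (\<forall>c v. \<phi> (c \<odot> v) = scl c (\<phi> v)) \<and>
     (\<forall>v w. \<phi> v \<star> w = \<phi> (v \<otimes> w))"

lemma homD:
  assumes "hom \<phi>"
  shows "\<phi> (v + w) = \<phi> v + \<phi> w" "\<phi> (c \<odot> v) = scl c (\<phi> v)" "\<phi> v \<star> w = \<phi> (v \<otimes> w)"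
    "\<phi> (v - w) = \<phi> v - \<phi> w" "\<phi> (- v) = - \<phi> v" "\<phi> 0 = 0"
proof -
  show 1: "\<phi> (v + w) = \<phi> v + \<phi> w" "\<phi> (c \<odot> v) = scl c (\<phi> v)" "\<phi> v \<star> w = \<phi> (v \<otimes> w)" for v w c
    using assms by (auto simp: hom_def)
  show 2: "\<phi> (- v) = - \<phi> v" for v using 1(2)[of "-1" v] by simp
  show "\<phi> (v - w) = \<phi> v - \<phi> w" using 1(1)[of v "- w"] 2 by simp
  show "\<phi> 0 = 0" using 1(2)[of 0 0] by simp
qed

definition ann :: "'m set" where "ann = {x. \<forall>v. x \<star> v = 0}"

lemma annD: "x \<in> ann \<Longrightarrow> x \<star> v = 0" by (simp add: ann_def)

lemma iso_part_lin: "iso_part (x + y) = iso_part x + iso_part y" "iso_part (x - y) = iso_part x - iso_part y"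
  "iso_part (- x) = - iso_part x" "iso_part (scl c x) = scl c (iso_part x)"
  by (simp_all add: iso_part_def vol_lin algebra_simps)

lemma iso_part_zero [simp]: "iso_part 0 = 0" using iso_part_lin(4)[of 0 0] by simp

text \<open>The matrix unit that \<open>tri\<close> is up to a multiple of the identity: on the image of a homomorphism
  it sends \<open>\<phi> v\<close> to \<open>q v f\<close> times \<open>\<phi> b\<close>, see \<open>munit_of_hom\<close>.\<close>

definition munit :: "'m \<Rightarrow> 'v \<Rightarrow> 'v \<Rightarrow> 'm" where
  "munit x f b = scl (1 / 12) (tri x f b) + scl (q f b) (iso_part x)"

lemma munit_lin:
  "munit (x + y) f b = munit x f b + munit y f b" "munit (x - y) f b = munit x f b - munit y f b"
  "munit (- x) f b = - munit x f b" "munit (scl r x) f b = scl r (munit x f b)"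
  "munit x (f + f') b = munit x f b + munit x f' b" "munit x (f - f') b = munit x f b - munit x f' b"
  "munit x (- f) b = - munit x f b" "munit x (r \<odot> f) b = scl r (munit x f b)"
  "munit x f (b + b') = munit x f b + munit x f b'" "munit x f (b - b') = munit x f b - munit x f b'"
  "munit x f (- b) = - munit x f b" "munit x f (r \<odot> b) = scl r (munit x f b)"
  by (simp_all add: munit_def tri_bilin iso_part_lin lin algebra_simps)

lemma munit_zero [simp]: "munit 0 f b = 0" "munit x 0 b = 0" "munit x f 0 = 0"
  by (simp_all add: munit_def)

text \<open>This is \<open>vol_eq\<close>, read through the definition of \<open>vol\<close>.\<close>

lemma hom_munit: "hom (munit x f)"
proof -
  have "munit x f b \<star> c = munit x f (b \<otimes> c)" for b c
  proof (rule eq_by_functionals)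
    fix g assume "functional g"
    note g = functionalD[OF this]
    have "scl (12 * q f (b \<otimes> c)) (iso_part x) = tri x f b \<star> c - tri x f (b \<otimes> c) + scl (12 * q f b) (x \<star> c)"
      using vol_eq[of x f b c] by (simp add: vol_def)
    from arg_cong[OF this, of g] show "g (munit x f b \<star> c) = g (munit x f (b \<otimes> c))"
      using nz48_12(2) by (simp add: munit_def lin iso_part_act g) (simp add: field_simps)
  qed
  thus ?thesis by (simp add: hom_def munit_lin)
qed

lemma cp_tri: "(v \<otimes> f) \<otimes> b + 2 \<odot> ((v \<otimes> b) \<otimes> f) - v \<otimes> (f \<otimes> b) =
    12 \<odot> (q v f \<odot> b - q f b \<odot> v)" (is "?l = ?r")
proof (rule V.eq_by_functionals)
  fix g assume "V.functional g"
  note g = V.functionalD[OF this]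
  have e: "v \<otimes> (f \<otimes> b) = (f \<otimes> v) \<otimes> b - ((4 * q f v) \<odot> b + (4 * q f b) \<odot> v - (8 * q v b) \<odot> f)"
    using V.cp_cp_lin[of f v b] V.cp_swap[of v "f \<otimes> b"] by (simp add: algebra_simps)
  have e': "(v \<otimes> b) \<otimes> f = - ((v \<otimes> f) \<otimes> b) + ((4 * q v f) \<odot> b + (4 * q v b) \<odot> f - (8 * q f b) \<odot> v)"
    by (rule eq_minus_swap[OF V.cp_cp_lin])
  show "g ?l = g ?r"
    by (simp add: e e' g V.cp_swap[of f v] V.bilin V.q_sym[of f v])
qed

lemma tri_hom:
  assumes "hom \<phi>"
  shows "tri (\<phi> v) f b = scl 12 (scl (q v f) (\<phi> b) - scl (q f b) (\<phi> v))"
proof -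
  note h = homD[OF assms]
  have "tri (\<phi> v) f b = \<phi> ((v \<otimes> f) \<otimes> b + 2 \<odot> ((v \<otimes> b) \<otimes> f) - v \<otimes> (f \<otimes> b))"
    by (simp add: tri_def h)
  thus ?thesis unfolding cp_tri by (simp add: h)
qed

lemma iso_part_hom:
  assumes "hom \<phi>"
  shows "iso_part (\<phi> v) = \<phi> v"
proof -
  note h = homD[OF assms]
  define c where "c = V.e1 \<otimes> V.e2"
  have n: "q V.e1 V.e1 \<noteq> 0" "q V.e2 V.e2 \<noteq> 0" "q V.e1 V.e2 = 0" "q V.e2 V.e1 = 0"
    using V.e12 V.E_aniso V.E_orth by metis+
  have e: "V.e2 \<otimes> c = (4 * q V.e2 V.e2) \<odot> V.e1" using n by (simp add: c_def V.cp_cp_swap)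
  have "vol (\<phi> v) V.e1 V.e2 c = scl (48 * (q V.e1 V.e1 * q V.e2 V.e2)) (\<phi> v)" (is "?l = ?r")
  proof (rule eq_by_functionals)
    fix g assume "functional g"
    note g = functionalD[OF this]
    show "g ?l = g ?r"
      by (simp add: vol_def tri_hom[OF assms] lin h g e n)
  qed
  thus ?thesis using n nz48_12 by (simp add: iso_part_def c_def)
qed

lemma munit_of_hom:
  assumes "hom \<phi>"
  shows "munit (\<phi> v) f b = scl (q v f) (\<phi> b)"
  unfolding munit_def tri_hom[OF assms] iso_part_hom[OF assms] using nz48_12 by simp

lemma ann_zero:
  assumes "x \<in> ann"
  shows "tri x f b = 0" "vol x f b c = 0" "iso_part x = 0" "munit x f b = 0"
  using annD[OF assms] by (simp_all add: tri_def vol_def iso_part_def munit_def)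

lemma hom_recover:
  assumes "hom \<phi>" "q b b \<noteq> 0"
  shows "\<phi> v = scl (1 / q b b) (munit (\<phi> b) b v)"
  using assms by (simp add: munit_of_hom)

text \<open>The adjoint module is irreducible, and matrix units recover a homomorphism from a single
  value.\<close>

lemma hom_eq:
  assumes "hom \<phi>" "hom \<psi>" "\<phi> b = \<psi> b" "q b b \<noteq> 0"
  shows "\<phi> v = \<psi> v"
  using hom_recover[OF assms(1,4)] hom_recover[OF assms(2,4)] assms(3) by metis

lemma hom_zero_fun: "hom (\<lambda>_. 0)" by (simp add: hom_def)
lemma hom_add: "\<lbrakk>hom \<phi>; hom \<psi>\<rbrakk> \<Longrightarrow> hom (\<lambda>v. \<phi> v + \<psi> v)"
  by (simp add: hom_def act_bilin scale_right_distrib algebra_simps)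
lemma hom_scale: "hom \<phi> \<Longrightarrow> hom (\<lambda>v. scl c (\<phi> v))"
  by (simp add: hom_def act_bilin scale_right_distrib mult.commute)
definition isotypic :: "'m set" where "isotypic = span {\<phi> v | \<phi> v. hom \<phi>}"

lemma isotypicI: "hom \<phi> \<Longrightarrow> \<phi> v \<in> isotypic" unfolding isotypic_def by (rule span_base) blast

lemma isotypic_closed:
  "0 \<in> isotypic" "\<lbrakk>x \<in> isotypic; y \<in> isotypic\<rbrakk> \<Longrightarrow> x + y \<in> isotypic" "\<lbrakk>x \<in> isotypic; y \<in> isotypic\<rbrakk> \<Longrightarrow> x - y \<in> isotypic"
  "x \<in> isotypic \<Longrightarrow> scl c x \<in> isotypic" "x \<in> isotypic \<Longrightarrow> - x \<in> isotypic"
  unfolding isotypic_def by (rule span_zero span_add span_diff span_scale span_neg; assumption?)+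

lemma isotypic_induct [consumes 1, case_names hom add scale]:
  assumes "x \<in> isotypic" "\<And>\<phi> v. hom \<phi> \<Longrightarrow> P (\<phi> v)" "\<And>x y. P x \<Longrightarrow> P y \<Longrightarrow> P (x + y)" "\<And>c x. P x \<Longrightarrow> P (scl c x)"
  shows "P x"
proof -
  have P0: "P 0" using assms(2)[OF hom_zero_fun] .
  from assms(1) show ?thesis unfolding isotypic_def
    by (induction rule: span_induct_alt) (auto intro: P0 assms(2-4))
qed

lemma iso_part_isotypic: "x \<in> isotypic \<Longrightarrow> iso_part x = x"
  by (induction rule: isotypic_induct) (simp_all add: iso_part_hom iso_part_lin)

lemma isotypic_act: "x \<in> isotypic \<Longrightarrow> x \<star> v \<in> isotypic"
  by (induction rule: isotypic_induct) (simp_all add: homD isotypicI act_bilin isotypic_closed)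

text \<open>Modulo \<open>isotypic\<close> all \<open>tri x f b\<close> with \<open>f\<close>, \<open>b\<close> orthogonal vanish, so that \<open>x \<star> f \<star> b\<close> becomes
  \<open>- x \<star> (f \<otimes> b)\<close>. For an independent triple, \<open>x \<star> f \<star> b \<star> c\<close> is then both
  \<open>x \<star> ((f \<otimes> b) \<otimes> c)\<close> and its negative.\<close>

lemma act_in_isotypic: "x \<star> v \<in> isotypic"
proof -
  have half: "x \<in> isotypic" if "scl 2 x \<in> isotypic" for x
    using isotypic_closed(4)[OF that, of "1/2"] two_nz by simp
  have two: "x \<star> f \<star> b + x \<star> (f \<otimes> b) \<in> isotypic" if o: "q f b = 0" for x f b
  proof -
    have t: "tri x f b \<in> isotypic" if "q f b = 0" for f b
      using isotypic_closed(4)[OF isotypicI[OF hom_munit[of x f], of b], of 12] that nz48_12 by (simp add: munit_def)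
    have s1: "x \<star> f \<star> b + x \<star> b \<star> f \<in> isotypic"
    proof -
      have "tri x f b + tri x b f = scl 3 (x \<star> f \<star> b + x \<star> b \<star> f)" (is "?l = ?r")
      proof (rule eq_by_functionals)
        fix g assume "functional g"
        note g = functionalD[OF this]
        show "g ?l = g ?r" by (simp add: tri_def lin g V.cp_swap[of b f])
      qed
      moreover have "tri x f b + tri x b f \<in> isotypic" using t o V.q_sym[of b f] isotypic_closed by simp
      ultimately have "scl (1 / 3) (scl 3 (x \<star> f \<star> b + x \<star> b \<star> f)) \<in> isotypic" using isotypic_closed(4) by metis
      thus ?thesis using three_nz by simp
    qed
    have "scl 2 (x \<star> f \<star> b + x \<star> (f \<otimes> b)) = x \<star> f \<star> b + x \<star> b \<star> f + (tri x b f - tri x f b) - (x \<star> f \<star> b + x \<star> b \<star> f) + (x \<star> f \<star> b + x \<star> b \<star> f)"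
      (is "?l = ?r")
    proof (rule eq_by_functionals)
      fix g assume "functional g"
      note g = functionalD[OF this]
      show "g ?l = g ?r" by (simp add: tri_def lin g V.cp_swap[of b f])
    qed
    moreover have "?r \<in> isotypic" using t o V.q_sym[of b f] s1 isotypic_closed by simp
    ultimately show ?thesis using half by metis
  qed
  have three: "x \<star> ((f \<otimes> b) \<otimes> c) \<in> isotypic" if i: "V.indep f b c" for f b c
  proof -
    note D = V.indepD[OF i]
    have "(x \<star> f \<star> b + x \<star> (f \<otimes> b)) \<star> c \<in> isotypic" "x \<star> (f \<otimes> b) \<star> c + x \<star> ((f \<otimes> b) \<otimes> c) \<in> isotypic"
      by (rule isotypic_act[OF two] two; use D in simp)+
    note 1 = isotypic_closed(3)[OF this(2,1)]
    have "(x \<star> f) \<star> b \<star> c + (x \<star> f) \<star> (b \<otimes> c) \<in> isotypic" "x \<star> f \<star> (b \<otimes> c) + x \<star> (f \<otimes> (b \<otimes> c)) \<in> isotypic"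
      by (rule two; use D in simp)+
    note 2 = isotypic_closed(3)[OF this]
    note isotypic_closed(2)[OF 1 2]
    moreover have "(x \<star> (f \<otimes> b) \<star> c + x \<star> ((f \<otimes> b) \<otimes> c)) - (x \<star> f \<star> b + x \<star> (f \<otimes> b)) \<star> c +
       ((x \<star> f \<star> b \<star> c + x \<star> f \<star> (b \<otimes> c)) - (x \<star> f \<star> (b \<otimes> c) + x \<star> (f \<otimes> (b \<otimes> c))))
       = scl 2 (x \<star> ((f \<otimes> b) \<otimes> c))" (is "?l = ?r")
    proof (rule eq_by_functionals)
      fix g assume "functional g"
      note g = functionalD[OF this]
      show "g ?l = g ?r" using D by (simp add: lin g)
    qed
    ultimately show ?thesis using half by simp
  qed
  show ?thesis
  proof (induction v rule: V.E_induct)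
    case (3 e)
    obtain r f b c where "V.indep f b c" "e = r \<odot> ((f \<otimes> b) \<otimes> c)" by (rule V.E_triple[OF 3]) blast
    thus ?case using three by (simp add: act_bilin isotypic_closed)
  qed (simp_all add: lin isotypic_closed)
qed

lemma iso_part_of_act: "iso_part (x \<star> v) = x \<star> v" by (rule iso_part_isotypic[OF act_in_isotypic])

lemma tri_same_arg: "tri x a a = scl 3 (x \<star> a \<star> a)" (is "?l = ?r")
proof (rule eq_by_functionals)
  fix g assume "functional g"
  note g = functionalD[OF this]
  show "g ?l = g ?r" by (simp add: tri_def lin g V.cp_self)
qed

lemma act_act_same: "x \<star> a \<star> a = scl 4 (munit x a a) - scl (4 * q a a) (iso_part x)"
proof -
  have "(4::'f) * (1 / 12 * 3) = 1" using nz48_12 by simp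
  thus ?thesis by (simp add: munit_def tri_same_arg scale_right_distrib)
qed

lemma iso_part_in_isotypic: "iso_part x \<in> isotypic"
proof -
  let ?a = "V.e1"
  have n: "q ?a ?a \<noteq> 0" using V.e12 V.E_aniso by blast
  have "scl (1 / (4 * q ?a ?a)) (scl 4 (munit x ?a ?a) - x \<star> ?a \<star> ?a) \<in> isotypic"
    using hom_munit isotypicI act_in_isotypic isotypic_closed by metis
  thus ?thesis using n four_nz by (simp add: act_act_same)
qed

lemma diff_iso_part_ann: "x - iso_part x \<in> ann" by (simp add: ann_def act_bilin iso_part_act)

lemma munit_iso_part: "munit (iso_part x) f b = munit x f b"
  using ann_zero(4)[OF diff_iso_part_ann, of x f b] by (simp add: munit_lin)

text \<open>The matrix unit absorbs an operator on its left, as it should by invariance of \<open>q\<close>.\<close>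

lemma munit_act: "munit (x \<star> a) f b = munit x (a \<otimes> f) b" (is "?l = ?r")
proof (rule eq_by_functionals)
  fix g assume "functional g"
  note g = functionalD[OF this]
  show "g ?l = g ?r" using nz48_12
    by (simp add: munit_def tri_act iso_part_of_act vol_eq V.q_cp_assoc lin g field_simps)
qed

text \<open>The diagonal matrix units add up to the identity on \<open>isotypic\<close>.\<close>

lemma iso_part_expand: "iso_part x = (\<Sum>e\<in>E. scl (1 / q e e) (munit x e e))"
proof -
  have "x = (\<Sum>e\<in>E. scl (1 / q e e) (munit x e e))" if "x \<in> isotypic" for x
    using that
  proof (induction rule: isotypic_induct)
    case (hom \<phi> v)
    have sum: "\<phi> (\<Sum>e\<in>F. h e) = (\<Sum>e\<in>F. \<phi> (h e))" if "finite F" for F and h :: "'v \<Rightarrow> 'v"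
      using that by induction (simp_all add: homD[OF hom])
    have "\<phi> v = \<phi> (\<Sum>e\<in>E. (q v e / q e e) \<odot> e)" by (simp flip: V.E_expand)
    also have "\<dots> = (\<Sum>e\<in>E. scl (1 / q e e) (munit (\<phi> v) e e))"
      unfolding sum[OF V.finite_E] by (simp add: homD[OF hom] munit_of_hom[OF hom])
    finally show ?case .
  next
    case (add x y)
    from add show ?case unfolding munit_lin scale_right_distrib sum.distrib
      by (rule arg_cong2[where f = "(+)"])
  next
    case (scale c x)
    have "(\<Sum>e\<in>E. scl (1 / q e e) (munit (scl c x) e e)) = scl c (\<Sum>e\<in>E. scl (1 / q e e) (munit x e e))"
      by (simp add: munit_lin scale_sum_right mult.commute)
    from trans[OF arg_cong[OF scale, of "scl c"] this[symmetric]] show ?case .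
  qed
  from this[OF iso_part_in_isotypic[of x]] show ?thesis by (simp add: munit_iso_part)
qed

section \<open>Products with the annihilator\<close>

lemma act_left_hom: "hom \<phi> \<Longrightarrow> \<iota> v \<cdot> \<phi> w = - \<phi> (w \<otimes> v)"
  by (simp add: act_left homD)

text \<open>Sagle's identity makes \<open>Q = x \<cdot> \<phi>\<close> vanish on the Jacobians of \<open>V\<close>, and independent triples show
  that these span \<open>V\<close>.\<close>

lemma ann_mult_hom:
  assumes n: "x \<in> ann" and h: "hom \<phi>"
  shows "x \<cdot> \<phi> v = 0"
proof -
  note h' = homD[OF h] and n' = annD[OF n]
  define Q where "Q c = x \<cdot> \<phi> c" for c
  have Q: "Q (r \<odot> c) = scl r (Q c)" "Q (- c) = - Q c" "Q (c + c') = Q c + Q c'" for r c c'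
    by (simp_all add: Q_def h' mult_bilin)
  have Q0: "Q 0 = 0" using Q(1)[of 0 0] by simp
  have sw: "\<phi> c \<cdot> x = - Q c" "\<iota> c \<cdot> x = 0" for c
    using mult_swap[of "\<phi> c" x] act_left[of c x] n' by (simp_all add: Q_def)
  have 1: "Q c \<star> d \<star> d' = Q (c \<otimes> (d \<otimes> d')) + Q (c \<otimes> d') \<star> d" for c d d'
  proof -
    have "(\<iota> d \<cdot> \<iota> d') \<cdot> \<phi> c = - \<phi> (c \<otimes> (d \<otimes> d'))" by (simp only: iota_cp[symmetric] act_left_hom[OF h])
    thus ?thesis
      using sagle[OF two_nz, of x "\<iota> d'" "\<iota> d" "\<phi> c"] n'[unfolded act_def] sw(1)[of c] sw(1)[of "c \<otimes> d'"] sw(1)[of "c \<otimes> (d \<otimes> d')"]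
      by (simp add: act_left_hom[OF h] mult_bilin Q_def act_def algebra_simps)
  qed
  have 2: "Q c \<star> d \<star> d' = Q ((c \<otimes> d) \<otimes> d')" for c d d'
  proof -
    have "(\<iota> d \<cdot> \<iota> d') \<cdot> x = 0" using sw(2)[of "d \<otimes> d'"] by (simp add: iota_cp)
    moreover have "\<phi> c \<cdot> \<iota> d \<cdot> \<iota> d' = \<phi> ((c \<otimes> d) \<otimes> d')" by (simp only: act_def[symmetric] h')
    ultimately show ?thesis
      using sagle[OF two_nz, of x "\<iota> d" "\<phi> c" "\<iota> d'"] n'[unfolded act_def] sw(2)[of d'] sw(1)[of "(c \<otimes> d) \<otimes> d'"]
      by (simp add: Q_def act_def algebra_simps)
  qed
  \<comment> \<open>Every \<open>b\<close> orthogonal to \<open>d\<close> is a multiple of \<open>(b \<otimes> d) \<otimes> d\<close>.\<close>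
  have orth: "Q b \<star> d = Q (b \<otimes> d)" if "q b d = 0" "q d d \<noteq> 0" for b d
  proof -
    have "(b \<otimes> d) \<otimes> d = - ((4 * q d d) \<odot> b)" using that by (simp add: V.cp_cp)
    hence "scl (4 * q d d) (Q b \<star> d) = scl (4 * q d d) (Q (b \<otimes> d))"
      using 1[of "b \<otimes> d" d d] 2[of "b \<otimes> d" d d] by (auto simp: V.cp_self Q Q0 lin)
    thus ?thesis using that four_nz by simp
  qed
  have indep: "Q ((c \<otimes> d) \<otimes> d') = 0" if i: "V.indep c d d'" and nd: "q d d \<noteq> 0" for c d d'
  proof -
    note D = V.indepD[OF i]
    have "q (c \<otimes> d') d = 0" using D(11) by (simp add: V.q_cp_assoc)
    from orth[OF this nd] have "Q (c \<otimes> d') \<star> d = - Q ((c \<otimes> d) \<otimes> d')" using D(14) by (simp add: Q)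
    from trans[OF 2[symmetric] 1, of c d d', unfolded this D(15) Q add_uminus_conv_diff]
    have "scl 3 (Q ((c \<otimes> d) \<otimes> d')) = 0" by (rule scale_three_eq_0)
    thus ?thesis using three_nz by simp
  qed
  have "Q v = 0"
  proof (induction v rule: V.E_induct)
    case (3 e)
    obtain r f b c where "V.indep f b c" "q b b \<noteq> 0" "e = r \<odot> ((f \<otimes> b) \<otimes> c)" by (rule V.E_triple[OF 3]) blast
    thus ?case using indep by (simp add: Q)
  qed (simp_all add: Q Q0)
  thus ?thesis by (simp add: Q_def)
qed

lemma ann_mult_isotypic: "\<lbrakk>x \<in> ann; y \<in> isotypic\<rbrakk> \<Longrightarrow> x \<cdot> y = 0"
  by (rotate_tac 1, induction rule: isotypic_induct) (simp_all add: ann_mult_hom mult_bilin)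

lemma ann_mult_ann:
  assumes "x \<in> ann" "y \<in> ann"
  shows "x \<cdot> y \<in> ann"
proof -
  have "(x \<cdot> y) \<star> v = 0" for v
  proof (induction v rule: V.E_induct)
    case (3 e)
    obtain r d w where e: "e = r \<odot> (d \<otimes> w)" using V.E_prod[OF 3] .
    have "\<iota> v \<cdot> x = 0" "\<iota> v \<cdot> y = 0" for v using act_left annD assms by simp_all
    hence "(x \<cdot> y) \<star> (d \<otimes> w) = 0"
      using sagle[OF two_nz, of x y "\<iota> d" "\<iota> w"] annD[OF assms(1)] annD[OF assms(2)]
      by (simp add: act_def iota_cp)
    thus ?case by (simp add: e act_bilin)
  qed (simp_all add: act_bilin)
  thus ?thesis by (simp add: ann_def)
qed

text \<open>If all Jacobians \<open>J(x, a, b)\<close> vanish, then so do the matrix units at \<open>x\<close> in the directions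
  \<open>(c \<otimes> b) \<otimes> a\<close>, because \<open>munit_act\<close> turns the Jacobian into one of \<open>V\<close>.\<close>

lemma ann_eq_jacobian_annihilator: "jacobian_annihilator (\<cdot>) (range \<iota>) = ann"
proof
  show "ann \<subseteq> jacobian_annihilator (\<cdot>) (range \<iota>)"
  proof
    fix x assume x: "x \<in> ann"
    have 0: "\<iota> b \<cdot> x = 0" "x \<cdot> \<iota> b = 0" for b
      using act_left[of b x] annD[OF x] by (simp_all add: act_def)
    have "\<iota> a \<cdot> \<iota> b \<cdot> x = 0" for a b using 0(1)[of "a \<otimes> b"] by (simp add: iota_cp)
    thus "x \<in> jacobian_annihilator (\<cdot>) (range \<iota>)" using 0 by (auto simp: jacobian_annihilator_def jacobian_def)
  qed
next
  show "jacobian_annihilator (\<cdot>) (range \<iota>) \<subseteq> ann"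
  proof
    fix x assume "x \<in> jacobian_annihilator (\<cdot>) (range \<iota>)"
    hence J0: "jacobian (\<cdot>) x (\<iota> a) (\<iota> b) = 0" for a b by (auto simp: jacobian_annihilator_def)
    have "x \<star> a \<star> b - x \<star> (a \<otimes> b) - x \<star> b \<star> a = 0" for a b
      using J0[of a b] act_left[of "a \<otimes> b" x] act_left[of b x] by (simp add: jacobian_def iota_cp act_def mult_bilin)
    note J1 = this
    have J: "x \<star> a \<star> b = x \<star> (a \<otimes> b) + x \<star> b \<star> a" for a b using J1[of a b] by (simp add: diff_diff_eq)
    have "munit x f = (\<lambda>_. 0)" if f: "f \<in> E" for f
    proof
      fix v
      obtain r c b a where *: "V.indep c b a" "f = r \<odot> ((c \<otimes> b) \<otimes> a)" by (rule V.E_triple[OF f]) blast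
      note D = V.indepD[OF V.indep_rot[OF *(1)]] V.indepD[OF V.indep_swap[OF V.indep_rot[OF V.indep_rot[OF *(1)]]]]
      note D' = V.indepD[OF *(1)]
      have "munit (x \<star> a \<star> b) c v = munit (x \<star> (a \<otimes> b) + x \<star> b \<star> a) c v"
        by (rule arg_cong[OF J])
      hence m: "munit x (a \<otimes> (b \<otimes> c)) v = munit x ((a \<otimes> b) \<otimes> c) v + munit x (b \<otimes> (a \<otimes> c)) v"
        by (simp add: munit_lin munit_act)
      have s: "a \<otimes> (b \<otimes> c) = (c \<otimes> b) \<otimes> a" "(a \<otimes> b) \<otimes> c = - ((c \<otimes> b) \<otimes> a)" "b \<otimes> (a \<otimes> c) = - ((c \<otimes> b) \<otimes> a)"
        using V.cp_swap[of a "b \<otimes> c"] V.cp_swap[of b c] V.cp_swap[of b "a \<otimes> c"] V.cp_swap[of a c]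
          V.cp_swap[of "a \<otimes> b" c] V.cp_swap[of a b] D'(14,15) by (simp_all add: V.bilin)
      have "scl 3 (munit x ((c \<otimes> b) \<otimes> a) v) = 0"
        using m unfolding s munit_lin add_uminus_conv_diff by (rule scale_three_eq_0)
      thus "munit x f v = 0" using three_nz by (simp add: * munit_lin)
    qed
    hence "iso_part x = 0" by (simp add: iso_part_expand)
    with diff_iso_part_ann[of x] show "x \<in> ann" by simp
  qed
qed

section \<open>Products inside the isotypic component\<close>

text \<open>\<open>h\<close> with \<open>\<phi> b\<close> in its third slot and \<open>\<psi>\<close> in its first one, in the manner of \<open>tri_same\<close>.\<close>

lemma hom_mult_square:
  assumes h: "hom \<phi>" "hom \<psi>"
  shows "(\<phi> b \<cdot> \<psi> c) \<star> a \<star> a + scl 2 ((\<phi> (b \<otimes> a) \<cdot> \<psi> c) \<star> a) - (\<phi> b \<cdot> \<psi> (c \<otimes> a)) \<star> a =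
    - scl (12 * q c a) (\<phi> b \<cdot> \<psi> a)"
proof -
  have prod: "(\<phi> b \<cdot> \<psi> (y \<otimes> z)) \<star> a \<star> a + scl 2 ((\<phi> (b \<otimes> a) \<cdot> \<psi> (y \<otimes> z)) \<star> a) - (\<phi> b \<cdot> \<psi> ((y \<otimes> z) \<otimes> a)) \<star> a =
    - scl (12 * q (y \<otimes> z) a) (\<phi> b \<cdot> \<psi> a)" (is "?l = ?r") for y z
  proof -
    have sq: "brace scl (\<cdot>) (\<psi> (y \<otimes> z)) (\<phi> b) (\<iota> a) \<star> a + brace scl (\<cdot>) (\<psi> (y \<otimes> a)) (\<iota> z) (\<iota> a) \<cdot> \<phi> b = 0"
      using h_square[of "\<psi> y" "\<iota> z" "\<phi> b" "\<iota> a"] by (simp only: act_def[symmetric] homD(3)[OF h(2)])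
    have 1: "brace scl (\<cdot>) (\<psi> (y \<otimes> z)) (\<phi> b) (\<iota> a)
        = - ((\<phi> b \<cdot> \<psi> (y \<otimes> z)) \<star> a) + \<phi> b \<cdot> \<psi> ((y \<otimes> z) \<otimes> a) - scl 2 (\<phi> (b \<otimes> a) \<cdot> \<psi> (y \<otimes> z))"
      unfolding brace_def act_def[symmetric] homD(3)[OF h(1)] homD(3)[OF h(2)]
      using mult_swap[of "\<psi> (y \<otimes> z)" "\<phi> b"] mult_swap[of "\<psi> ((y \<otimes> z) \<otimes> a)" "\<phi> b"] mult_swap[of "\<psi> (y \<otimes> z)" "\<phi> (b \<otimes> a)"]
      by (simp add: act_bilin)
    have "q (y \<otimes> a) z = - q (y \<otimes> z) a"
      using V.cp_swap[of a z] by (simp add: V.q_cp_assoc V.qbilin)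
    hence 2: "brace scl (\<cdot>) (\<psi> (y \<otimes> a)) (\<iota> z) (\<iota> a) = scl (12 * q (y \<otimes> z) a) (\<psi> a)"
      unfolding brace_iota_left(3) tri_hom[OF h(2)] by (simp add: V.q_cp V.q_sym[of z a] algebra_simps)
    have 3: "\<psi> a \<cdot> \<phi> b = - (\<phi> b \<cdot> \<psi> a)" by (rule mult_swap)
    show ?thesis
    proof (rule eq_by_functionals)
      fix g assume "functional g"
      note g = functionalD[OF this]
      show "g ?l = g ?r"
        using arg_cong[OF sq, of g] by (simp add: 1 2 3 lin mult_bilin g) algebra
    qed
  qed
  define D where "D c = (\<phi> b \<cdot> \<psi> c) \<star> a \<star> a + scl 2 ((\<phi> (b \<otimes> a) \<cdot> \<psi> c) \<star> a) - (\<phi> b \<cdot> \<psi> (c \<otimes> a)) \<star> a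
    + scl (12 * q c a) (\<phi> b \<cdot> \<psi> a)" for c
  have D: "D (c + c') = D c + D c'" "D (r \<odot> c) = scl r (D c)" for c c' r
    unfolding D_def by (simp_all add: homD[OF h(2)] lin mult_bilin algebra_simps)
  have "D c = 0"
  proof (induction c rule: V.E_induct)
    case (3 e)
    obtain r d w where e: "e = r \<odot> (d \<otimes> w)" using V.E_prod[OF 3] .
    have "D (d \<otimes> w) = 0" unfolding D_def prod by simp
    thus ?case by (simp add: e D)
  qed (simp_all add: D)
  thus ?thesis unfolding D_def by (simp add: eq_neg_iff_add_eq_0)
qed

text \<open>For \<open>b = c = a\<close>, \<open>hom_mult_square\<close> says that \<open>p = \<phi> a \<cdot> \<psi> a\<close> is an eigenvector of the squared
  operator of \<open>a\<close> for \<open>- 12 q a a\<close>, while on \<open>p \<star> a\<close> the only eigenvalue is \<open>- 4 q a a\<close>; so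
  \<open>p = 0\<close>, and polarization gives skew symmetry.\<close>

lemma hom_mult_swap:
  assumes h: "hom \<phi>" "hom \<psi>"
  shows "\<phi> c \<cdot> \<psi> b = - (\<phi> b \<cdot> \<psi> c)"
proof -
  note H = homD[OF h(1)] homD[OF h(2)]
  have aniso: "\<phi> a \<cdot> \<psi> a = 0" if n: "q a a \<noteq> 0" for a
  proof -
    define p where "p = \<phi> a \<cdot> \<psi> a"
    have 1: "p \<star> a \<star> a = - scl (12 * q a a) p"
      using hom_mult_square[OF h, of a a a] by (simp add: p_def V.cp_self H)
    have "scl (12 * q a a) (p \<star> a) = scl (4 * q a a) (p \<star> a)"
      using act_act_same[of "p \<star> a" a] by (simp add: 1 munit_act V.cp_self iso_part_of_act lin)
    moreover have "(8::'f) = 2 * 4" "(12::'f) - 4 = 8" by simp_all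
    hence "(12::'f) \<noteq> 4" using two_nz four_nz by (metis eq_iff_diff_eq_0 mult_eq_0_iff)
    ultimately have "p \<star> a = 0" using n by simp
    thus ?thesis using 1 n nz48_12 by (simp add: p_def)
  qed
  have E: "\<phi> c \<cdot> \<psi> b + \<phi> b \<cdot> \<psi> c = 0" if E: "b \<in> E" "c \<in> E" for b c
  proof (cases "b = c")
    case True
    thus ?thesis using aniso V.E_aniso E by simp
  next
    case False
    have o: "q b c = 0" "q c b = 0" using False V.E_orth E by metis+
    have n: "q b b \<noteq> 0" "q c c \<noteq> 0" using V.E_aniso E by auto
    obtain s where s: "s \<noteq> 0" "q b b + s * s * q c c \<noteq> 0"
    proof (cases "q b b + q c c = 0")
      case True
      have "q b b + 2 * 2 * q c c = 3 * q c c + (q b b + q c c)" by simp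
      hence "q b b + 2 * 2 * q c c \<noteq> 0" using True n three_nz by (simp only: mult_eq_0_iff) simp
      thus ?thesis using that two_nz by blast
    next
      case False
      thus ?thesis using that[of 1] by simp
    qed
    have "q (b + s \<odot> c) (b + s \<odot> c) \<noteq> 0" using s o by (simp add: V.qbilin mult.assoc)
    from aniso[OF this] have "scl s (\<phi> c \<cdot> \<psi> b + \<phi> b \<cdot> \<psi> c) = 0"
      using aniso n by (simp add: H mult_bilin scale_right_distrib add.commute)
    thus ?thesis using s by simp
  qed
  define D where "D b c = \<phi> c \<cdot> \<psi> b + \<phi> b \<cdot> \<psi> c" for b c
  have D: "D (b + b') c = D b c + D b' c" "D (r \<odot> b) c = scl r (D b c)"
    "D b (c + c') = D b c + D b c'" "D b (r \<odot> c) = scl r (D b c)" for b b' c c' r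
    unfolding D_def by (simp_all add: H mult_bilin algebra_simps)
  have "D b c = 0"
  proof (induction c rule: V.E_induct)
    case (3 c)
    note c = this
    show ?case
    proof (induction b rule: V.E_induct)
      case (3 b)
      show ?case using E[OF 3 c] by (simp add: D_def)
    qed (simp_all add: D)
  qed (simp_all add: D)
  thus ?thesis by (simp add: D_def eq_neg_iff_add_eq_0)
qed

text \<open>Sagle's identity with \<open>d\<close> in two opposite slots.\<close>

lemma hom_mult_double:
  assumes h: "hom \<phi>" "hom \<psi>"
  shows "(\<phi> (b \<otimes> d) \<cdot> \<psi> c) \<star> d - (\<phi> b \<cdot> \<psi> (c \<otimes> d)) \<star> d =
    \<phi> ((b \<otimes> d) \<otimes> d) \<cdot> \<psi> c - \<phi> b \<cdot> \<psi> ((c \<otimes> d) \<otimes> d)"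
proof -
  note H = homD[OF h(1)] homD[OF h(2)] act_left_hom[OF h(1)] act_left_hom[OF h(2)]
  have 1: "\<phi> b \<cdot> \<iota> d = \<phi> (b \<otimes> d)" "\<psi> b \<cdot> \<iota> d = \<psi> (b \<otimes> d)" for b d
    by (simp_all only: act_def[symmetric] H)
  show ?thesis
    using sagle[OF two_nz, of "\<phi> b" "\<psi> c" "\<iota> d" "\<iota> d"]
      mult_swap[of "\<psi> ((c \<otimes> d) \<otimes> d)" "\<phi> b"] mult_swap[of "\<psi> (c \<otimes> d)" "\<phi> b"]
    by (simp add: 1 H mult_self mult_bilin act_def) (simp add: algebra_simps)
qed

lemma hom_mult_orth:
  assumes h: "hom \<phi>" "hom \<psi>" and o: "q b d = 0" and n: "q d d \<noteq> 0"
  shows "(\<phi> b \<cdot> \<psi> d) \<star> d = \<phi> (b \<otimes> d) \<cdot> \<psi> d"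
proof -
  note H = homD[OF h(1)] homD[OF h(2)]
  have "(b \<otimes> d) \<otimes> d = - ((4 * q d d) \<odot> b)" using o by (simp add: V.cp_cp)
  hence "scl (4 * q d d) ((\<phi> b \<cdot> \<psi> d) \<star> d) = scl (4 * q d d) (\<phi> (b \<otimes> d) \<cdot> \<psi> d)"
    using hom_mult_double[OF h, of "b \<otimes> d" d d] by (simp add: H V.cp_self lin mult_bilin del: scale_cancel_left)
  thus ?thesis using n four_nz by simp
qed

lemma hom_mult_via:
  assumes h: "hom \<phi>" "hom \<psi>" and o: "q b d = 0" and n: "q d d \<noteq> 0"
  shows "\<phi> b \<cdot> \<psi> d = scl (- 1 / (4 * q d d)) ((\<phi> (b \<otimes> d) \<cdot> \<psi> d) \<star> d)"
proof -
  have "(b \<otimes> d) \<otimes> d = - ((4 * q d d) \<odot> b)" using o by (simp add: V.cp_cp)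
  thus ?thesis using n four_nz hom_mult_orth[OF h _ n, of "b \<otimes> d"]
    by (simp add: V.q_cp homD[OF h(1)] mult_bilin)
qed

lemma hom_mult_isotypic:
  assumes "hom \<phi>" "hom \<psi>" "q b d = 0" "q d d \<noteq> 0"
  shows "\<phi> b \<cdot> \<psi> d \<in> isotypic"
  unfolding hom_mult_via[OF assms] by (intro isotypic_closed(4) act_in_isotypic)

lemma munit_hom_mult_right:
  assumes "hom \<phi>" "hom \<psi>" "q b d = 0" "q d d \<noteq> 0"
  shows "munit (\<phi> b \<cdot> \<psi> d) d v = 0"
  unfolding hom_mult_via[OF assms] by (simp add: munit_lin munit_act V.cp_self)

lemma munit_hom_mult_left:
  assumes "hom \<phi>" "hom \<psi>" "q b d = 0" "q b b \<noteq> 0"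
  shows "munit (\<phi> b \<cdot> \<psi> d) b v = 0"
  using munit_hom_mult_right[OF assms(1,2), of d b v] assms(3,4) V.q_sym[of d b]
  by (subst hom_mult_swap[OF assms(1,2)]) (simp add: munit_lin)

text \<open>The expected relation \<open>\<phi> (b \<otimes> a) \<cdot> \<psi> c = - (\<phi> b \<cdot> \<psi> c) \<star> a\<close> holds at least up to elements
  killed by \<open>a\<close>.\<close>

lemma hom_mult_defect:
  assumes h: "hom \<phi>" "hom \<psi>" and o: "q b a = 0" "q c a = 0"
  shows "(\<phi> (b \<otimes> a) \<cdot> \<psi> c + (\<phi> b \<cdot> \<psi> c) \<star> a) \<star> a = 0"
proof (rule eq_by_functionals)
  fix g assume "functional g"
  note g = functionalD[OF this]
  note H = homD[OF h(1)] homD[OF h(2)]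
  have "(b \<otimes> a) \<otimes> a = - ((4 * q a a) \<odot> b)" "(c \<otimes> a) \<otimes> a = - ((4 * q a a) \<odot> c)"
    using o by (simp_all add: V.cp_cp)
  thus "g ((\<phi> (b \<otimes> a) \<cdot> \<psi> c + (\<phi> b \<cdot> \<psi> c) \<star> a) \<star> a) = g 0"
    using arg_cong[OF hom_mult_square[OF h, of b c a], of g] arg_cong[OF hom_mult_double[OF h, of b a c], of g] o
    by (simp add: H mult_bilin lin g)
qed

lemma munit_act_zero:
  assumes "u \<star> a = 0" "q w a = 0" "q a a \<noteq> 0"
  shows "munit u w v = 0"
proof -
  have "munit u (a \<otimes> (a \<otimes> w)) v = munit (u \<star> a) (a \<otimes> w) v" by (simp add: munit_act)
  also have "\<dots> = 0" by (simp add: assms(1))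
  finally show ?thesis using assms(2,3) four_nz by (simp add: V.cp_cp_left munit_lin)
qed

text \<open>With \<open>a = c \<otimes> k\<close> the product \<open>\<phi> b \<cdot> \<psi> c\<close> is, up to a scalar and an element killed by \<open>a\<close>, the
  image under \<open>a\<close> of a product \<open>\<phi> b' \<cdot> \<psi> c\<close>. The latter has no component along \<open>c\<close>, and \<open>a\<close>
  moves the direction \<open>c\<close> to \<open>k\<close>.\<close>

lemma munit_hom_mult_indep:
  assumes h: "hom \<phi>" "hom \<psi>" and i: "V.indep b c k" and n: "q c c \<noteq> 0" "q k k \<noteq> 0"
  shows "munit (\<phi> b \<cdot> \<psi> c) k v = 0"
proof -
  note D = V.indepD[OF i]
  note H = homD[OF h(1)] homD[OF h(2)]
  define a where "a = c \<otimes> k"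
  define b' where "b' = b \<otimes> a"
  have na: "q a a \<noteq> 0" using n D four_nz by (simp add: a_def V.q_cp_cp)
  have o: "q b a = 0" "q c a = 0" "q k a = 0" "q b' a = 0"
    using D(7) V.q_sym[of c a] V.q_sym[of k a] V.q_cp[of b a] by (simp_all add: a_def b'_def V.q_cp V.q_cp_left)
  have o': "q b' c = 0" using D by (simp add: b'_def a_def V.q_cp_assoc V.cp_cp_mid V.cp_cp_swap V.qbilin)
  have ba: "b' \<otimes> a = - ((4 * q a a) \<odot> b)" using o by (simp add: b'_def V.cp_cp)
  have ak: "a \<otimes> k = - ((4 * q k k) \<odot> c)" using D by (simp add: a_def V.cp_cp)
  have "munit (\<phi> (b' \<otimes> a) \<cdot> \<psi> c + (\<phi> b' \<cdot> \<psi> c) \<star> a) k v = 0"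
    by (rule munit_act_zero[OF hom_mult_defect[OF h o(4,2)] o(3) na])
  moreover have "munit ((\<phi> b' \<cdot> \<psi> c) \<star> a) k v = 0"
    using munit_hom_mult_right[OF h o' n(1)] by (simp add: munit_act ak munit_lin)
  ultimately show ?thesis using na four_nz by (simp add: munit_lin ba H mult_bilin)
qed

text \<open>The homomorphism whose value at \<open>b \<otimes> c\<close> is the component of \<open>\<phi> b \<cdot> \<psi> c\<close> along \<open>b \<otimes> c\<close>.\<close>

definition pair_prod :: "('v \<Rightarrow> 'm) \<Rightarrow> ('v \<Rightarrow> 'm) \<Rightarrow> 'v \<Rightarrow> 'v \<Rightarrow> 'v \<Rightarrow> 'm" where
  "pair_prod \<phi> \<psi> b c v = scl (1 / q (b \<otimes> c) (b \<otimes> c)) (munit (\<phi> b \<cdot> \<psi> c) (b \<otimes> c) v)"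

lemma hom_pair_prod: "hom (pair_prod \<phi> \<psi> b c)"
  unfolding pair_prod_def by (rule hom_scale[OF hom_munit])

lemma pair_prod:
  assumes h: "hom \<phi>" "hom \<psi>" and E: "b \<in> E" "c \<in> E" "b \<noteq> c"
  shows "\<phi> b \<cdot> \<psi> c = pair_prod \<phi> \<psi> b c (b \<otimes> c)"
proof -
  have o: "q b c = 0" "q c b = 0" using V.E_orth E by metis+
  have n: "q b b \<noteq> 0" "q c c \<noteq> 0" using V.E_aniso E by auto
  obtain r e where e: "e \<in> E" "b \<otimes> c = r \<odot> e" using V.E_cp[OF E] by blast
  have "q (b \<otimes> c) (b \<otimes> c) \<noteq> 0" using n o four_nz by (simp add: V.q_cp_cp)
  hence r: "r \<noteq> 0" using e by (auto simp: V.qbilin)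
  let ?P = "\<phi> b \<cdot> \<psi> c"
  have z: "munit ?P d v = 0" if "d \<in> E" "d \<noteq> e" for d v
  proof -
    consider "d = b" | "d = c" | "d \<noteq> b" "d \<noteq> c" by blast
    thus ?thesis
    proof cases
      case 3
      have "q b (c \<otimes> d) = 0" using V.E_orth[OF e(1) that(1)] that(2) e by (simp add: V.q_cp_assoc[symmetric] V.qbilin)
      hence "V.indep b c d" using 3 that o V.E_orth E by (simp add: V.indep_def)
      thus ?thesis using munit_hom_mult_indep[OF h] V.E_aniso that n by blast
    qed (use munit_hom_mult_left[OF h o(1) n(1)] munit_hom_mult_right[OF h o(1) n(2)] in auto)
  qed
  have "?P = iso_part ?P" using iso_part_isotypic[OF hom_mult_isotypic[OF h o(1) n(2)]] by simp
  also have "\<dots> = (\<Sum>d\<in>E. if d = e then scl (1 / q d d) (munit ?P d d) else 0)"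
    unfolding iso_part_expand[of ?P] by (rule sum.cong) (auto simp: z)
  also have "\<dots> = scl (1 / q e e) (munit ?P e e)" using V.finite_E e by simp
  also have "\<dots> = pair_prod \<phi> \<psi> b c (b \<otimes> c)"
    unfolding pair_prod_def e using r by (simp add: munit_lin V.qbilin)
  finally show ?thesis .
qed

text \<open>For an independent triple \<open>b\<close>, \<open>b'\<close>, \<open>c\<close>, \<open>hom_mult_defect\<close> with \<open>a = b \<otimes> b'\<close> compares the two
  homomorphisms at \<open>b \<otimes> c\<close>, since \<open>b \<otimes> a\<close> is a multiple of \<open>b'\<close>.\<close>

lemma pair_prod_const:
  assumes h: "hom \<phi>" "hom \<psi>" and E: "b \<in> E" "c \<in> E" "b \<noteq> c" "b' \<in> E" "c' \<in> E" "b' \<noteq> c'"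
  shows "pair_prod \<phi> \<psi> b c = pair_prod \<phi> \<psi> b' c'"
proof (rule V.E_pairs_const[OF _ _ E])
  fix b c
  have "c \<otimes> b = - (b \<otimes> c)" by (rule V.cp_swap)
  thus "pair_prod \<phi> \<psi> b c = pair_prod \<phi> \<psi> c b"
    by (simp add: pair_prod_def fun_eq_iff hom_mult_swap[OF h, of c b] munit_lin V.qbilin)
next
  fix b b' c assume E: "b \<in> E" "b' \<in> E" "c \<in> E" and i: "V.indep b b' c"
  note D = V.indepD[OF i]
  note n = E[THEN V.E_aniso]
  define a where "a = b \<otimes> b'"
  let ?f = "pair_prod \<phi> \<psi> b c" and ?f' = "pair_prod \<phi> \<psi> b' c"
  note F = homD[OF hom_pair_prod]
  note H = homD[OF h(1)] homD[OF h(2)]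
  have na: "q a a \<noteq> 0" using D(1) n four_nz by (simp add: a_def V.q_cp_cp)
  have o: "q b a = 0" "q c a = 0"
    using D(12) V.q_sym[of b a] by (simp_all add: a_def V.q_cp_left)
  have ba: "b \<otimes> a = - ((4 * q b b) \<odot> b')" using D(2) by (simp add: a_def V.cp_cp_left)
  have z: "q (b \<otimes> c) a = 0"
    using V.q_cp_cp[of c b b'] D V.cp_swap[of c b] V.cp_swap[of b' b] by (simp add: a_def V.qbilin)
  hence "V.indep b c a" using D(3) o by (simp add: V.indep_def V.q_cp_assoc)
  note sw = V.indepD(14)[OF this]
  have "b \<noteq> c" "b' \<noteq> c" using D(3,5) n by auto
  hence P: "\<phi> b \<cdot> \<psi> c = ?f (b \<otimes> c)" "\<phi> b' \<cdot> \<psi> c = ?f' (b' \<otimes> c)" using pair_prod[OF h] E by blast+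
  have "\<phi> (b \<otimes> a) \<cdot> \<psi> c = ?f' ((b \<otimes> a) \<otimes> c)" by (simp add: ba H F mult_bilin P V.bilin)
  hence "(?f ((b \<otimes> c) \<otimes> a) - ?f' ((b \<otimes> c) \<otimes> a)) \<star> a = 0"
    using hom_mult_defect[OF h o] unfolding P sw by (simp add: F)
  hence "scl (4 * q a a) (?f (b \<otimes> c)) = scl (4 * q a a) (?f' (b \<otimes> c))"
    using z by (simp add: act_bilin F V.cp_cp del: scale_cancel_left)
  hence "?f (b \<otimes> c) = ?f' (b \<otimes> c)" using na four_nz by simp
  moreover have "q (b \<otimes> c) (b \<otimes> c) \<noteq> 0" using D(3) n four_nz by (simp add: V.q_cp_cp)
  ultimately show "?f = ?f'" using hom_eq[OF hom_pair_prod hom_pair_prod] by blast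
qed

definition hom_prod :: "('v \<Rightarrow> 'm) \<Rightarrow> ('v \<Rightarrow> 'm) \<Rightarrow> 'v \<Rightarrow> 'm" where
  "hom_prod \<phi> \<psi> = pair_prod \<phi> \<psi> V.e1 V.e2"

lemma hom_hom_prod: "hom (hom_prod \<phi> \<psi>)" unfolding hom_prod_def by (rule hom_pair_prod)

lemma hom_mult:
  assumes h: "hom \<phi>" "hom \<psi>"
  shows "\<phi> b \<cdot> \<psi> c = hom_prod \<phi> \<psi> (b \<otimes> c)"
proof -
  note H = homD[OF h(1)] homD[OF h(2)] homD[OF hom_hom_prod]
  have E: "\<phi> b \<cdot> \<psi> c = hom_prod \<phi> \<psi> (b \<otimes> c)" if E: "b \<in> E" "c \<in> E" for b c
  proof (cases "b = c")
    case True
    have "\<phi> b \<cdot> \<psi> b + \<phi> b \<cdot> \<psi> b = 0" using hom_mult_swap[OF h, of b b] by (simp only: eq_neg_iff_add_eq_0)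
    hence "scl 2 (\<phi> b \<cdot> \<psi> b) = 0" using scale_left_distrib[of 1 1 "\<phi> b \<cdot> \<psi> b"] by simp
    thus ?thesis using True two_nz by (simp add: V.cp_self H)
  next
    case False
    thus ?thesis using pair_prod[OF h E False] pair_prod_const[OF h E False V.e12] by (simp add: hom_prod_def)
  qed
  show ?thesis
  proof (induction c rule: V.E_induct)
    case (3 c)
    note c = this
    show ?case by (induction b rule: V.E_induct) (use E c in \<open>simp_all add: H lin mult_bilin\<close>)
  qed (simp_all add: H lin mult_bilin)
qed

lemma e12_cp_aniso: "q (V.e1 \<otimes> V.e2) (V.e1 \<otimes> V.e2) \<noteq> 0"
  using V.e12 V.E_aniso[of V.e1] V.E_aniso[of V.e2] V.E_orth[of V.e1 V.e2] four_nz by (simp add: V.q_cp_cp)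

lemma hom_prod_comm:
  assumes h: "hom \<phi>" "hom \<psi>"
  shows "hom_prod \<psi> \<phi> = hom_prod \<phi> \<psi>"
proof
  fix v
  have "hom_prod \<phi> \<psi> (V.e1 \<otimes> V.e2) = hom_prod \<psi> \<phi> (V.e1 \<otimes> V.e2)"
    using hom_mult[OF h, of V.e1 V.e2] hom_mult[OF h(2,1), of V.e2 V.e1] mult_swap[of "\<phi> V.e1" "\<psi> V.e2"]
      V.cp_swap[of V.e2 V.e1] by (simp add: homD[OF hom_hom_prod])
  thus "hom_prod \<psi> \<phi> v = hom_prod \<phi> \<psi> v" using hom_eq[OF hom_hom_prod hom_hom_prod _ e12_cp_aniso] by metis
qed

text \<open>Sagle's identity for \<open>\<phi> b\<close>, \<open>\<theta> e\<close>, \<open>\<psi> c\<close>, \<open>\<iota> c\<close> with \<open>b\<close>, \<open>c\<close>, \<open>e\<close> independent reads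
  \<open>(\<phi>\<psi>)\<theta> = 2 (\<phi>\<theta>)\<psi> - (\<theta>\<psi>)\<phi>\<close>. Exchanging \<open>\<psi>\<close> and \<open>\<theta>\<close> and eliminating gives
  \<open>3 (\<phi>\<psi>)\<theta> = 3 (\<theta>\<psi>)\<phi>\<close>, which by commutativity is associativity.\<close>

lemma hom_prod_assoc:
  assumes h: "hom \<phi>" "hom \<psi>" "hom \<theta>"
  shows "hom_prod (hom_prod \<phi> \<psi>) \<theta> = hom_prod \<phi> (hom_prod \<psi> \<theta>)"
proof
  fix v
  let ?S = "\<lambda>\<phi> \<psi> \<theta>. hom_prod (hom_prod \<phi> \<psi>) \<theta>"
  obtain e where e: "e \<in> E" "V.indep V.e1 V.e2 e" using V.E_indep[OF V.e12] by blast
  define b c where "b = V.e1" and "c = V.e2"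
  have i: "V.indep b c e" using e by (simp add: b_def c_def)
  note D = V.indepD[OF i]
  note D' = V.indepD[OF V.indep_swap[OF i]]
  have n: "q b b \<noteq> 0" "q c c \<noteq> 0" "q e e \<noteq> 0" using V.e12 e V.E_aniso by (simp_all add: b_def c_def)
  have z: "q (b \<otimes> e) (b \<otimes> e) \<noteq> 0" using D n four_nz V.q_cp_cp[of b e b] by simp
  have vec: "((b \<otimes> e) \<otimes> c) \<otimes> c = - ((4 * q c c) \<odot> (b \<otimes> e))" "((b \<otimes> c) \<otimes> e) \<otimes> c = (4 * q c c) \<odot> (b \<otimes> e)"
    "((e \<otimes> c) \<otimes> c) \<otimes> b = (4 * q c c) \<odot> (b \<otimes> e)" "(b \<otimes> c) \<otimes> (e \<otimes> c) = - ((4 * q c c) \<odot> (b \<otimes> e))"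
  proof -
    show 1: "((b \<otimes> e) \<otimes> c) \<otimes> c = - ((4 * q c c) \<odot> (b \<otimes> e))" using D'(8) by (simp add: V.cp_cp)
    show 2: "((b \<otimes> c) \<otimes> e) \<otimes> c = (4 * q c c) \<odot> (b \<otimes> e)" using 1 D'(14) by (simp add: V.bilin)
    show "((e \<otimes> c) \<otimes> c) \<otimes> b = (4 * q c c) \<odot> (b \<otimes> e)" using D V.cp_swap[of e b] by (simp add: V.cp_cp V.bilin)
    have "(e \<otimes> c) \<otimes> (b \<otimes> c) = - ((e \<otimes> (b \<otimes> c)) \<otimes> c)"
      using V.cp_cp_lin[of e c "b \<otimes> c"] D V.q_sym[of c "b \<otimes> c"] V.q_cp[of b c] by (simp add: eq_neg_iff_add_eq_0)
    also have "e \<otimes> (b \<otimes> c) = - ((b \<otimes> c) \<otimes> e)" by (rule V.cp_swap)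
    finally have "(e \<otimes> c) \<otimes> (b \<otimes> c) = (4 * q c c) \<odot> (b \<otimes> e)" using 2 by (simp add: V.bilin)
    thus "(b \<otimes> c) \<otimes> (e \<otimes> c) = - ((4 * q c c) \<odot> (b \<otimes> e))" using V.cp_swap[of "b \<otimes> c" "e \<otimes> c"] by simp
  qed
  note F = homD[OF hom_hom_prod]
  have rel: "?S \<phi> \<psi> \<theta> v = scl 2 (?S \<phi> \<theta> \<psi> v) - ?S \<theta> \<psi> \<phi> v"
    if h: "hom \<phi>" "hom \<psi>" "hom \<theta>" for \<phi> \<psi> \<theta> v
  proof -
    have C: "\<phi> x \<cdot> \<psi> y = hom_prod \<phi> \<psi> (x \<otimes> y)" "\<phi> x \<cdot> \<theta> y = hom_prod \<phi> \<theta> (x \<otimes> y)" "\<theta> x \<cdot> \<psi> y = hom_prod \<theta> \<psi> (x \<otimes> y)"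
      "hom_prod \<phi> \<psi> x \<cdot> \<theta> y = ?S \<phi> \<psi> \<theta> (x \<otimes> y)" "hom_prod \<phi> \<theta> x \<cdot> \<psi> y = ?S \<phi> \<theta> \<psi> (x \<otimes> y)" "hom_prod \<theta> \<psi> x \<cdot> \<phi> y = ?S \<theta> \<psi> \<phi> (x \<otimes> y)" for x y
      using hom_mult h hom_hom_prod by blast+
    have A: "\<eta> x \<cdot> \<iota> y = \<eta> (x \<otimes> y)" if "hom \<eta>" for \<eta> x y using homD(3)[OF that] by (simp add: act_def)
    have A': "\<iota> c \<cdot> \<phi> b = - \<phi> (b \<otimes> c)" "\<psi> c \<cdot> \<iota> c = 0"
      using act_left_hom[OF h(1)] A[OF h(2), of c c] by (simp_all add: V.cp_self homD(6)[OF h(2)])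
    have "?S \<phi> \<psi> \<theta> ((b \<otimes> c) \<otimes> (e \<otimes> c)) =
      ?S \<phi> \<theta> \<psi> (((b \<otimes> e) \<otimes> c) \<otimes> c) + ?S \<theta> \<psi> \<phi> (((e \<otimes> c) \<otimes> c) \<otimes> b) - ?S \<phi> \<theta> \<psi> (((b \<otimes> c) \<otimes> e) \<otimes> c)"
      using sagle[OF two_nz, of "\<phi> b" "\<psi> c" "\<theta> e" "\<iota> c"]
      by (simp add: A' C A[OF h(3)] A[OF hom_hom_prod] mult_bilin)
    note main = this[unfolded vec F]
    have "scl (- 4 * q c c) (?S \<phi> \<psi> \<theta> (b \<otimes> e)) = scl (- 4 * q c c) (scl 2 (?S \<phi> \<theta> \<psi> (b \<otimes> e)) - ?S \<theta> \<psi> \<phi> (b \<otimes> e))"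
      (is "?l = ?r")
    proof (rule eq_by_functionals)
      fix g assume "functional g"
      note g = functionalD[OF this]
      show "g ?l = g ?r" using arg_cong[OF main, of g] unfolding g by algebra
    qed
    hence eq: "?S \<phi> \<psi> \<theta> (b \<otimes> e) = scl 2 (?S \<phi> \<theta> \<psi> (b \<otimes> e)) + scl (- 1) (?S \<theta> \<psi> \<phi> (b \<otimes> e))"
      using n four_nz by simp
    have "hom (\<lambda>v. scl 2 (?S \<phi> \<theta> \<psi> v) + scl (- 1) (?S \<theta> \<psi> \<phi> v))"
      by (intro hom_add hom_scale hom_hom_prod)
    from hom_eq[OF hom_hom_prod this eq z, of v] show ?thesis by simp
  qed
  have "scl 3 (?S \<phi> \<psi> \<theta> v) = scl 3 (?S \<theta> \<psi> \<phi> v)" (is "?l = ?r")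
  proof (rule eq_by_functionals)
    fix g assume "functional g"
    note g = functionalD[OF this]
    show "g ?l = g ?r"
      using arg_cong[OF rel[OF h, of v], of g] arg_cong[OF rel[OF h(1,3,2), of v], of g]
      unfolding hom_prod_comm[OF h(3,2)] g by algebra
  qed
  hence "?S \<phi> \<psi> \<theta> v = ?S \<theta> \<psi> \<phi> v" using three_nz by simp
  also have "\<dots> = hom_prod \<phi> (hom_prod \<psi> \<theta>) v"
    by (simp only: hom_prod_comm[OF h(2,3)] hom_prod_comm[OF h(1) hom_hom_prod[of \<psi> \<theta>]])
  finally show "?S \<phi> \<psi> \<theta> v = hom_prod \<phi> (hom_prod \<psi> \<theta>) v" .
qed

end

section \<open>Quotients as images\<close>

lemma alg_on_simps:
  "carrier (alg_on s m S) = S" "add (alg_on s m S) = (+)" "zero (alg_on s m S) = 0"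
  "smul (alg_on s m S) = s" "mul (alg_on s m S) = m"
  by (simp_all add: alg_on_def)

lemma direct_sum_simps:
  "carrier (direct_sum X Y) = carrier X \<times> carrier Y"
  "add (direct_sum X Y) (x, y) (x', y') = (add X x x', add Y y y')"
  "smul (direct_sum X Y) c (x, y) = (smul X c x, smul Y c y)"
  "mul (direct_sum X Y) (x, y) (x', y') = (mul X x x', mul Y y y')"
  by (simp_all add: direct_sum_def)

lemma mem_coset: "(y::'a::ab_group_add) \<in> x +o K \<longleftrightarrow> y - x \<in> K"
  unfolding elt_set_plus_def by (auto intro: bexI[of _ "y - x"])

text \<open>Cosets of the kernel \<open>K\<close> of a homomorphism \<open>F\<close> on \<open>S\<close> are its fibres, and the operations on
  cosets are those of the image of \<open>F\<close>. Both the tensor product and the two exceptional algebras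
  are treated in this way.\<close>

locale quotient_by_kernel = vector_space sc
  for sc :: "'f::field \<Rightarrow> 'a::ab_group_add \<Rightarrow> 'a" +
  fixes mu :: "'a \<Rightarrow> 'a \<Rightarrow> 'a" and S K :: "'a set"
    and F :: "'a \<Rightarrow> 'b::ab_group_add" and sc' :: "'f \<Rightarrow> 'b \<Rightarrow> 'b" and mu' :: "'b \<Rightarrow> 'b \<Rightarrow> 'b"
  assumes sub: "subspace S"
    and KS: "K \<subseteq> S"
    and F_add: "\<lbrakk>p \<in> S; r \<in> S\<rbrakk> \<Longrightarrow> F (p + r) = F p + F r"
    and F_scale: "p \<in> S \<Longrightarrow> F (sc c p) = sc' c (F p)"
    and mu_S: "\<lbrakk>p \<in> S; r \<in> S\<rbrakk> \<Longrightarrow> mu p r \<in> S"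
    and F_mu: "\<lbrakk>p \<in> S; r \<in> S\<rbrakk> \<Longrightarrow> F (mu p r) = mu' (F p) (F r)"
    and K_iff: "p \<in> S \<Longrightarrow> p \<in> K \<longleftrightarrow> F p = 0"
begin

definition fib :: "'b \<Rightarrow> 'a set" where "fib w = {p \<in> S. F p = w}"

abbreviation "Q \<equiv> quotient_alg sc mu S K"

lemma F_diff: "\<lbrakk>p \<in> S; r \<in> S\<rbrakk> \<Longrightarrow> F (p - r) = F p - F r"
  using F_add[of "p - r" r] subspace_diff[OF sub] by (simp add: algebra_simps)

lemma coset_fib:
  assumes "p \<in> S"
  shows "p +o K = fib (F p)"
proof
  show "p +o K \<subseteq> fib (F p)"
  proof
    fix y assume "y \<in> p +o K"
    hence k: "y - p \<in> K" by (simp add: mem_coset)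
    hence "y - p \<in> S" "F (y - p) = 0" using KS K_iff by auto
    moreover from this have "y \<in> S" using subspace_add[OF sub, of "y - p" p] assms by simp
    ultimately show "y \<in> fib (F p)" using F_diff assms by (simp add: fib_def)
  qed
  show "fib (F p) \<subseteq> p +o K"
    using assms F_diff K_iff subspace_diff[OF sub] by (auto simp: fib_def mem_coset)
qed

lemma carrier_Q: "carrier Q = fib ` F ` S"
  by (auto simp: quotient_alg_def coset_fib image_iff)

lemma fib_inj: "inj_on fib (F ` S)"
  by (auto simp: inj_on_def fib_def)

lemma fib_bij: "bij_betw fib (F ` S) (carrier Q)"
  unfolding carrier_Q bij_betw_def using fib_inj by blast

lemma fib_ops:
  assumes "v \<in> F ` S" "w \<in> F ` S"
  shows "add Q (fib v) (fib w) = fib (v + w)" "smul Q c (fib v) = fib (sc' c v)"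
    "mul Q (fib v) (fib w) = fib (mu' v w)"
proof -
  have ne: "fib v \<noteq> {}" "fib w \<noteq> {}" using assms by (auto simp: fib_def)
  have "(\<Union>x\<in>fib v. \<Union>y\<in>fib w. (x + y) +o K) = (\<Union>x\<in>fib v. \<Union>y\<in>fib w. fib (v + w))"
    using subspace_add[OF sub] F_add by (intro SUP_cong refl) (auto simp: fib_def[of v] fib_def[of w] coset_fib)
  thus "add Q (fib v) (fib w) = fib (v + w)" using ne by (simp add: quotient_alg_def)
  have "(\<Union>x\<in>fib v. sc c x +o K) = (\<Union>x\<in>fib v. fib (sc' c v))"
    using subspace_scale[OF sub] F_scale by (intro SUP_cong refl) (auto simp: fib_def[of v] coset_fib)
  thus "smul Q c (fib v) = fib (sc' c v)" using ne by (simp add: quotient_alg_def)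
  have "(\<Union>x\<in>fib v. \<Union>y\<in>fib w. mu x y +o K) = (\<Union>x\<in>fib v. \<Union>y\<in>fib w. fib (mu' v w))"
    using mu_S F_mu by (intro SUP_cong refl) (auto simp: fib_def[of v] fib_def[of w] coset_fib)
  thus "mul Q (fib v) (fib w) = fib (mu' v w)" using ne by (simp add: quotient_alg_def)
qed

end

context malcev_over_cross
begin

section \<open>The coordinate algebra and the tensor product\<close>

text \<open>The only homomorphism that can take the value \<open>a\<close> at \<open>e1\<close>; it does so for \<open>a\<close> in \<open>coords\<close>.\<close>

definition hom_of :: "'m \<Rightarrow> 'v \<Rightarrow> 'm" where
  "hom_of a v = scl (1 / q V.e1 V.e1) (munit a V.e1 v)"

definition coords :: "'m set" where "coords = {a. hom_of a V.e1 = a}"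

definition coord_mult :: "'m \<Rightarrow> 'm \<Rightarrow> 'm" where "coord_mult a b = hom_prod (hom_of a) (hom_of b) V.e1"

definition coord_alg :: "('f, 'm) alg" where "coord_alg = alg_on scl coord_mult coords"

lemma hom_hom_of: "hom (hom_of a)"
  unfolding hom_of_def by (rule hom_scale[OF hom_munit])

lemma e1_aniso: "q V.e1 V.e1 \<noteq> 0" using V.e12 V.E_aniso by blast

lemma hom_of_eval: "hom \<phi> \<Longrightarrow> hom_of (\<phi> V.e1) = \<phi>"
  using e1_aniso by (simp add: hom_of_def munit_of_hom fun_eq_iff)

lemma hom_in_coords: "hom \<phi> \<Longrightarrow> \<phi> V.e1 \<in> coords" by (simp add: coords_def hom_of_eval)

lemma coordsD: "a \<in> coords \<Longrightarrow> hom_of a V.e1 = a" by (simp add: coords_def)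

lemma hom_of_lin: "hom_of (a + b) v = hom_of a v + hom_of b v" "hom_of (scl c a) v = scl c (hom_of a v)" "hom_of 0 v = 0"
  "hom_of (a - b) v = hom_of a v - hom_of b v"
  by (simp_all add: hom_of_def munit_lin algebra_simps)

lemma coords_closed: "0 \<in> coords" "\<lbrakk>a \<in> coords; b \<in> coords\<rbrakk> \<Longrightarrow> a + b \<in> coords" "a \<in> coords \<Longrightarrow> scl c a \<in> coords" "a \<in> coords \<Longrightarrow> - a \<in> coords"
  using hom_of_lin(2)[of "-1" a] by (simp_all add: coords_def hom_of_lin)

lemma hom_prod_lin_right:
  "hom_prod \<phi> (\<lambda>v. \<psi> v + \<psi>' v) v = hom_prod \<phi> \<psi> v + hom_prod \<phi> \<psi>' v"
  "hom_prod \<phi> (\<lambda>v. scl c (\<psi> v)) v = scl c (hom_prod \<phi> \<psi> v)"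
  by (simp_all add: hom_prod_def pair_prod_def mult_bilin munit_lin algebra_simps)

lemma hom_of_coord_mult: "hom_of (coord_mult a b) = hom_prod (hom_of a) (hom_of b)"
  unfolding coord_mult_def by (rule hom_of_eval[OF hom_hom_prod])

lemma coord_mult_in_coords: "coord_mult a b \<in> coords" unfolding coord_mult_def by (rule hom_in_coords[OF hom_hom_prod])

lemma comm_assoc_coord_alg: "comm_assoc_algebra coord_alg"
proof
  fix a b c assume A: "a \<in> carrier coord_alg" "b \<in> carrier coord_alg"
  show "mul coord_alg a b = mul coord_alg b a"
    by (simp add: coord_alg_def alg_on_def coord_mult_def hom_prod_comm[OF hom_hom_of hom_hom_of, of b a])
  show "mul coord_alg (mul coord_alg a b) c = mul coord_alg a (mul coord_alg b c)"
    unfolding coord_alg_def alg_on_def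
    by (simp add: coord_mult_def[of "coord_mult a b"] coord_mult_def[of a "coord_mult b c"] hom_of_coord_mult hom_prod_assoc[OF hom_hom_of hom_hom_of hom_hom_of])
  have f: "hom_of (b + c) = (\<lambda>v. hom_of b v + hom_of c v)" "hom_of (scl k b) = (\<lambda>v. scl k (hom_of b v))" for b c k
    by (simp_all add: fun_eq_iff hom_of_lin)
  show "mul coord_alg a (add coord_alg b c) = add coord_alg (mul coord_alg a b) (mul coord_alg a c)"
    by (simp add: coord_alg_def alg_on_def coord_mult_def f hom_prod_lin_right)
  show "mul coord_alg a (smul coord_alg k b) = smul coord_alg k (mul coord_alg a b)" for k
    by (simp add: coord_alg_def alg_on_def coord_mult_def f hom_prod_lin_right)
qed (auto simp: coord_alg_def alg_on_def coords_closed coord_mult_in_coords algebra_simps intro: bexI[of _ "- _"])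

abbreviation "B_alg \<equiv> alg_on scl (\<cdot>) (range \<iota>)"

definition tensor_gens :: "('m \<times> 'm \<Rightarrow>\<^sub>0 'f) set" where
  "tensor_gens = {p. Poly_Mapping.keys p \<subseteq> range \<iota> \<times> coords}"

definition iota_inv :: "'m \<Rightarrow> 'v" where "iota_inv = inv \<iota>"

lemma iota_inv [simp]: "iota_inv (\<iota> v) = v" by (simp add: iota_inv_def iota_inj)

definition tensor_eval :: "('m \<times> 'm \<Rightarrow>\<^sub>0 'f) \<Rightarrow> 'm" where
  "tensor_eval p = (\<Sum>k\<in>Poly_Mapping.keys p. scl (Poly_Mapping.lookup p k) (hom_of (snd k) (iota_inv (fst k))))"

lemma tensor_eval_superset:
  assumes "finite D" "Poly_Mapping.keys p \<subseteq> D"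
  shows "tensor_eval p = (\<Sum>k\<in>D. scl (Poly_Mapping.lookup p k) (hom_of (snd k) (iota_inv (fst k))))"
  unfolding tensor_eval_def using assms by (intro sum.mono_neutral_left) (auto simp: in_keys_iff)

lemma tensor_eval_add: "tensor_eval (p + r) = tensor_eval p + tensor_eval r"
proof -
  let ?D = "Poly_Mapping.keys p \<union> Poly_Mapping.keys r"
  have D: "finite ?D" "Poly_Mapping.keys (p + r) \<subseteq> ?D" by (simp_all add: Poly_Mapping.keys_add)
  show ?thesis
    using tensor_eval_superset[OF D] tensor_eval_superset[OF D(1), of p] tensor_eval_superset[OF D(1), of r]
    by (simp add: lookup_add scale_left_distrib sum.distrib)
qed

lemma tensor_eval_scale: "tensor_eval (free_scale c p) = scl c (tensor_eval p)"
proof -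
  have "Poly_Mapping.keys (free_scale c p) \<subseteq> Poly_Mapping.keys p" by (auto simp: in_keys_iff lookup_free_scale)
  thus ?thesis using tensor_eval_superset[of "Poly_Mapping.keys p" "free_scale c p"]
    by (simp add: tensor_eval_def lookup_free_scale scale_sum_right)
qed

lemma tensor_eval_diff: "tensor_eval (p - r) = tensor_eval p - tensor_eval r" using tensor_eval_add[of "p - r" r] by (simp add: algebra_simps)
lemma tensor_eval_zero [simp]: "tensor_eval 0 = 0" by (simp add: tensor_eval_def)

lemma tensor_eval_sum: "tensor_eval (\<Sum>i\<in>I. h i) = (\<Sum>i\<in>I. tensor_eval (h i))"
  by (induction I rule: infinite_finite_induct) (simp_all add: tensor_eval_add)

lemma tensor_eval_pure [simp]: "tensor_eval (pure_tensor x a) = hom_of a (iota_inv x)" by (simp add: tensor_eval_def)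

interpretation fs: vector_space "free_scale :: 'f \<Rightarrow> ('m \<times> 'm \<Rightarrow>\<^sub>0 'f) \<Rightarrow> _" by (rule vector_space_free_scale)

abbreviation "tensor_rels \<equiv> tensor_relations B_alg coord_alg"
abbreviation "rel_span \<equiv> fs.span tensor_rels"

lemma tensor_gens_subspace: "fs.subspace tensor_gens"
proof (rule fs.subspaceI)
  fix p r :: "'m \<times> 'm \<Rightarrow>\<^sub>0 'f" and c
  assume p: "p \<in> tensor_gens"
  show "free_scale c p \<in> tensor_gens" using p by (auto simp: tensor_gens_def in_keys_iff lookup_free_scale)
  assume r: "r \<in> tensor_gens"
  show "p + r \<in> tensor_gens" using p r Poly_Mapping.keys_add[of p r] by (auto simp: tensor_gens_def)
qed (simp add: tensor_gens_def)

lemma pure_in_tensor_gens: "\<lbrakk>x \<in> range \<iota>; a \<in> coords\<rbrakk> \<Longrightarrow> pure_tensor x a \<in> tensor_gens" by (auto simp: tensor_gens_def)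

lemma tensor_rels_eq: "tensor_rels =
     {pure_tensor (x + y) a - pure_tensor x a - pure_tensor y a | x y a.
        x \<in> range \<iota> \<and> y \<in> range \<iota> \<and> a \<in> coords} \<union>
     {pure_tensor x (a + b) - pure_tensor x a - pure_tensor x b | x a b.
        x \<in> range \<iota> \<and> a \<in> coords \<and> b \<in> coords} \<union>
     {pure_tensor (scl c x) a - free_scale c (pure_tensor x a) | c x a.
        x \<in> range \<iota> \<and> a \<in> coords} \<union>
     {pure_tensor x (scl c a) - free_scale c (pure_tensor x a) | c x a.
        x \<in> range \<iota> \<and> a \<in> coords}"
  by (simp add: tensor_relations_def coord_alg_def alg_on_def)

lemma iota_range: "\<lbrakk>x \<in> range \<iota>; y \<in> range \<iota>\<rbrakk> \<Longrightarrow> x + y \<in> range \<iota>" "x \<in> range \<iota> \<Longrightarrow> scl c x \<in> range \<iota>"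
  by (auto simp flip: iota_add iota_scale)

lemma iota_inv_lin: "\<lbrakk>x \<in> range \<iota>; y \<in> range \<iota>\<rbrakk> \<Longrightarrow> iota_inv (x + y) = iota_inv x + iota_inv y" "x \<in> range \<iota> \<Longrightarrow> iota_inv (scl c x) = c \<odot> iota_inv x"
  by (auto simp flip: iota_add iota_scale)

lemma tensor_rels_in_gens: "tensor_rels \<subseteq> tensor_gens"
  unfolding tensor_rels_eq
  by (auto intro!: fs.subspace_diff[OF tensor_gens_subspace] fs.subspace_scale[OF tensor_gens_subspace] pure_in_tensor_gens iota_range coords_closed)

lemma tensor_eval_rels: "r \<in> tensor_rels \<Longrightarrow> tensor_eval r = 0"
  unfolding tensor_rels_eq by (auto simp: tensor_eval_diff tensor_eval_scale hom_of_lin homD(1,2)[OF hom_hom_of] iota_inv_lin)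

lemma rel_span_sub: "rel_span \<subseteq> tensor_gens" by (rule fs.span_minimal[OF tensor_rels_in_gens tensor_gens_subspace])

lemma tensor_eval_rel_span: "r \<in> rel_span \<Longrightarrow> tensor_eval r = 0"
  by (induction rule: fs.span_induct_alt) (simp_all add: tensor_eval_add tensor_eval_scale tensor_eval_rels)

definition basis_tensor :: "('v \<Rightarrow> 'm) \<Rightarrow> ('m \<times> 'm \<Rightarrow>\<^sub>0 'f)" where
  "basis_tensor c = (\<Sum>e\<in>E. pure_tensor (\<iota> e) (c e))"

text \<open>Being congruent, modulo the bilinearity relations, to a combination of pure tensors with the
  basis vectors on the left; the evaluation map detects when such a combination vanishes.\<close>

definition reducible :: "('m \<times> 'm \<Rightarrow>\<^sub>0 'f) \<Rightarrow> bool" where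
  "reducible p \<longleftrightarrow> (\<exists>c. (\<forall>e\<in>E. c e \<in> coords) \<and> p - basis_tensor c \<in> rel_span)"

lemma tensor_rels_intros:
  "\<lbrakk>x \<in> range \<iota>; y \<in> range \<iota>; a \<in> coords\<rbrakk> \<Longrightarrow> pure_tensor (x + y) a - pure_tensor x a - pure_tensor y a \<in> rel_span"
  "\<lbrakk>x \<in> range \<iota>; a \<in> coords; b \<in> coords\<rbrakk> \<Longrightarrow> pure_tensor x (a + b) - pure_tensor x a - pure_tensor x b \<in> rel_span"
  "\<lbrakk>x \<in> range \<iota>; a \<in> coords\<rbrakk> \<Longrightarrow> pure_tensor (scl c x) a - free_scale c (pure_tensor x a) \<in> rel_span"
  "\<lbrakk>x \<in> range \<iota>; a \<in> coords\<rbrakk> \<Longrightarrow> pure_tensor x (scl c a) - free_scale c (pure_tensor x a) \<in> rel_span"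
  unfolding tensor_rels_eq by (rule fs.span_base, blast)+

lemma pure_zero_rel_span: "x \<in> range \<iota> \<Longrightarrow> pure_tensor x 0 \<in> rel_span"
  using tensor_rels_intros(4)[of x 0 0] coords_closed(1) by simp

lemma reducible_add:
  assumes "reducible p" "reducible r"
  shows "reducible (p + r)"
proof -
  obtain c d where c: "\<forall>e\<in>E. c e \<in> coords" "p - basis_tensor c \<in> rel_span" and d: "\<forall>e\<in>E. d e \<in> coords" "r - basis_tensor d \<in> rel_span"
    using assms by (auto simp: reducible_def)
  let ?cd = "\<lambda>e. c e + d e"
  have "basis_tensor ?cd - basis_tensor c - basis_tensor d = (\<Sum>e\<in>E. pure_tensor (\<iota> e) (c e + d e) - pure_tensor (\<iota> e) (c e) - pure_tensor (\<iota> e) (d e))"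
    by (simp add: basis_tensor_def sum_subtractf)
  also have "\<dots> \<in> rel_span" using c d by (intro fs.span_sum tensor_rels_intros) auto
  finally have "(p - basis_tensor c) + (r - basis_tensor d) - (basis_tensor ?cd - basis_tensor c - basis_tensor d) \<in> rel_span"
    by (rule fs.span_diff[OF fs.span_add[OF c(2) d(2)]])
  hence "p + r - basis_tensor ?cd \<in> rel_span" by (simp add: algebra_simps)
  thus ?thesis using c d coords_closed unfolding reducible_def by (intro exI[of _ ?cd]) auto
qed

lemma reducible_scale:
  assumes "reducible p"
  shows "reducible (free_scale k p)"
proof -
  obtain c where c: "\<forall>e\<in>E. c e \<in> coords" "p - basis_tensor c \<in> rel_span" using assms by (auto simp: reducible_def)
  let ?c = "\<lambda>e. scl k (c e)"
  have "basis_tensor ?c - free_scale k (basis_tensor c) = (\<Sum>e\<in>E. pure_tensor (\<iota> e) (scl k (c e)) - free_scale k (pure_tensor (\<iota> e) (c e)))"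
    by (simp add: basis_tensor_def sum_subtractf fs.scale_sum_right)
  also have "\<dots> \<in> rel_span" using c by (intro fs.span_sum tensor_rels_intros) auto
  finally have "free_scale k (p - basis_tensor c) - (basis_tensor ?c - free_scale k (basis_tensor c)) \<in> rel_span"
    by (rule fs.span_diff[OF fs.span_scale[OF c(2)]])
  hence "free_scale k p - basis_tensor ?c \<in> rel_span" by (simp add: algebra_simps)
  thus ?thesis using c coords_closed unfolding reducible_def by (intro exI[of _ ?c]) auto
qed

lemma reducible_cong:
  assumes "reducible r" "p - r \<in> rel_span"
  shows "reducible p"
proof -
  obtain c where c: "\<forall>e\<in>E. c e \<in> coords" "r - basis_tensor c \<in> rel_span" using assms by (auto simp: reducible_def)
  have "(r - basis_tensor c) + (p - r) \<in> rel_span" using c assms by (intro fs.span_add)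
  thus ?thesis using c unfolding reducible_def by (intro exI[of _ c]) simp
qed

lemma reducible_pure:
  assumes a: "a \<in> coords"
  shows "reducible (pure_tensor (\<iota> v) a)"
proof (induction v rule: V.E_induct)
  case (1 v w)
  have "pure_tensor (\<iota> (v + w)) a - (pure_tensor (\<iota> v) a + pure_tensor (\<iota> w) a) \<in> rel_span"
    using tensor_rels_intros(1)[of "\<iota> v" "\<iota> w" a] a by (simp add: iota_add algebra_simps)
  thus ?case by (rule reducible_cong[OF reducible_add[OF 1]])
next
  case (2 c v)
  show ?case unfolding iota_scale by (rule reducible_cong[OF reducible_scale[OF 2] tensor_rels_intros(3)[OF _ a]]) simp
next
  case (3 e)
  let ?c = "\<lambda>e'. if e' = e then a else 0"
  have "basis_tensor ?c = pure_tensor (\<iota> e) a + (\<Sum>e'\<in>E - {e}. pure_tensor (\<iota> e') 0)"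
    unfolding basis_tensor_def using V.finite_E 3 by (simp add: sum.remove[of E e])
  hence "pure_tensor (\<iota> e) a - basis_tensor ?c = - (\<Sum>e'\<in>E - {e}. pure_tensor (\<iota> e') 0)" by simp
  also have "\<dots> \<in> rel_span" by (intro fs.span_neg fs.span_sum pure_zero_rel_span) simp
  finally show ?case using a coords_closed unfolding reducible_def by (intro exI[of _ ?c]) auto
qed

lemma tensor_gens_reducible:
  assumes "p \<in> tensor_gens"
  shows "reducible p"
proof -
  have 0: "reducible 0" using reducible_scale[OF reducible_pure[OF coords_closed(1), of 0], of 0] by simp
  have "reducible (\<Sum>k\<in>D. Poly_Mapping.single k (Poly_Mapping.lookup p k))"
    if "finite D" "D \<subseteq> Poly_Mapping.keys p" for D
    using that
  proof induction
    case (insert k D)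
    obtain v a where k: "k = (\<iota> v, a)" "a \<in> coords" using insert assms by (auto simp: tensor_gens_def)
    have "Poly_Mapping.single k (Poly_Mapping.lookup p k) = free_scale (Poly_Mapping.lookup p k) (Poly_Mapping.single k 1)"
      by (rule poly_mapping_eqI) (simp add: lookup_free_scale lookup_single when_def)
    hence "reducible (Poly_Mapping.single k (Poly_Mapping.lookup p k))"
      using reducible_scale[OF reducible_pure[OF k(2)]] k by simp
    thus ?case using insert by (simp add: reducible_add)
  qed (simp add: 0)
  from this[OF finite_keys order_refl]
  have "reducible (\<Sum>k\<in>Poly_Mapping.keys p. Poly_Mapping.single k (Poly_Mapping.lookup p k))" .
  moreover have "(\<Sum>k\<in>Poly_Mapping.keys p. Poly_Mapping.single k (Poly_Mapping.lookup p k)) = p"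
    by (rule poly_mapping_eqI) (simp add: lookup_sum lookup_single when_def in_keys_iff)
  ultimately show ?thesis by simp
qed

lemma tensor_eval_basis_zero:
  assumes c: "\<forall>e\<in>E. c e \<in> coords" and z: "tensor_eval (basis_tensor c) = 0"
  shows "\<forall>e\<in>E. c e = 0"
proof
  fix e assume e: "e \<in> E"
  have sum: "munit (\<Sum>i\<in>I. h i) f b = (\<Sum>i\<in>I. munit (h i) f b)" for I :: "'v set" and h f b
    by (induction I rule: infinite_finite_induct) (simp_all add: munit_lin)
  have "0 = munit (\<Sum>d\<in>E. hom_of (c d) d) e V.e1" using z by (simp add: basis_tensor_def tensor_eval_sum)
  also have "\<dots> = (\<Sum>d\<in>E. if d = e then scl (q e e) (c e) else 0)"
    unfolding sum using c V.E_orth e by (intro sum.cong refl) (auto simp: munit_of_hom[OF hom_hom_of] coordsD)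
  also have "\<dots> = scl (q e e) (c e)" using e V.finite_E by simp
  finally show "c e = 0" using V.E_aniso[OF e] by simp
qed

text \<open>A tensor of evaluation zero is congruent to some \<open>basis_tensor c\<close> of evaluation zero, whose
  coordinates \<open>c e\<close> must vanish because matrix units separate them.\<close>

lemma rel_span_iff:
  assumes p: "p \<in> tensor_gens"
  shows "p \<in> rel_span \<longleftrightarrow> tensor_eval p = 0"
proof
  assume z: "tensor_eval p = 0"
  obtain c where c: "\<forall>e\<in>E. c e \<in> coords" "p - basis_tensor c \<in> rel_span" using tensor_gens_reducible[OF p] by (auto simp: reducible_def)
  have "tensor_eval (basis_tensor c) = 0" using tensor_eval_rel_span[OF c(2)] z by (simp add: tensor_eval_diff)
  with c(1) have "\<forall>e\<in>E. c e = 0" by (rule tensor_eval_basis_zero)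
  hence "basis_tensor c = (\<Sum>e\<in>E. pure_tensor (\<iota> e) 0)" unfolding basis_tensor_def by (intro sum.cong) auto
  also have "\<dots> \<in> rel_span" by (intro fs.span_sum pure_zero_rel_span) simp
  finally show "p \<in> rel_span" using fs.span_add[OF c(2), of "basis_tensor c"] by simp
qed (rule tensor_eval_rel_span)

lemma isotypic_mult:
  assumes "x \<in> isotypic" "y \<in> isotypic"
  shows "x \<cdot> y \<in> isotypic"
  using assms(1)
proof (induction rule: isotypic_induct)
  case (hom \<phi> v)
  show ?case using assms(2)
  proof (induction rule: isotypic_induct)
    case (hom \<psi> w)
    show ?case using hom_mult[OF \<open>hom \<phi>\<close> hom] isotypicI[OF hom_hom_prod] by simp
  qed (simp_all add: mult_bilin isotypic_closed)
qed (simp_all add: mult_bilin isotypic_closed)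

lemma tensor_eval_image: "tensor_eval ` tensor_gens = isotypic"
proof
  show "tensor_eval ` tensor_gens \<subseteq> isotypic"
  proof
    fix w assume "w \<in> tensor_eval ` tensor_gens"
    then obtain p where p: "p \<in> tensor_gens" "w = tensor_eval p" by blast
    have "(\<Sum>k\<in>D. scl (Poly_Mapping.lookup p k) (hom_of (snd k) (iota_inv (fst k)))) \<in> isotypic" if "finite D" for D
      using that by induction (simp_all add: isotypic_closed isotypicI[OF hom_hom_of])
    thus "w \<in> isotypic" using p by (simp add: tensor_eval_def)
  qed
  show "isotypic \<subseteq> tensor_eval ` tensor_gens"
  proof
    fix w assume "w \<in> isotypic"
    thus "w \<in> tensor_eval ` tensor_gens"
    proof (induction rule: isotypic_induct)
      case (hom \<phi> v)
      have "\<phi> v = tensor_eval (pure_tensor (\<iota> v) (\<phi> V.e1))" by (simp add: hom_of_eval[OF hom])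
      thus ?case using pure_in_tensor_gens hom_in_coords[OF hom] by blast
    next
      case (add x y)
      then obtain p r where "p \<in> tensor_gens" "r \<in> tensor_gens" "x = tensor_eval p" "y = tensor_eval r" by blast
      thus ?case using fs.subspace_add[OF tensor_gens_subspace, of p r] tensor_eval_add[of p r] by force
    next
      case (scale c x)
      then obtain p where "p \<in> tensor_gens" "x = tensor_eval p" by blast
      thus ?case using fs.subspace_scale[OF tensor_gens_subspace, of p c] tensor_eval_scale[of c p] by force
    qed
  qed
qed

lemma free_mult_eval:
  assumes p: "p \<in> tensor_gens" and r: "r \<in> tensor_gens"
  shows "free_mult B_alg coord_alg p r \<in> tensor_gens"
    "tensor_eval (free_mult B_alg coord_alg p r) = tensor_eval p \<cdot> tensor_eval r"
proof -
  have m: "mul B_alg x y = x \<cdot> y" "mul coord_alg a b = coord_mult a b" for x y a b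
    by (simp_all add: alg_on_def coord_alg_def)
  have fm: "free_mult B_alg coord_alg p r = (\<Sum>k\<in>Poly_Mapping.keys p. \<Sum>l\<in>Poly_Mapping.keys r.
      free_scale (Poly_Mapping.lookup p k * Poly_Mapping.lookup r l) (pure_tensor (fst k \<cdot> fst l) (coord_mult (snd k) (snd l))))"
    unfolding free_mult_def m by (simp add: case_prod_beta)
  have r1: "x \<cdot> y \<in> range \<iota>" "iota_inv (x \<cdot> y) = iota_inv x \<otimes> iota_inv y" if "x \<in> range \<iota>" "y \<in> range \<iota>" for x y
    using that by (auto simp flip: iota_cp)
  have k: "fst k \<in> range \<iota>" "snd k \<in> coords" if "k \<in> Poly_Mapping.keys p \<or> k \<in> Poly_Mapping.keys r" for k
    using that p r by (auto simp: tensor_gens_def)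
  show "free_mult B_alg coord_alg p r \<in> tensor_gens" unfolding fm
    by (intro fs.subspace_sum[OF tensor_gens_subspace] fs.subspace_scale[OF tensor_gens_subspace] pure_in_tensor_gens coord_mult_in_coords r1(1) k) auto
  have suml: "(\<Sum>i\<in>I. h i) \<cdot> y = (\<Sum>i\<in>I. h i \<cdot> y)" and sumr: "y \<cdot> (\<Sum>i\<in>I. h i) = (\<Sum>i\<in>I. y \<cdot> h i)"
    for I :: "('m \<times> 'm) set" and h y
    by (induction I rule: infinite_finite_induct, simp_all add: mult_bilin)
  show "tensor_eval (free_mult B_alg coord_alg p r) = tensor_eval p \<cdot> tensor_eval r"
    unfolding fm tensor_eval_sum tensor_eval_scale tensor_eval_pure tensor_eval_def[of p] tensor_eval_def[of r] suml unfolding sumr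
    by (intro sum.cong refl) (simp add: mult_bilin r1 k hom_mult[OF hom_hom_of hom_hom_of] hom_of_coord_mult)
qed

interpretation tq: quotient_by_kernel free_scale "free_mult B_alg coord_alg" tensor_gens rel_span tensor_eval scl "(\<cdot>)"
  by unfold_locales
    (simp_all add: tensor_gens_subspace rel_span_sub tensor_eval_add tensor_eval_scale free_mult_eval rel_span_iff)

lemma tensor_alg_eq: "tensor_alg B_alg coord_alg = quotient_alg free_scale (free_mult B_alg coord_alg) tensor_gens rel_span"
  by (simp add: tensor_alg_def tensor_gens_def alg_on_def coord_alg_def)

lemma ann_ideal: "alg_ideal scl (\<cdot>) ann"
proof -
  have "x \<cdot> y \<in> ann" if "x \<in> ann" for x y
  proof -
    have "x \<cdot> y = x \<cdot> iso_part y + x \<cdot> (y - iso_part y)" by (simp flip: mult_add_right)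
    thus ?thesis using ann_mult_isotypic[OF that iso_part_in_isotypic] ann_mult_ann[OF that diff_iso_part_ann] by simp
  qed
  moreover have "subspace ann" by (rule subspaceI) (simp_all add: ann_def act_bilin)
  ultimately show ?thesis using mult_swap subspace_neg unfolding alg_ideal_def by metis
qed

text \<open>The isomorphism splits \<open>x\<close> into \<open>iso_part x\<close>, viewed as a coset of tensors, and
  \<open>x - iso_part x\<close>. It is multiplicative since \<open>isotypic\<close> and \<open>ann\<close> annihilate each other.\<close>

lemma decomposition_iso: "alg_isomorphic (alg_on scl (\<cdot>) UNIV) (direct_sum (tensor_alg B_alg coord_alg) (alg_on scl (\<cdot>) ann))"
proof -
  define \<Phi> where "\<Phi> x = (tq.fib (iso_part x), x - iso_part x)" for x
  have c: "iso_part x \<in> tensor_eval ` tensor_gens" for x using iso_part_in_isotypic by (simp add: tensor_eval_image)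
  have cm: "iso_part (x \<cdot> y) = iso_part x \<cdot> iso_part y" "x \<cdot> y - iso_part x \<cdot> iso_part y = (x - iso_part x) \<cdot> (y - iso_part y)" for x y
  proof -
    let ?x = "x - iso_part x" and ?y = "y - iso_part y"
    have "?x \<cdot> iso_part y = 0" "iso_part x \<cdot> ?y = 0"
      using ann_mult_isotypic diff_iso_part_ann iso_part_in_isotypic mult_swap[of "iso_part x" ?y] by simp_all
    hence xy: "x \<cdot> y = iso_part x \<cdot> iso_part y + ?x \<cdot> ?y" by (simp add: mult_bilin)
    have "iso_part (iso_part x \<cdot> iso_part y) = iso_part x \<cdot> iso_part y" by (intro iso_part_isotypic isotypic_mult iso_part_in_isotypic)
    moreover have "iso_part (?x \<cdot> ?y) = 0" by (intro ann_zero ann_mult_ann diff_iso_part_ann)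
    ultimately show "iso_part (x \<cdot> y) = iso_part x \<cdot> iso_part y" by (simp add: xy iso_part_lin)
    show "x \<cdot> y - iso_part x \<cdot> iso_part y = ?x \<cdot> ?y" using xy by simp
  qed
  have "bij_betw \<Phi> UNIV (carrier tq.Q \<times> ann)"
  proof (rule bij_betw_imageI)
    show "inj \<Phi>"
    proof (rule injI)
      fix x y assume "\<Phi> x = \<Phi> y"
      hence "iso_part x = iso_part y" "x - iso_part x = y - iso_part y" using inj_onD[OF tq.fib_inj _ c c] by (auto simp: \<Phi>_def)
      thus "x = y" by simp
    qed
    show "range \<Phi> = carrier tq.Q \<times> ann"
    proof (intro equalityI subsetI)
      fix z assume "z \<in> range \<Phi>"
      thus "z \<in> carrier tq.Q \<times> ann" using c diff_iso_part_ann by (auto simp: \<Phi>_def tq.carrier_Q)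
    next
      fix z assume "z \<in> carrier tq.Q \<times> ann"
      then obtain m n where z: "z = (tq.fib m, n)" "m \<in> isotypic" "n \<in> ann" by (auto simp: tq.carrier_Q tensor_eval_image)
      hence "\<Phi> (m + n) = z" using iso_part_isotypic ann_zero(3) by (simp add: \<Phi>_def iso_part_lin)
      thus "z \<in> range \<Phi>" by blast
    qed
  qed
  thus ?thesis
    unfolding alg_isomorphic_def tensor_alg_eq
    by (intro exI[of _ \<Phi>]) (simp add: direct_sum_simps alg_on_simps \<Phi>_def tq.fib_ops[OF c c] iso_part_lin cm scale_right_diff_distrib)
qed

end

section \<open>The two exceptional algebras\<close>

type_synonym 'f v7 = "'f \<times> 'f \<times> 'f \<times> 'f \<times> 'f \<times> 'f \<times> 'f"

definition v7_scale :: "'f::field \<Rightarrow> 'f v7 \<Rightarrow> 'f v7" where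
  "v7_scale k = (\<lambda>(x1, x2, x3, y0, y1, y2, y3). (k * x1, k * x2, k * x3, k * y0, k * y1, k * y2, k * y3))"

text \<open>The commutator of imaginary octonions in the coordinates of \<open>(x1 i + x2 j + x3 k) + v (y0 + y1 i + y2 j + y3 k)\<close>,
  where \<open>v\<^sup>2 = g\<close>.\<close>

definition cross7 :: "'f::field \<Rightarrow> 'f v7 \<Rightarrow> 'f v7 \<Rightarrow> 'f v7" where
  "cross7 g = (\<lambda>(x1, x2, x3, y0, y1, y2, y3) (u1, u2, u3, w0, w1, w2, w3).
     (2 * (x2 * u3 - x3 * u2 + g * (y0 * w1 - y1 * w0 + y2 * w3 - y3 * w2)),
      2 * (x3 * u1 - x1 * u3 + g * (y0 * w2 - y2 * w0 + y3 * w1 - y1 * w3)),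
      2 * (x1 * u2 - x2 * u1 + g * (y0 * w3 - y3 * w0 + y1 * w2 - y2 * w1)),
      2 * (x1 * w1 + x2 * w2 + x3 * w3 - u1 * y1 - u2 * y2 - u3 * y3),
      2 * (u1 * y0 + u2 * y3 - u3 * y2 - x1 * w0 - x2 * w3 + x3 * w2),
      2 * (u2 * y0 + u3 * y1 - u1 * y3 - x2 * w0 - x3 * w1 + x1 * w3),
      2 * (u3 * y0 + u1 * y2 - u2 * y1 - x3 * w0 - x1 * w2 + x2 * w1)))"

definition form7 :: "'f::field \<Rightarrow> 'f v7 \<Rightarrow> 'f v7 \<Rightarrow> 'f" where
  "form7 g = (\<lambda>(x1, x2, x3, y0, y1, y2, y3) (u1, u2, u3, w0, w1, w2, w3).
     x1 * u1 + x2 * u2 + x3 * u3 - g * (y0 * w0 + y1 * w1 + y2 * w2 + y3 * w3))"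

definition basis7 :: "'f::field v7 set" where
  "basis7 = {(1, 0, 0, 0, 0, 0, 0), (0, 1, 0, 0, 0, 0, 0), (0, 0, 1, 0, 0, 0, 0), (0, 0, 0, 1, 0, 0, 0),
     (0, 0, 0, 0, 1, 0, 0), (0, 0, 0, 0, 0, 1, 0), (0, 0, 0, 0, 0, 0, 1)}"

lemmas v7_defs = v7_scale_def cross7_def form7_def zero_prod_def

lemma cross7_cross_product_space:
  assumes nz: "(2::'f::field) \<noteq> 0" "(3::'f) \<noteq> 0" "g \<noteq> 0"
  shows "cross_product_space v7_scale (cross7 g) (form7 g) (basis7 :: 'f v7 set)"
proof
  fix x y z v :: "'f v7" and c d :: 'f
  show "v7_scale c (x + y) = v7_scale c x + v7_scale c y" "v7_scale (c + d) x = v7_scale c x + v7_scale d x"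
    "v7_scale c (v7_scale d x) = v7_scale (c * d) x" "v7_scale 1 x = x"
    by (cases x; cases y; simp add: v7_defs algebra_simps)+
  show "cross7 g (x + y) z = cross7 g x z + cross7 g y z" "cross7 g (v7_scale c x) z = v7_scale c (cross7 g x z)"
    "cross7 g z (x + y) = cross7 g z x + cross7 g z y" "cross7 g z (v7_scale c x) = v7_scale c (cross7 g z x)"
    by (cases x; cases y; cases z; simp add: v7_defs algebra_simps)+
  show "cross7 g x x = 0" by (cases x) (simp add: v7_defs algebra_simps)
  show "form7 g (x + y) z = form7 g x z + form7 g y z" "form7 g (v7_scale c x) z = c * form7 g x z" "form7 g x y = form7 g y x"
    by (cases x; cases y; cases z; simp add: v7_defs algebra_simps)+
  show "form7 g (cross7 g x y) y = 0" by (cases x; cases y; simp add: v7_defs algebra_simps)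
  show "cross7 g (cross7 g x y) y = v7_scale (4 * form7 g x y) y - v7_scale (4 * form7 g y y) x"
    by (cases x; cases y; simp add: v7_defs algebra_simps)
  show "v = (\<Sum>e\<in>basis7. v7_scale (form7 g v e / form7 g e e) e)"
    using nz by (cases v) (simp add: basis7_def v7_defs)
next
  show "finite (basis7 :: 'f v7 set)" by (simp add: basis7_def)
  show "\<exists>e\<in>basis7. \<exists>e'\<in>basis7. (e :: 'f v7) \<noteq> e'"
    by (rule bexI[of _ "(1, 0, 0, 0, 0, 0, 0)"], rule bexI[of _ "(0, 1, 0, 0, 0, 0, 0)"]) (simp_all add: basis7_def)
next
  fix e e' :: "'f v7" assume "e \<in> basis7" "e' \<in> basis7" "e \<noteq> e'"
  thus "form7 g e e' = 0" "\<exists>c\<in>basis7. \<exists>r. cross7 g e e' = v7_scale r c"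
    "\<exists>c\<in>basis7. c \<noteq> e \<and> c \<noteq> e' \<and> form7 g c (cross7 g e e') = 0"
    using nz unfolding basis7_def by (elim insertE emptyE; simp add: v7_defs)+
next
  fix e :: "'f v7" assume "e \<in> basis7"
  thus "form7 g e e \<noteq> 0" using nz by (auto simp: basis7_def v7_defs)
qed (use nz in auto)

lemma (in quotient_by_kernel) obtain_embedding:
  assumes iso: "alg_isomorphic (alg_on scl mult B) Q" and B: "subalgebra scl mult B" and "vector_space scl"
    and onto: "F ` S = UNIV"
  obtains \<iota> :: "'b \<Rightarrow> 'm::ab_group_add" where
    "\<And>v w. \<iota> (v + w) = \<iota> v + \<iota> w" "\<And>c v. \<iota> (sc' c v) = scl c (\<iota> v)"
    "\<And>v w. \<iota> (mu' v w) = mult (\<iota> v) (\<iota> w)" "inj \<iota>" "range \<iota> = B"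
proof -
  interpret m: vector_space scl by fact
  obtain \<phi> where bij: "bij_betw \<phi> B (carrier Q)"
    and \<phi>: "\<And>x y. \<lbrakk>x \<in> B; y \<in> B\<rbrakk> \<Longrightarrow> \<phi> (x + y) = add Q (\<phi> x) (\<phi> y)"
      "\<And>c x. x \<in> B \<Longrightarrow> \<phi> (scl c x) = smul Q c (\<phi> x)"
      "\<And>x y. \<lbrakk>x \<in> B; y \<in> B\<rbrakk> \<Longrightarrow> \<phi> (mult x y) = mul Q (\<phi> x) (\<phi> y)"
    using iso unfolding alg_isomorphic_def alg_on_simps by blast
  define \<iota> where "\<iota> v = inv_into B \<phi> (fib v)" for v
  have c: "bij_betw fib UNIV (carrier Q)" using fib_bij by (simp add: onto)
  have \<iota>: "\<iota> v \<in> B" "\<phi> (\<iota> v) = fib v" for v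
  proof -
    have "fib v \<in> \<phi> ` B" using bij c by (auto simp: bij_betw_def)
    thus "\<iota> v \<in> B" "\<phi> (\<iota> v) = fib v" unfolding \<iota>_def by (rule inv_into_into, rule f_inv_into_f)
  qed
  have eq: "\<iota> v = x" if "x \<in> B" "\<phi> x = fib v" for x v
    using that \<iota> bij by (auto simp: bij_betw_def inj_on_def)
  have closed: "x + y \<in> B" "scl k x \<in> B" "mult x y \<in> B" if "x \<in> B" "y \<in> B" for x y k
    using B that by (auto simp: subalgebra_def m.subspace_add m.subspace_scale)
  show ?thesis
  proof (rule that)
    show "\<iota> (v + w) = \<iota> v + \<iota> w" for v w by (rule eq) (simp_all add: closed \<iota> \<phi> fib_ops onto)
    show "\<iota> (sc' c v) = scl c (\<iota> v)" for c v by (rule eq) (simp_all add: closed[OF \<iota>(1) \<iota>(1)] \<iota> \<phi> fib_ops onto)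
    show "\<iota> (mu' v w) = mult (\<iota> v) (\<iota> w)" for v w by (rule eq) (simp_all add: closed \<iota> \<phi> fib_ops onto)
    show "inj \<iota>" using \<iota>(2) c by (auto simp: inj_on_def bij_betw_def) metis
    show "range \<iota> = B"
    proof (intro equalityI subsetI)
      fix x assume x: "x \<in> B"
      hence "\<phi> x \<in> range fib" using bij c by (auto simp: bij_betw_def)
      then obtain v where "\<phi> x = fib v" by auto
      from eq[OF x this] show "x \<in> range \<iota>" by (metis rangeI)
    qed (use \<iota> in auto)
  qed
qed

definition oct_im :: "'f::field oct \<Rightarrow> 'f v7" where
  "oct_im = (\<lambda>((x0, x1, x2, x3), (y0, y1, y2, y3)). (x1, x2, x3, y0, y1, y2, y3))"

lemmas oct_defs = oct_im_def oct_scale_def oct_mult_def oct_one_def quat_scale_def quat_mult_def quat_conj_def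
  commutator_def v7_defs

lemma oct_vector_space: "vector_space (oct_scale :: 'f::field \<Rightarrow> _)"
  by unfold_locales (auto simp: oct_defs algebra_simps split: prod.split)

lemma oct_quotient:
  fixes g :: "'f::field"
  shows "quotient_by_kernel oct_scale (commutator (oct_mult g)) UNIV (range (\<lambda>k. oct_scale k oct_one)) oct_im v7_scale (cross7 g)"
proof (intro quotient_by_kernel.intro quotient_by_kernel_axioms.intro oct_vector_space)
  interpret vector_space "oct_scale :: 'f \<Rightarrow> _" by (rule oct_vector_space)
  show "subspace UNIV" by (rule subspace_UNIV)
  fix p r :: "'f oct" and c d :: 'f
  show "oct_im (p + r) = oct_im p + oct_im r" "oct_im (oct_scale c p) = v7_scale c (oct_im p)"
    by (auto simp: oct_defs split: prod.split)
  show "oct_im (commutator (oct_mult g) p r) = cross7 g (oct_im p) (oct_im r)"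
    by (auto simp: oct_defs algebra_simps split: prod.split)
  show "p \<in> range (\<lambda>k. oct_scale k oct_one) \<longleftrightarrow> oct_im p = 0"
    by (auto simp: oct_defs split: prod.split)
qed auto

text \<open>The coordinates refer to the matrices \<open>i = (0, \<epsilon>\<^sub>1, -\<epsilon>\<^sub>1, 0)\<close>, \<open>j = (0, \<epsilon>\<^sub>2, -\<epsilon>\<^sub>2, 0)\<close>,
  \<open>k = i j = (0, -\<epsilon>\<^sub>3, \<epsilon>\<^sub>3, 0)\<close> and \<open>v = (1, 0, 0, -1)\<close>, which satisfy the relations of the division
  case with \<open>v\<^sup>2 = 1\<close>; here \<open>\<epsilon>\<^sub>1, \<epsilon>\<^sub>2, \<epsilon>\<^sub>3\<close> is the standard basis.\<close>

definition zorn_im :: "'f::field zorn \<Rightarrow> 'f v7" where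
  "zorn_im = (\<lambda>(a, \<alpha>, \<beta>, b). ((\<alpha> $ 1 - \<beta> $ 1) / 2, (\<alpha> $ 2 - \<beta> $ 2) / 2, (\<beta> $ 3 - \<alpha> $ 3) / 2,
     (a - b) / 2, (\<alpha> $ 1 + \<beta> $ 1) / 2, (\<alpha> $ 2 + \<beta> $ 2) / 2, - (\<alpha> $ 3 + \<beta> $ 3) / 2))"

lemmas zorn_defs = zorn_im_def zorn_scale_def zorn_mult_def zorn_e0_def dot3_def vec_prod3_def commutator_def v7_defs

lemma zorn_vector_space: "vector_space (zorn_scale :: 'f::field \<Rightarrow> _)"
  by unfold_locales (auto simp: zorn_defs vec_eq_iff algebra_simps)

lemma zorn_quotient:
  assumes two: "(2::'f::field) \<noteq> 0"
  shows "quotient_by_kernel zorn_scale (commutator zorn_mult) UNIV (range (\<lambda>k. zorn_scale k zorn_e0))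
    (zorn_im :: 'f zorn \<Rightarrow> _) v7_scale (cross7 1)"
proof (intro quotient_by_kernel.intro quotient_by_kernel_axioms.intro zorn_vector_space)
  interpret vector_space "zorn_scale :: 'f \<Rightarrow> _" by (rule zorn_vector_space)
  show "subspace UNIV" by (rule subspace_UNIV)
  fix p r :: "'f zorn" and c d :: 'f
  show "zorn_im (p + r) = zorn_im p + zorn_im r" "zorn_im (zorn_scale c p) = v7_scale c (zorn_im p)"
    by (cases p; cases r; simp add: zorn_defs add_divide_distrib diff_divide_distrib algebra_simps)+
  show "zorn_im (commutator zorn_mult p r) = cross7 1 (zorn_im p) (zorn_im r)"
  proof -
    \<comment> \<open>Naming the inverse of 2 keeps the goals polynomial.\<close>
    define h where "h = inverse (2::'f)"
    have h: "2 * h = 1" "x / 2 = x * h" for x using two by (simp_all add: h_def field_simps)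
    obtain a \<alpha> \<beta> b where p: "p = (a, \<alpha>, \<beta>, b)" by (cases p)
    obtain c \<gamma> \<delta> d where r: "r = (c, \<gamma>, \<delta>, d)" by (cases r)
    show ?thesis
      unfolding p r zorn_im_def zorn_mult_def commutator_def cross7_def dot3_def vec_prod3_def sum_3 h(2)
      by (simp add: sum_3, intro conjI) (use h(1) in algebra)+
  qed
  show "p \<in> range (\<lambda>k. zorn_scale k zorn_e0) \<longleftrightarrow> zorn_im p = 0"
  proof
    assume z: "zorn_im p = 0"
    obtain a \<alpha> \<beta> b where p: "p = (a, \<alpha>, \<beta>, b)" by (cases p)
    have "\<alpha> $ i = 0 \<and> \<beta> $ i = 0" if "\<alpha> $ i = \<beta> $ i" "\<alpha> $ i + \<beta> $ i = 0" for i
      using that two by (simp flip: mult_2)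
    with z two have "\<alpha> = 0" "\<beta> = 0" "a = b" by (auto simp: p zorn_defs vec_eq_iff forall_3)
    hence "p = zorn_scale a zorn_e0" by (simp add: p zorn_defs)
    thus "p \<in> range (\<lambda>k. zorn_scale k zorn_e0)" by blast
  qed (auto simp: zorn_defs)
qed auto

section \<open>The decomposition theorem\<close>

lemma two_three_neq_0:
  assumes "CHAR('f::field) \<noteq> 2" "CHAR('f) \<noteq> 3"
  shows "(2::'f) \<noteq> 0" "(3::'f) \<noteq> 0"
proof -
  have "CHAR('f) \<noteq> 1" using of_nat_eq_0_iff_char_dvd[of 1, where 'a = 'f] by auto
  have "\<not> CHAR('f) dvd n" if "n = 2 \<or> n = 3" for n
  proof
    assume d: "CHAR('f) dvd n"
    hence "CHAR('f) \<le> 3" using dvd_imp_le[OF d] that by auto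
    hence "CHAR('f) = 0 \<or> CHAR('f) = 1 \<or> CHAR('f) = 2 \<or> CHAR('f) = 3" by linarith
    thus False using d that assms \<open>CHAR('f) \<noteq> 1\<close> by auto
  qed
  hence "\<not> CHAR('f) dvd 2" "\<not> CHAR('f) dvd 3" by blast+
  thus "(2::'f) \<noteq> 0" "(3::'f) \<noteq> 0"
    using of_nat_eq_0_iff_char_dvd[of 2, where 'a = 'f] of_nat_eq_0_iff_char_dvd[of 3, where 'a = 'f] by auto
qed

theorem theorem3p2:
  fixes scl :: "'f::field \<Rightarrow> 'm::ab_group_add \<Rightarrow> 'm"
    and mult :: "'m \<Rightarrow> 'm \<Rightarrow> 'm"
    and B :: "'m set"
  assumes "CHAR('f) \<noteq> 2" and "CHAR('f) \<noteq> 3"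
    and "malcev_algebra_H scl mult"
    and "subalgebra scl mult B"
    and "exceptional_malcev (alg_on scl mult B)"
  shows "alg_ideal scl mult (jacobian_annihilator mult B) \<and>
    (\<exists>A :: ('f, 'm) alg. comm_assoc_algebra A \<and>
      alg_isomorphic (alg_on scl mult UNIV)
        (direct_sum (tensor_alg (alg_on scl mult B) A)
          (alg_on scl mult (jacobian_annihilator mult B))))"
proof -
  note nz = two_three_neq_0[OF assms(1,2)]
  interpret H: malcev_algebra_H scl mult by fact
  have vs: "vector_space scl" by unfold_locales
  have main: ?thesis
    if g: "g \<noteq> 0" and "\<And>v w. \<iota> (v + w) = \<iota> v + \<iota> w" "\<And>c v. \<iota> (v7_scale c v) = scl c (\<iota> v)"
      "\<And>v w. \<iota> (cross7 g v w) = mult (\<iota> v) (\<iota> w)" "inj \<iota>" and B: "range \<iota> = B"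
    for g and \<iota> :: "'f v7 \<Rightarrow> 'm"
  proof -
    interpret malcev_over_cross scl mult v7_scale "cross7 g" "form7 g" basis7 \<iota>
      by (intro malcev_over_cross.intro malcev_over_cross_axioms.intro cross7_cross_product_space)
        (use that nz assms in auto)
    show ?thesis
      using ann_ideal decomposition_iso comm_assoc_coord_alg unfolding ann_eq_jacobian_annihilator[symmetric] B by blast
  qed
  from assms(5)[unfolded exceptional_malcev_def] show ?thesis
  proof (elim disjE exE conjE)
    assume iso: "alg_isomorphic (alg_on scl mult B) (split_M7 :: ('f, 'f zorn set) alg)"
    interpret q: quotient_by_kernel zorn_scale "commutator zorn_mult" UNIV "range (\<lambda>k. zorn_scale k zorn_e0)"
      "zorn_im :: 'f zorn \<Rightarrow> _" v7_scale "cross7 1" by (rule zorn_quotient[OF nz(1)])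
    have "v \<in> range (zorn_im :: 'f zorn \<Rightarrow> _)" for v :: "'f v7"
    proof -
      obtain x1 x2 x3 y0 y1 y2 y3 where v: "v = (x1, x2, x3, y0, y1, y2, y3)" by (cases v)
      have "v = zorn_im (y0, vector [x1 + y1, x2 + y2, - (x3 + y3)], vector [y1 - x1, y2 - x2, x3 - y3], - y0)"
        using nz by (simp add: v zorn_im_def field_simps)
      thus ?thesis by blast
    qed
    hence onto: "range (zorn_im :: 'f zorn \<Rightarrow> _) = UNIV" by auto
    show ?thesis
    proof (rule q.obtain_embedding[OF iso[unfolded split_M7_def] assms(4) vs onto])
      fix \<iota> :: "'f v7 \<Rightarrow> 'm"
      assume "\<And>v w. \<iota> (v + w) = \<iota> v + \<iota> w" "\<And>c v. \<iota> (v7_scale c v) = scl c (\<iota> v)"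
        "\<And>v w. \<iota> (cross7 1 v w) = mult (\<iota> v) (\<iota> w)" "inj \<iota>" "range \<iota> = B"
      from main[OF one_neq_zero this] show ?thesis .
    qed
  next
    fix g assume g: "g \<noteq> 0" and iso: "alg_isomorphic (alg_on scl mult B) (division_M7 g)"
    interpret q: quotient_by_kernel oct_scale "commutator (oct_mult g)" UNIV "range (\<lambda>k. oct_scale k oct_one)"
      oct_im v7_scale "cross7 g" by (rule oct_quotient)
    have "v \<in> range (oct_im :: 'f oct \<Rightarrow> _)" for v :: "'f v7"
    proof -
      have "v = oct_im ((0, fst v, fst (snd v), fst (snd (snd v))), snd (snd (snd v)))"
        by (cases v) (simp add: oct_im_def)
      thus ?thesis by (rule range_eqI)
    qed
    hence onto: "range (oct_im :: 'f oct \<Rightarrow> _) = UNIV" by auto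
    show ?thesis
    proof (rule q.obtain_embedding[OF iso[unfolded division_M7_def] assms(4) vs onto])
      fix \<iota> :: "'f v7 \<Rightarrow> 'm"
      assume "\<And>v w. \<iota> (v + w) = \<iota> v + \<iota> w" "\<And>c v. \<iota> (v7_scale c v) = scl c (\<iota> v)"
        "\<And>v w. \<iota> (cross7 g v w) = mult (\<iota> v) (\<iota> w)" "inj \<iota>" "range \<iota> = B"
      from main[OF g this] show ?thesis .
    qed
  qed
qed

end
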